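(* Let us apply a Runge--Kutta scheme $\Phi^1_{\Delta t}$, resp. $\Phi^2_{\Delta t}$, with coefficients satisfying $$b_ia_{ij}+b_ja_{ji}=b_ib_j\qquad\text{for all } i,j=1,\dots,s,$$ to the system $\bar Y_t=\bar G_1(\bar Y)$, resp. $\bar Y_t=\bar G_2(\bar Y)$, with time step size $\Delta t$. Then the Lie--Trotter splitting $$\Phi_{\Delta t}:=\Phi^2_{\Delta t}\circ\Phi^1_{\Delta t}$$ has order of convergence one and preserves all the invariants $\bar I_i$ for $i=-N,\dots,N-1$. The Strang splitting $$\Phi_{\Delta t}:=\Phi^1_{\Delta t/2}\circ\Phi^2_{\Delta t}\circ\Phi^1_{\Delta t/2}$$ is symmetric, has thus order of convergence two, and preserves all the invariants $\bar I_i$ for $i=-N,\dots,N-1$.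
   Context: Fix $\gamma\in\mathbb{R}$, $\Delta\xi>0$, $N\in\mathbb{N}$, $R=N\Delta\xi$, $\xi_i=i\Delta\xi$. The unknown is $\bar Y=(\zeta_i,U_i,H_i,q_i,w_i,h_i)_{i=-N}^{N-1}\in\mathbb{R}^{2N\times6}$. It is identified with functions of $\xi$ that are piecewise constant on the cells $[\xi_i,\xi_{i+1})$, $-N\le i\le N-1$, with $U=w=h=0$ and $q=1$ outside $[-R,R)$ and $\zeta$ constant on $(-\infty,-R)$ and on $[R,\infty)$; put $y(\xi)=\xi+\zeta(\xi)$. Then $P_i=P(\xi_i)$, $Q_i=Q(\xi_i)$ where $P(\xi)=\frac12\int_{\mathbb{R}}e^{-\mathrm{sgn}(\xi-\eta)(y(\xi)-y(\eta))}\left(\frac{3-2\gamma}{2}U^2q+\frac{\gamma}{2}h\right)(\eta)\,d\eta$, $Q(\xi)=-\frac12\int_{\mathbb{R}}\mathrm{sgn}(\xi-\eta)e^{-\mathrm{sgn}(\xi-\eta)(y(\xi)-y(\eta))}\left(\frac{3-2\gamma}{2}U^2q+\frac{\gamma}{2}h\right)(\eta)\,d\eta$; these depend only on $\bar Y$. System $\bar Y_t=\bar G_1(\bar Y)$: for $i=-N,\dots,N-1$, $\zeta_{i,t}=U_{i,t}=H_{i,t}=0$, $q_{i,t}=\gamma w_i$, $w_{i,t}=\frac{\gamma}{2}h_i+\left(\frac{3-2\gamma}{2}U_i^2-P_i\right)q_i$, $h_{i,t}=(3U_i^2-2P_i)w_i$. System $\bar Y_t=\bar G_2(\bar Y)$: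 for $i=-N,\dots,N-1$, $\zeta_{i,t}=\gamma U_i$, $U_{i,t}=-Q_i$, $H_{i,t}=U_i^3-2P_iU_i$, $q_{i,t}=w_{i,t}=0$, $h_{i,t}=-2Q_iU_iq_i$. The splittings are numerical methods for the semi-discrete system $\bar Y_t=\bar G_1(\bar Y)+\bar G_2(\bar Y)$. Invariants: $\bar I_i(\bar Y)=U_i^2q_i^2+w_i^2-q_ih_i$. A Runge--Kutta scheme with coefficients $(a_{ij},b_j)_{i,j=1}^s$ for $Y_t=f(Y)$ is $Y_1=Y_0+\Delta t\sum_{j=1}^sb_jK_j$, $K_i=f(Y_0+\Delta t\sum_{j=1}^sa_{ij}K_j)$. A one-step method $\Phi_{\Delta t}$ is symmetric if $\Phi_{\Delta t}\circ\Phi_{-\Delta t}=\mathrm{Id}$. Order of convergence is understood in the usual sense for one-step methods for ordinary differential equations (in the time step $\Delta t$).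
   Formalization: Symmetry of the Strang splitting is claimed only when both Runge–Kutta schemes are symmetric (it fails for non-symmetric schemes satisfying the coefficient condition), and both order claims assume consistency, that the b_j sum to 1 (b=0 is a counterexample). *)

theory Defs
  imports "HOL-Analysis.Analysis"
begin

text \<open>
  The unknowns are indexed by a finite type \<open>'n\<close>, which a bijection \<open>ix\<close> identifies with
  \<open>{-N..<N}\<close>. A state is the tuple \<open>(\<zeta>, U, H, q, w, h)\<close> of six vectors.
\<close>

type_synonym 'n state =
  "(real^'n) \<times> (real^'n) \<times> (real^'n) \<times> (real^'n) \<times> (real^'n) \<times> (real^'n)"

definition cell :: "real \<Rightarrow> ('n \<Rightarrow> int) \<Rightarrow> 'n \<Rightarrow> real set" where
  "cell \<Delta>\<xi> ix i = {of_int (ix i) * \<Delta>\<xi> ..< of_int (ix i + 1) * \<Delta>\<xi>}"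

definition pc :: "nat \<Rightarrow> real \<Rightarrow> ('n::finite \<Rightarrow> int) \<Rightarrow> real \<Rightarrow> real^'n \<Rightarrow> real \<Rightarrow> real \<Rightarrow> real" where
  "pc N \<Delta>\<xi> ix l v r \<xi> =
     (if \<xi> < - (real N * \<Delta>\<xi>) then l
      else if real N * \<Delta>\<xi> \<le> \<xi> then r
      else v $ (THE i. \<xi> \<in> cell \<Delta>\<xi> ix i))"

text \<open>
  \<open>zl\<close> and \<open>zr\<close> are the constant values of \<open>\<zeta>\<close> to the left and to the right of the grid. The data
  do not determine them; they do not influence \<open>P\<close> and \<open>Q\<close> at the grid points, because outside the grid
  \<open>U\<close> and \<open>h\<close> vanish.
\<close>

fun y_fun :: "nat \<Rightarrow> real \<Rightarrow> ('n::finite \<Rightarrow> int) \<Rightarrow> real \<Rightarrow> real \<Rightarrow> 'n state \<Rightarrow> real \<Rightarrow> real" where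
  "y_fun N \<Delta>\<xi> ix zl zr (\<zeta>, U, H, q, w, h) \<xi> = \<xi> + pc N \<Delta>\<xi> ix zl \<zeta> zr \<xi>"

fun source :: "real \<Rightarrow> nat \<Rightarrow> real \<Rightarrow> ('n::finite \<Rightarrow> int) \<Rightarrow> 'n state \<Rightarrow> real \<Rightarrow> real" where
  "source \<gamma> N \<Delta>\<xi> ix (\<zeta>, U, H, q, w, h) \<eta> =
     (3 - 2 * \<gamma>) / 2 * (pc N \<Delta>\<xi> ix 0 U 0 \<eta>)\<^sup>2 * pc N \<Delta>\<xi> ix 1 q 1 \<eta>
       + \<gamma> / 2 * pc N \<Delta>\<xi> ix 0 h 0 \<eta>"

definition P_fun ::
    "real \<Rightarrow> nat \<Rightarrow> real \<Rightarrow> ('n::finite \<Rightarrow> int) \<Rightarrow> real \<Rightarrow> real \<Rightarrow> 'n state \<Rightarrow> real \<Rightarrow> real" where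
  "P_fun \<gamma> N \<Delta>\<xi> ix zl zr Y \<xi> =
     1 / 2 * (LINT \<eta>|lborel.
       exp (- sgn (\<xi> - \<eta>) * (y_fun N \<Delta>\<xi> ix zl zr Y \<xi> - y_fun N \<Delta>\<xi> ix zl zr Y \<eta>))
         * source \<gamma> N \<Delta>\<xi> ix Y \<eta>)"

definition Q_fun ::
    "real \<Rightarrow> nat \<Rightarrow> real \<Rightarrow> ('n::finite \<Rightarrow> int) \<Rightarrow> real \<Rightarrow> real \<Rightarrow> 'n state \<Rightarrow> real \<Rightarrow> real" where
  "Q_fun \<gamma> N \<Delta>\<xi> ix zl zr Y \<xi> =
     - (1 / 2) * (LINT \<eta>|lborel.
       sgn (\<xi> - \<eta>)
         * exp (- sgn (\<xi> - \<eta>) * (y_fun N \<Delta>\<xi> ix zl zr Y \<xi> - y_fun N \<Delta>\<xi> ix zl zr Y \<eta>))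
         * source \<gamma> N \<Delta>\<xi> ix Y \<eta>)"

definition P_vec ::
    "real \<Rightarrow> nat \<Rightarrow> real \<Rightarrow> ('n::finite \<Rightarrow> int) \<Rightarrow> real \<Rightarrow> real \<Rightarrow> 'n state \<Rightarrow> real^'n" where
  "P_vec \<gamma> N \<Delta>\<xi> ix zl zr Y = (\<chi> i. P_fun \<gamma> N \<Delta>\<xi> ix zl zr Y (of_int (ix i) * \<Delta>\<xi>))"

definition Q_vec ::
    "real \<Rightarrow> nat \<Rightarrow> real \<Rightarrow> ('n::finite \<Rightarrow> int) \<Rightarrow> real \<Rightarrow> real \<Rightarrow> 'n state \<Rightarrow> real^'n" where
  "Q_vec \<gamma> N \<Delta>\<xi> ix zl zr Y = (\<chi> i. Q_fun \<gamma> N \<Delta>\<xi> ix zl zr Y (of_int (ix i) * \<Delta>\<xi>))"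

fun G1 ::
    "real \<Rightarrow> nat \<Rightarrow> real \<Rightarrow> ('n::finite \<Rightarrow> int) \<Rightarrow> real \<Rightarrow> real \<Rightarrow> 'n state \<Rightarrow> 'n state" where
  "G1 \<gamma> N \<Delta>\<xi> ix zl zr (\<zeta>, U, H, q, w, h) =
     (let P = P_vec \<gamma> N \<Delta>\<xi> ix zl zr (\<zeta>, U, H, q, w, h) in
       (0, 0, 0,
        (\<chi> i. \<gamma> * w $ i),
        (\<chi> i. \<gamma> / 2 * h $ i + ((3 - 2 * \<gamma>) / 2 * (U $ i)\<^sup>2 - P $ i) * q $ i),
        (\<chi> i. (3 * (U $ i)\<^sup>2 - 2 * P $ i) * w $ i)))"

fun G2 ::
    "real \<Rightarrow> nat \<Rightarrow> real \<Rightarrow> ('n::finite \<Rightarrow> int) \<Rightarrow> real \<Rightarrow> real \<Rightarrow> 'n state \<Rightarrow> 'n state" where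
  "G2 \<gamma> N \<Delta>\<xi> ix zl zr (\<zeta>, U, H, q, w, h) =
     (let P = P_vec \<gamma> N \<Delta>\<xi> ix zl zr (\<zeta>, U, H, q, w, h);
          Q = Q_vec \<gamma> N \<Delta>\<xi> ix zl zr (\<zeta>, U, H, q, w, h) in
       ((\<chi> i. \<gamma> * U $ i),
        (\<chi> i. - Q $ i),
        (\<chi> i. (U $ i) ^ 3 - 2 * P $ i * U $ i),
        0, 0,
        (\<chi> i. - 2 * Q $ i * U $ i * q $ i)))"

fun inv_I :: "'n::finite \<Rightarrow> 'n state \<Rightarrow> real" where
  "inv_I i (\<zeta>, U, H, q, w, h) = (U $ i)\<^sup>2 * (q $ i)\<^sup>2 + (w $ i)\<^sup>2 - q $ i * h $ i"

text \<open>
  One step of an implicit scheme need not exist for every step size and every state, so a one-step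
  method is a family of partial maps, composed with \<open>\<circ>\<^sub>m\<close>.
\<close>

type_synonym 'a one_step = "real \<Rightarrow> 'a \<rightharpoonup> 'a"

definition rk_stages ::
    "nat \<Rightarrow> (nat \<Rightarrow> nat \<Rightarrow> real) \<Rightarrow> ('a::real_normed_vector \<Rightarrow> 'a) \<Rightarrow> real \<Rightarrow> 'a \<Rightarrow> (nat \<Rightarrow> 'a) \<Rightarrow> bool"
  where
  "rk_stages s a f dt Y K \<longleftrightarrow> (\<forall>i<s. K i = f (Y + dt *\<^sub>R (\<Sum>j<s. a i j *\<^sub>R K j)))"

definition rk_update ::
    "nat \<Rightarrow> (nat \<Rightarrow> real) \<Rightarrow> real \<Rightarrow> 'a::real_normed_vector \<Rightarrow> (nat \<Rightarrow> 'a) \<Rightarrow> 'a" where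
  "rk_update s b dt Y K = Y + dt *\<^sub>R (\<Sum>j<s. b j *\<^sub>R K j)"

text \<open>
  The stage equations of an implicit scheme may have several solutions, some of them unbounded as
  the step size tends to 0. \<open>\<Phi>\<close> realises the scheme if every step it performs comes from a solution
  of the stage equations, and if for small steps, locally uniformly in the state, the step is
  performed with stages that stay bounded.
\<close>

definition rk_method ::
    "nat \<Rightarrow> (nat \<Rightarrow> nat \<Rightarrow> real) \<Rightarrow> (nat \<Rightarrow> real) \<Rightarrow> ('a::real_normed_vector \<Rightarrow> 'a) \<Rightarrow> 'a one_step \<Rightarrow> bool"
  where
  "rk_method s a b f \<Phi> \<longleftrightarrow>
     (\<forall>dt Y Y1. \<Phi> dt Y = Some Y1 \<longrightarrow>
        (\<exists>K. rk_stages s a f dt Y K \<and> Y1 = rk_update s b dt Y K)) \<and>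
     (\<forall>B. bounded B \<longrightarrow>
        (\<exists>\<delta>>0. \<exists>M. \<forall>dt Y. \<bar>dt\<bar> \<le> \<delta> \<and> Y \<in> B \<longrightarrow>
           (\<exists>K. rk_stages s a f dt Y K \<and> (\<forall>i<s. norm (K i) \<le> M) \<and>
                \<Phi> dt Y = Some (rk_update s b dt Y K))))"

text \<open>
  The adjoint of a Runge--Kutta scheme is the scheme with coefficients
  \<open>b\<^sub>s\<^sub>+\<^sub>1\<^sub>-\<^sub>j - a\<^sub>s\<^sub>+\<^sub>1\<^sub>-\<^sub>i\<^sub>,\<^sub>s\<^sub>+\<^sub>1\<^sub>-\<^sub>j\<close> and \<open>b\<^sub>s\<^sub>+\<^sub>1\<^sub>-\<^sub>j\<close>; the scheme is symmetric if these are its own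
  coefficients. Here the stages are numbered from 0.
\<close>

definition rk_symmetric :: "nat \<Rightarrow> (nat \<Rightarrow> nat \<Rightarrow> real) \<Rightarrow> (nat \<Rightarrow> real) \<Rightarrow> bool" where
  "rk_symmetric s a b \<longleftrightarrow>
     (\<forall>i<s. \<forall>j<s. a i j = b (s - 1 - j) - a (s - 1 - i) (s - 1 - j)) \<and>
     (\<forall>j<s. b j = b (s - 1 - j))"

definition lie_trotter :: "'a one_step \<Rightarrow> 'a one_step \<Rightarrow> 'a one_step" where
  "lie_trotter \<Phi>1 \<Phi>2 dt = \<Phi>2 dt \<circ>\<^sub>m \<Phi>1 dt"

definition strang :: "'a one_step \<Rightarrow> 'a one_step \<Rightarrow> 'a one_step" where
  "strang \<Phi>1 \<Phi>2 dt = \<Phi>1 (dt / 2) \<circ>\<^sub>m (\<Phi>2 dt \<circ>\<^sub>m \<Phi>1 (dt / 2))"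

text \<open>The identity \<open>\<Phi> dt \<circ> \<Phi> (- dt) = Id\<close>, for small steps, locally uniformly in the state.\<close>

definition symmetric_method :: "'a::real_normed_vector one_step \<Rightarrow> bool" where
  "symmetric_method \<Phi> \<longleftrightarrow>
     (\<forall>B. bounded B \<longrightarrow>
        (\<exists>\<delta>>0. \<forall>dt Y. \<bar>dt\<bar> \<le> \<delta> \<and> Y \<in> B \<longrightarrow> (\<Phi> dt \<circ>\<^sub>m \<Phi> (- dt)) Y = Some Y))"

definition preserves :: "'a one_step \<Rightarrow> ('a \<Rightarrow> real) \<Rightarrow> bool" where
  "preserves \<Phi> I \<longleftrightarrow> (\<forall>dt Y Y1. \<Phi> dt Y = Some Y1 \<longrightarrow> I Y1 = I Y)"

fun iterate :: "('a \<rightharpoonup> 'a) \<Rightarrow> nat \<Rightarrow> 'a \<rightharpoonup> 'a" where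
  "iterate F 0 = Some"
| "iterate F (Suc n) = F \<circ>\<^sub>m iterate F n"

definition ode_solution :: "('a::real_normed_vector \<Rightarrow> 'a) \<Rightarrow> real \<Rightarrow> (real \<Rightarrow> 'a) \<Rightarrow> bool" where
  "ode_solution f T Y \<longleftrightarrow>
     (\<forall>t\<in>{0..T}. (Y has_vector_derivative f (Y t)) (at t within {0..T}))"

text \<open>
  The global error on every compact time interval on which the exact solution exists is
  \<open>O(dt\<^sup>p)\<close>; in particular the numerical solution is defined there for small step sizes.
\<close>

definition convergence_order ::
    "('a::real_normed_vector \<Rightarrow> 'a) \<Rightarrow> 'a one_step \<Rightarrow> nat \<Rightarrow> bool" where
  "convergence_order f \<Phi> p \<longleftrightarrow>
     (\<forall>T Y. 0 \<le> T \<and> ode_solution f T Y \<longrightarrow>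
        (\<exists>C. \<exists>\<delta>>0. \<forall>dt n. 0 < dt \<and> dt \<le> \<delta> \<and> real n * dt \<le> T \<longrightarrow>
           (\<exists>Z. iterate (\<Phi> dt) n (Y 0) = Some Z \<and> norm (Z - Y (real n * dt)) \<le> C * dt ^ p)))"

end

theory Submission
  imports Defs
begin

text \<open>
  Three observations carry the theorem.

  \<^emph>\<open>The vector fields are smooth.\<close> On a cell of the grid the data are constant, so the integrals
  defining \<open>P\<close> and \<open>Q\<close> at the grid points collapse to finite sums in which the state enters only through
  polynomials and exponentials of differences \<open>\<zeta>\<^sub>i - \<zeta>\<^sub>j\<close> (\<open>kernel_integral\<close>). Both fields therefore have
  first-order Taylor expansions with quadratic remainder, uniformly on balls (\<open>G1_quad_smooth\<close>,
  \<open>G2_quad_smooth\<close>). That is all the regularity the numerical analysis uses: the stage equations of a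
  Runge--Kutta scheme are solved by a contraction (\<open>rk_method_exists\<close>), bounded stages are unique and
  depend on the state in a Lipschitz way (\<open>rk_stages_stable\<close>), and a step has a Taylor expansion
  (\<open>rk_method_expands\<close>).

  \<^emph>\<open>The condition on the coefficients does two things.\<close> It makes a Runge--Kutta step preserve every quadratic
  form that is constant along the flow (\<open>rk_preserves_quadratic\<close>). The invariants are polynomials of degree four, but
  the first system leaves \<open>U\<close> fixed and the second leaves \<open>q\<close> fixed, and in the remaining variables they
  are quadratic. Moreover, summed over all pairs of stages, the condition is the order condition
  \<open>\<Sum>\<^sub>i b\<^sub>i c\<^sub>i = 1/2\<close>, \<open>c\<^sub>i = \<Sum>\<^sub>j a\<^sub>i\<^sub>j\<close> (\<open>symplectic_order2\<close>): a consistent scheme of this kind has order two.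

  \<^emph>\<open>Splitting and convergence.\<close> With both substeps of order two, expanding the Lie--Trotter composition
  reproduces the exact solution up to \<open>O(h\<^sup>2)\<close> and the Strang composition up to \<open>O(h\<^sup>3)\<close>, where the
  symmetric arrangement makes all four second-order products \<open>D\<^sub>i f\<^sub>j\<close> appear with weight \<open>1/2\<close>
  (\<open>strang_local_error\<close>). Stability of the steps turns local into global errors
  (\<open>stable_step_convergence\<close>). Symmetry of the Strang splitting is cancellation from the inside out
  (\<open>strang_symmetric\<close>), and a scheme with symmetric coefficients is symmetric because its stages, read
  backwards, solve the stage equations of the reversed step
  (\<open>rk_symmetric_imp_symmetric_method\<close>).
\<close>

section \<open>Functions with a second-order remainder on balls\<close>

text \<open>
  The regularity notion of the whole development, essentially class \<open>C\<^sup>1\<^sup>,\<^sup>1\<close> on balls. It is phrased by the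
  Taylor remainder since this is the form in which local errors consume it, and it is stable under
  composition, which makes checking it for concrete formulas mechanical.
\<close>

definition quad_deriv ::
    "('a::real_normed_vector \<Rightarrow> 'b::real_normed_vector) \<Rightarrow> ('a \<Rightarrow> 'a \<Rightarrow> 'b) \<Rightarrow> bool" where
  "quad_deriv f D \<longleftrightarrow>
     (\<forall>x. linear (D x)) \<and>
     (\<forall>R. \<exists>C\<ge>0. \<forall>x z. norm x \<le> R \<longrightarrow> norm z \<le> R \<longrightarrow>
        (\<forall>v. norm (D x v) \<le> C * norm v) \<and>
        norm (f z - f x - D x (z - x)) \<le> C * (norm (z - x))\<^sup>2)"

definition quad_smooth :: "('a::real_normed_vector \<Rightarrow> 'b::real_normed_vector) \<Rightarrow> bool" where
  "quad_smooth f \<longleftrightarrow> (\<exists>D. quad_deriv f D)"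

lemma quad_derivE:
  assumes "quad_deriv f D"
  obtains C where "C \<ge> 0"
    "\<And>x v. norm x \<le> R \<Longrightarrow> norm (D x v) \<le> C * norm v"
    "\<And>x z. norm x \<le> R \<Longrightarrow> norm z \<le> R \<Longrightarrow>
       norm (f z - f x - D x (z - x)) \<le> C * (norm (z - x))\<^sup>2"
proof -
  obtain C where "C \<ge> 0" and C: "\<forall>x z. norm x \<le> R \<longrightarrow> norm z \<le> R \<longrightarrow>
        (\<forall>v. norm (D x v) \<le> C * norm v) \<and>
        norm (f z - f x - D x (z - x)) \<le> C * (norm (z - x))\<^sup>2"
    using assms unfolding quad_deriv_def by meson
  then show ?thesis by (intro that[of C]) blast+
qed

lemma quad_derivI:
  assumes "\<And>x. linear (D x)"
    and "\<And>R. R \<ge> 0 \<Longrightarrow> \<exists>C\<ge>0. \<forall>x z. norm x \<le> R \<longrightarrow> norm z \<le> R \<longrightarrow>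
        (\<forall>v. norm (D x v) \<le> C * norm v) \<and>
        norm (f z - f x - D x (z - x)) \<le> C * (norm (z - x))\<^sup>2"
  shows "quad_deriv f D"
  unfolding quad_deriv_def
proof (intro conjI allI)
  fix R :: real
  show "\<exists>C\<ge>0. \<forall>x z. norm x \<le> R \<longrightarrow> norm z \<le> R \<longrightarrow>
        (\<forall>v. norm (D x v) \<le> C * norm v) \<and>
        norm (f z - f x - D x (z - x)) \<le> C * (norm (z - x))\<^sup>2"
  proof (cases "R \<ge> 0")
    case False
    then have "\<not> norm x \<le> R" for x :: 'a
      using norm_ge_zero[of x] by linarith
    then show ?thesis by (intro exI[of _ 0]) auto
  qed (use assms(2) in blast)
qed (use assms(1) in blast)

lemma quad_deriv_lipschitz:
  assumes "quad_deriv f D"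
  obtains L where "L \<ge> 0"
    "\<And>x z. norm x \<le> R \<Longrightarrow> norm z \<le> R \<Longrightarrow> norm (f z - f x) \<le> L * norm (z - x)"
proof -
  obtain C where C: "C \<ge> 0"
    "\<And>x v. norm x \<le> R \<Longrightarrow> norm (D x v) \<le> C * norm v"
    "\<And>x z. norm x \<le> R \<Longrightarrow> norm z \<le> R \<Longrightarrow>
       norm (f z - f x - D x (z - x)) \<le> C * (norm (z - x))\<^sup>2"
    using quad_derivE[OF assms, where R = R] by blast
  show ?thesis
  proof (rule that[of "C + C * (2 * \<bar>R\<bar>)"])
    show "C + C * (2 * \<bar>R\<bar>) \<ge> 0" using C(1) by simp
    fix x z :: 'a assume xz: "norm x \<le> R" "norm z \<le> R"
    have "norm (z - x) \<le> 2 * \<bar>R\<bar>"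
      using norm_triangle_ineq4[of z x] xz by linarith
    then have "C * (norm (z - x))\<^sup>2 \<le> C * (2 * \<bar>R\<bar>) * norm (z - x)"
      unfolding power2_eq_square using C(1)
      by (metis mult.assoc mult_left_mono mult_right_mono norm_ge_zero)
    moreover have "norm (f z - f x) \<le> norm (f z - f x - D x (z - x)) + norm (D x (z - x))"
      using norm_triangle_ineq[of "f z - f x - D x (z - x)" "D x (z - x)"] by simp
    ultimately show "norm (f z - f x) \<le> (C + C * (2 * \<bar>R\<bar>)) * norm (z - x)"
      using C(3)[OF xz] C(2)[OF xz(1), of "z - x"] by (simp add: algebra_simps)
  qed
qed

lemma quad_deriv_bounded:
  assumes "quad_deriv f D"
  obtains F where "F \<ge> 0" "\<And>x. norm x \<le> R \<Longrightarrow> norm (f x) \<le> F"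
proof -
  obtain L where L: "L \<ge> 0"
    "\<And>x z. norm x \<le> \<bar>R\<bar> \<Longrightarrow> norm z \<le> \<bar>R\<bar> \<Longrightarrow> norm (f z - f x) \<le> L * norm (z - x)"
    using quad_deriv_lipschitz[OF assms, where R = "\<bar>R\<bar>"] by blast
  show ?thesis
  proof (rule that[of "norm (f 0) + L * \<bar>R\<bar>"])
    fix x :: 'a assume "norm x \<le> R"
    then have "norm (f x - f 0) \<le> L * \<bar>R\<bar>"
      using L(2)[of 0 x] mult_left_mono[OF _ L(1), of "norm x" "\<bar>R\<bar>"] by force
    then show "norm (f x) \<le> norm (f 0) + L * \<bar>R\<bar>"
      using norm_triangle_sub[of "f x" "f 0"] by linarith
  qed (use L(1) in simp)
qed

lemma quad_deriv_compose:
  fixes f :: "'b::real_normed_vector \<Rightarrow> 'c::real_normed_vector"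
    and g :: "'a::real_normed_vector \<Rightarrow> 'b"
  assumes f: "quad_deriv f D" and g: "quad_deriv g E"
  shows "quad_deriv (\<lambda>x. f (g x)) (\<lambda>x v. D (g x) (E x v))"
proof (rule quad_derivI)
  have lin: "linear (D y)" "linear (E x)" for x y
    using f g by (auto simp: quad_deriv_def)
  show "linear (\<lambda>v. D (g x) (E x v))" for x
    using linear_compose[OF lin(2) lin(1)] by (simp add: o_def)
  fix R :: real assume "R \<ge> 0"
  obtain S where S: "S \<ge> 0" "\<And>x. norm x \<le> R \<Longrightarrow> norm (g x) \<le> S"
    using quad_deriv_bounded[OF g, where R = R] by blast
  obtain L where L: "L \<ge> 0"
    "\<And>x z. norm x \<le> R \<Longrightarrow> norm z \<le> R \<Longrightarrow> norm (g z - g x) \<le> L * norm (z - x)"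
    using quad_deriv_lipschitz[OF g, where R = R] by blast
  obtain B where B: "B \<ge> 0"
    "\<And>x v. norm x \<le> R \<Longrightarrow> norm (E x v) \<le> B * norm v"
    "\<And>x z. norm x \<le> R \<Longrightarrow> norm z \<le> R \<Longrightarrow>
       norm (g z - g x - E x (z - x)) \<le> B * (norm (z - x))\<^sup>2"
    using quad_derivE[OF g, where R = R] by blast
  obtain C where C: "C \<ge> 0"
    "\<And>x v. norm x \<le> S \<Longrightarrow> norm (D x v) \<le> C * norm v"
    "\<And>x z. norm x \<le> S \<Longrightarrow> norm z \<le> S \<Longrightarrow>
       norm (f z - f x - D x (z - x)) \<le> C * (norm (z - x))\<^sup>2"
    using quad_derivE[OF f, where R = S] by blast
  have bound: "norm (D (g x) (E x v)) \<le> C * B * norm v" if "norm x \<le> R" for x v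
    using C(2)[OF S(2)[OF that], of "E x v"] mult_left_mono[OF B(2)[OF that, of v] C(1)]
    by (simp add: mult.assoc)
  have rem: "norm (f (g z) - f (g x) - D (g x) (E x (z - x))) \<le> (C * L\<^sup>2 + C * B) * (norm (z - x))\<^sup>2"
    if xz: "norm x \<le> R" "norm z \<le> R" for x z
  proof -
    have "f (g z) - f (g x) - D (g x) (E x (z - x)) =
        (f (g z) - f (g x) - D (g x) (g z - g x)) + D (g x) (g z - g x - E x (z - x))"
      using linear_diff[OF lin(1), of "g x" "g z - g x" "E x (z - x)"] by simp
    also have "norm \<dots> \<le> C * (norm (g z - g x))\<^sup>2 + C * norm (g z - g x - E x (z - x))"
      using norm_triangle_ineq C(3)[OF S(2)[OF xz(1)] S(2)[OF xz(2)]] C(2)[OF S(2)[OF xz(1)]]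
      by (meson add_mono order_trans)
    also have "\<dots> \<le> C * (L * norm (z - x))\<^sup>2 + C * (B * (norm (z - x))\<^sup>2)"
      by (intro add_mono mult_left_mono power_mono L(2) B(3) xz C(1)) simp
    finally show ?thesis by (simp add: algebra_simps power_mult_distrib)
  qed
  show "\<exists>K\<ge>0. \<forall>x z. norm x \<le> R \<longrightarrow> norm z \<le> R \<longrightarrow>
        (\<forall>v. norm (D (g x) (E x v)) \<le> K * norm v) \<and>
        norm (f (g z) - f (g x) - D (g x) (E x (z - x))) \<le> K * (norm (z - x))\<^sup>2"
  proof (intro exI[of _ "C * B + C * L\<^sup>2"] conjI allI impI)
    fix x z v :: 'a assume xz: "norm x \<le> R" "norm z \<le> R"
    show "norm (f (g z) - f (g x) - D (g x) (E x (z - x))) \<le> (C * B + C * L\<^sup>2) * (norm (z - x))\<^sup>2"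
      using rem[OF xz] by (simp add: add.commute)
    have "C * B * norm v \<le> (C * B + C * L\<^sup>2) * norm v"
      using C(1) by (intro mult_right_mono) auto
    with bound[OF xz(1), of v] show "norm (D (g x) (E x v)) \<le> (C * B + C * L\<^sup>2) * norm v"
      by linarith
  qed (use C(1) B(1) in auto)
qed

lemma quad_deriv_bounded_linear:
  assumes "bounded_linear f"
  shows "quad_deriv f (\<lambda>x. f)"
proof (rule quad_derivI)
  show "linear f" using assms by (rule bounded_linear.linear)
  obtain K where "K \<ge> 0" "\<And>v. norm (f v) \<le> norm v * K"
    using bounded_linear.nonneg_bounded[OF assms] by blast
  then show "\<exists>C\<ge>0. \<forall>x z. norm x \<le> R \<longrightarrow> norm z \<le> R \<longrightarrow>
        (\<forall>v. norm (f v) \<le> C * norm v) \<and>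
        norm (f z - f x - f (z - x)) \<le> C * (norm (z - x))\<^sup>2" for R
    by (intro exI[of _ K])
       (auto simp: mult.commute linear_diff[OF bounded_linear.linear[OF assms]])
qed

lemma quad_deriv_const: "quad_deriv (\<lambda>x. c) (\<lambda>x v. 0)"
  by (rule quad_derivI) (auto intro: exI[of _ 0] simp: linear_iff)

lemma quad_deriv_Pair:
  fixes f :: "'a::real_normed_vector \<Rightarrow> 'b::real_normed_vector"
    and g :: "'a \<Rightarrow> 'c::real_normed_vector"
  assumes f: "quad_deriv f D" and g: "quad_deriv g E"
  shows "quad_deriv (\<lambda>x. (f x, g x)) (\<lambda>x v. (D x v, E x v))"
proof (rule quad_derivI)
  show "linear (\<lambda>v. (D x v, E x v))" for x
    using f g by (auto simp: quad_deriv_def linear_iff)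
  fix R :: real
  obtain B where B: "B \<ge> 0"
    "\<And>x v. norm x \<le> R \<Longrightarrow> norm (E x v) \<le> B * norm v"
    "\<And>x z. norm x \<le> R \<Longrightarrow> norm z \<le> R \<Longrightarrow>
       norm (g z - g x - E x (z - x)) \<le> B * (norm (z - x))\<^sup>2"
    using quad_derivE[OF g, where R = R] by blast
  obtain C where C: "C \<ge> 0"
    "\<And>x v. norm x \<le> R \<Longrightarrow> norm (D x v) \<le> C * norm v"
    "\<And>x z. norm x \<le> R \<Longrightarrow> norm z \<le> R \<Longrightarrow>
       norm (f z - f x - D x (z - x)) \<le> C * (norm (z - x))\<^sup>2"
    using quad_derivE[OF f, where R = R] by blast
  show "\<exists>K\<ge>0. \<forall>x z. norm x \<le> R \<longrightarrow> norm z \<le> R \<longrightarrow>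
        (\<forall>v. norm (D x v, E x v) \<le> K * norm v) \<and>
        norm ((f z, g z) - (f x, g x) - (D x (z - x), E x (z - x))) \<le> K * (norm (z - x))\<^sup>2"
  proof (intro exI[of _ "C + B"] conjI allI impI)
    fix x z v :: 'a assume xz: "norm x \<le> R" "norm z \<le> R"
    show "norm (D x v, E x v) \<le> (C + B) * norm v"
      using norm_Pair_le[of "D x v" "E x v"] B(2)[OF xz(1), of v] C(2)[OF xz(1), of v]
      by (simp add: algebra_simps)
    show "norm ((f z, g z) - (f x, g x) - (D x (z - x), E x (z - x))) \<le> (C + B) * (norm (z - x))\<^sup>2"
      using norm_Pair_le[of "f z - f x - D x (z - x)" "g z - g x - E x (z - x)"]
        B(3)[OF xz] C(3)[OF xz] by (simp add: algebra_simps)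
  qed (use C(1) B(1) in auto)
qed

lemma quad_deriv_add:
  fixes f g :: "'a::real_normed_vector \<Rightarrow> 'b::real_normed_vector"
  assumes f: "quad_deriv f D" and g: "quad_deriv g E"
  shows "quad_deriv (\<lambda>x. f x + g x) (\<lambda>x v. D x v + E x v)"
proof -
  have "bounded_linear (\<lambda>p::'b \<times> 'b. fst p + snd p)"
    by (intro bounded_linear_add bounded_linear_fst bounded_linear_snd)
  from quad_deriv_compose[OF quad_deriv_bounded_linear[OF this] quad_deriv_Pair[OF f g]]
  show ?thesis by simp
qed

lemma quad_deriv_times:
  "quad_deriv (\<lambda>p::real \<times> real. fst p * snd p) (\<lambda>p v. fst v * snd p + fst p * snd v)"
proof (rule quad_derivI)
  show "linear (\<lambda>v. fst v * snd p + fst p * snd v)" for p :: "real \<times> real"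
    by (auto simp: linear_iff algebra_simps)
  have fs: "\<bar>fst v\<bar> \<le> norm v" "\<bar>snd v\<bar> \<le> norm v" for v :: "real \<times> real"
    using norm_fst_le[of "fst v" "snd v"] norm_snd_le[of "snd v" "fst v"] by auto
  fix R :: real assume R: "R \<ge> 0"
  show "\<exists>C\<ge>0. \<forall>x z :: real \<times> real. norm x \<le> R \<longrightarrow> norm z \<le> R \<longrightarrow>
        (\<forall>v. norm (fst v * snd x + fst x * snd v) \<le> C * norm v) \<and>
        norm (fst z * snd z - fst x * snd x - (fst (z - x) * snd x + fst x * snd (z - x)))
          \<le> C * (norm (z - x))\<^sup>2"
  proof (intro exI[of _ "2 * R + 1"] conjI allI impI)
    fix x z v :: "real \<times> real" assume xz: "norm x \<le> R" "norm z \<le> R"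
    have "\<bar>fst v * snd x\<bar> \<le> norm v * R" "\<bar>fst x * snd v\<bar> \<le> R * norm v"
      unfolding abs_mult using fs[of v] fs[of x] xz(1) R by (auto intro!: mult_mono)
    moreover have "norm v \<ge> 0" by simp
    moreover have "norm (fst v * snd x + fst x * snd v) \<le> \<bar>fst v * snd x\<bar> + \<bar>fst x * snd v\<bar>"
      unfolding real_norm_def by (rule abs_triangle_ineq)
    moreover have "(2 * R + 1) * norm v = norm v * R + R * norm v + norm v"
      by (simp add: algebra_simps)
    ultimately show "norm (fst v * snd x + fst x * snd v) \<le> (2 * R + 1) * norm v"
      by linarith
    have "fst z * snd z - fst x * snd x - (fst (z - x) * snd x + fst x * snd (z - x))
        = fst (z - x) * snd (z - x)"
      by (simp add: algebra_simps)
    moreover have "\<bar>fst (z - x) * snd (z - x)\<bar> \<le> 1 * (norm (z - x))\<^sup>2"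
      using mult_mono[OF fs[of "z - x"]] by (simp add: abs_mult power2_eq_square)
    moreover have "1 * (norm (z - x))\<^sup>2 \<le> (2 * R + 1) * (norm (z - x))\<^sup>2"
      using R by (intro mult_right_mono) auto
    ultimately show "norm (fst z * snd z - fst x * snd x
        - (fst (z - x) * snd x + fst x * snd (z - x))) \<le> (2 * R + 1) * (norm (z - x))\<^sup>2"
      unfolding real_norm_def by linarith
  qed (use R in simp)
qed

text \<open>
  Convexity of the exponential gives both bounds on the remainder: the tangent at \<open>x\<close> lies below the
  graph, and so does the tangent at \<open>z\<close>, which bounds the remainder by
  \<open>(exp z - exp x) (z - x)\<close>.
\<close>

lemma quad_deriv_exp: "quad_deriv (exp :: real \<Rightarrow> real) (\<lambda>x v. exp x * v)"
proof (rule quad_derivI)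
  show "linear (\<lambda>v. exp x * v)" for x :: real
    by (simp add: linear_times)
  fix R :: real
  have tangent: "exp x * (z - x) \<le> exp z - exp x" for x z :: real
  proof -
    have "exp z = exp x * exp (z - x)" by (simp flip: exp_add)
    then show ?thesis
      using mult_left_mono[OF exp_ge_add_one_self[of "z - x"], of "exp x"]
      by (simp add: algebra_simps)
  qed
  have rem: "\<bar>exp z - exp x - exp x * (z - x)\<bar> \<le> exp R * (z - x)\<^sup>2"
    if xz: "\<bar>x\<bar> \<le> R" "\<bar>z\<bar> \<le> R" for x z :: real
  proof -
    have "\<bar>exp z - exp x\<bar> \<le> exp R * \<bar>z - x\<bar>"
    proof -
      have "exp z \<le> exp R" "exp x \<le> exp R" using xz by auto
      then have "exp z * (z - x) \<le> exp R * (z - x)" if "x \<le> z"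
        using that by (intro mult_right_mono) auto
      moreover have "exp x * (x - z) \<le> exp R * (x - z)" if "z \<le> x"
        using that \<open>exp x \<le> exp R\<close> by (intro mult_right_mono) auto
      ultimately show ?thesis
        using tangent[of x z] tangent[of z x]
        by (cases "x \<le> z") (auto simp: abs_if algebra_simps)
    qed
    have "exp z - exp x - exp x * (z - x) \<le> (exp z - exp x) * (z - x)"
      using tangent[of z x] by (simp add: algebra_simps)
    also have "\<dots> \<le> \<bar>exp z - exp x\<bar> * \<bar>z - x\<bar>"
      by (metis abs_ge_self abs_mult)
    also have "\<dots> \<le> exp R * \<bar>z - x\<bar> * \<bar>z - x\<bar>"
      using \<open>\<bar>exp z - exp x\<bar> \<le> exp R * \<bar>z - x\<bar>\<close> by (intro mult_right_mono) auto
    finally show ?thesis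
      using tangent[of x z] by (simp add: power2_eq_square abs_mult_self_eq mult.assoc)
  qed
  show "\<exists>C\<ge>0. \<forall>x z :: real. norm x \<le> R \<longrightarrow> norm z \<le> R \<longrightarrow>
        (\<forall>v. norm (exp x * v) \<le> C * norm v) \<and>
        norm (exp z - exp x - exp x * (z - x)) \<le> C * (norm (z - x))\<^sup>2"
    by (intro exI[of _ "exp R"]) (auto simp: abs_mult rem intro!: mult_right_mono)
qed

lemma quad_smooth_const: "quad_smooth (\<lambda>x. c)"
  using quad_deriv_const unfolding quad_smooth_def by blast

lemma quad_smooth_bounded_linear: "bounded_linear f \<Longrightarrow> quad_smooth f"
  using quad_deriv_bounded_linear unfolding quad_smooth_def by blast

lemma quad_smooth_Pair:
  "quad_smooth f \<Longrightarrow> quad_smooth g \<Longrightarrow> quad_smooth (\<lambda>x. (f x, g x))"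
  using quad_deriv_Pair unfolding quad_smooth_def by blast

lemma quad_smooth_compose:
  "quad_smooth f \<Longrightarrow> quad_smooth g \<Longrightarrow> quad_smooth (\<lambda>x. f (g x))"
  using quad_deriv_compose unfolding quad_smooth_def by blast

lemma quad_smooth_add:
  "quad_smooth f \<Longrightarrow> quad_smooth g \<Longrightarrow> quad_smooth (\<lambda>x. f x + g x)"
  using quad_deriv_add unfolding quad_smooth_def by blast

lemma quad_smooth_mult:
  fixes f g :: "'a::real_normed_vector \<Rightarrow> real"
  assumes "quad_smooth f" "quad_smooth g"
  shows "quad_smooth (\<lambda>x. f x * g x)"
proof -
  have "quad_smooth (\<lambda>p::real \<times> real. fst p * snd p)"
    using quad_deriv_times unfolding quad_smooth_def by blast
  from quad_smooth_compose[OF this quad_smooth_Pair[OF assms]] show ?thesis by simp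
qed

lemma quad_smooth_minus:
  fixes f :: "'a::real_normed_vector \<Rightarrow> 'b::real_normed_vector"
  shows "quad_smooth f \<Longrightarrow> quad_smooth (\<lambda>x. - f x)"
  by (rule quad_smooth_compose[OF quad_smooth_bounded_linear])
     (rule bounded_linear_minus[OF bounded_linear_ident])

lemma quad_smooth_diff:
  "quad_smooth f \<Longrightarrow> quad_smooth g \<Longrightarrow> quad_smooth (\<lambda>x. f x - g x)"
  using quad_smooth_add[OF _ quad_smooth_minus] by force

lemma quad_smooth_power:
  fixes f :: "'a::real_normed_vector \<Rightarrow> real"
  shows "quad_smooth f \<Longrightarrow> quad_smooth (\<lambda>x. f x ^ n)"
  by (induction n) (auto intro: quad_smooth_const quad_smooth_mult)

lemma quad_smooth_exp:
  fixes f :: "'a::real_normed_vector \<Rightarrow> real"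
  shows "quad_smooth f \<Longrightarrow> quad_smooth (\<lambda>x. exp (f x))"
  using quad_smooth_compose[of exp f] quad_deriv_exp unfolding quad_smooth_def by blast

lemma quad_smooth_sum:
  "(\<And>i. i \<in> I \<Longrightarrow> quad_smooth (f i)) \<Longrightarrow> quad_smooth (\<lambda>x. \<Sum>i\<in>I. f i x)"
  by (induction I rule: infinite_finite_induct) (auto intro: quad_smooth_const quad_smooth_add)

lemma quad_smooth_vec:
  fixes f :: "'n::finite \<Rightarrow> 'a::real_normed_vector \<Rightarrow> real"
  assumes "\<And>i. quad_smooth (f i)"
  shows "quad_smooth (\<lambda>x. \<chi> i. f i x)"
proof -
  have "(\<chi> i. f i x) = (\<Sum>i\<in>UNIV. f i x *\<^sub>R axis i 1)" for x
    by (subst basis_expansion[symmetric]) (simp add: scalar_mult_eq_scaleR)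
  moreover have "quad_smooth (\<lambda>x. \<Sum>i\<in>UNIV. f i x *\<^sub>R axis i (1::real))"
    by (intro quad_smooth_sum quad_smooth_compose[OF quad_smooth_bounded_linear assms]
          bounded_linear_scaleR_left)
  ultimately show ?thesis by simp
qed

section \<open>Runge--Kutta steps for small step sizes\<close>

text \<open>
  Several smallness requirements on the step size are met at once by adding up their constants.
\<close>

lemma small_step:
  fixes \<delta>0 c :: real
  assumes "\<delta>0 > 0" "c \<ge> 0"
  obtains \<delta> where "\<delta> > 0" "\<delta> \<le> \<delta>0" "\<delta> \<le> 1" "\<And>h. \<bar>h\<bar> \<le> \<delta> \<Longrightarrow> \<bar>h\<bar> * c \<le> 1"
proof (rule that[of "min \<delta>0 (1 / (c + 1))"])
  show "min \<delta>0 (1 / (c + 1)) > 0" "min \<delta>0 (1 / (c + 1)) \<le> \<delta>0" "min \<delta>0 (1 / (c + 1)) \<le> 1"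
    using assms by (auto simp: min_le_iff_disj)
  fix h :: real assume "\<bar>h\<bar> \<le> min \<delta>0 (1 / (c + 1))"
  then have "\<bar>h\<bar> * c \<le> 1 / (c + 1) * c"
    using assms by (intro mult_right_mono) auto
  also have "\<dots> \<le> 1" using assms by (simp add: field_simps)
  finally show "\<bar>h\<bar> * c \<le> 1" .
qed

definition coeff_sum :: "nat \<Rightarrow> (nat \<Rightarrow> nat \<Rightarrow> real) \<Rightarrow> real" where
  "coeff_sum s a = (\<Sum>i<s. \<Sum>j<s. \<bar>a i j\<bar>)"

lemma coeff_sum_nonneg: "coeff_sum s a \<ge> 0"
  unfolding coeff_sum_def by (intro sum_nonneg) auto

lemma coeff_row_le: "i < s \<Longrightarrow> (\<Sum>j<s. \<bar>a i j\<bar>) \<le> coeff_sum s a"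
  unfolding coeff_sum_def by (rule member_le_sum) (auto intro: sum_nonneg)

lemma coeff_le: "i < s \<Longrightarrow> j < s \<Longrightarrow> \<bar>a i j\<bar> \<le> coeff_sum s a"
  using coeff_row_le[of i s a] member_le_sum[of j "{..<s}" "\<lambda>j. \<bar>a i j\<bar>"] by force

lemma norm_weighted_sum_le:
  fixes K :: "nat \<Rightarrow> 'a::real_normed_vector"
  assumes "\<forall>j<s. norm (K j) \<le> M"
  shows "norm (\<Sum>j<s. c j *\<^sub>R K j) \<le> (\<Sum>j<s. \<bar>c j\<bar>) * M"
proof -
  have "norm (\<Sum>j<s. c j *\<^sub>R K j) \<le> (\<Sum>j<s. \<bar>c j\<bar> * norm (K j))"
    using norm_sum[of "\<lambda>j. c j *\<^sub>R K j" "{..<s}"] by simp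
  also have "\<dots> \<le> (\<Sum>j<s. \<bar>c j\<bar> * M)"
    using assms by (intro sum_mono mult_left_mono) auto
  finally show ?thesis by (simp add: sum_distrib_right)
qed

lemma norm_stage_sum_le:
  fixes K :: "nat \<Rightarrow> 'a::real_normed_vector"
  assumes "i < s" "M \<ge> 0" "\<forall>j<s. norm (K j) \<le> M"
  shows "norm (\<Sum>j<s. a i j *\<^sub>R K j) \<le> coeff_sum s a * M"
  using norm_weighted_sum_le[OF assms(3), of "a i"]
    mult_right_mono[OF coeff_row_le[OF assms(1), of a] assms(2)] by linarith

lemma rk_stage_near:
  fixes K :: "nat \<Rightarrow> 'a::real_normed_vector"
  assumes "i < s" "M \<ge> 0" "\<forall>j<s. norm (K j) \<le> M"
  shows "norm (Y + h *\<^sub>R (\<Sum>j<s. a i j *\<^sub>R K j) - Y) \<le> \<bar>h\<bar> * (coeff_sum s a * M)"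
  using mult_left_mono[OF norm_stage_sum_le[OF assms, of a], of "\<bar>h\<bar>"] by simp

lemma rk_stage_bounded:
  fixes K :: "nat \<Rightarrow> 'a::real_normed_vector"
  assumes "i < s" "M \<ge> 0" "\<forall>j<s. norm (K j) \<le> M"
    and "norm Y \<le> R" "\<bar>h\<bar> * (coeff_sum s a * M) \<le> 1"
  shows "norm (Y + h *\<^sub>R (\<Sum>j<s. a i j *\<^sub>R K j)) \<le> R + 1"
  using rk_stage_near[OF assms(1-3), of Y h a] assms(4,5)
    norm_triangle_ineq2[of "Y + h *\<^sub>R (\<Sum>j<s. a i j *\<^sub>R K j)" Y] by linarith

text \<open>
  Subtracting the stage equations bounds the sum of the stage differences by a multiple of
  \<open>norm (Y - Z)\<close> plus at most half of that sum itself, which is absorbed. For \<open>Y = Z\<close> this is uniqueness of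
  bounded stages.
\<close>

lemma rk_stages_stable:
  fixes f :: "'a::real_normed_vector \<Rightarrow> 'a"
  assumes L: "L \<ge> 0" "\<And>x z. norm x \<le> R + 1 \<Longrightarrow> norm z \<le> R + 1 \<Longrightarrow> norm (f z - f x) \<le> L * norm (z - x)"
    and Y: "norm Y \<le> R" "rk_stages s a f h Y K" "\<forall>i<s. norm (K i) \<le> M"
    and Z: "norm Z \<le> R" "rk_stages s a f h Z J" "\<forall>i<s. norm (J i) \<le> M"
    and M: "M \<ge> 0" "\<bar>h\<bar> * (coeff_sum s a * M) \<le> 1"
    and h: "\<bar>h\<bar> * (2 * real s * L * coeff_sum s a) \<le> 1"
  shows "(\<Sum>i<s. norm (K i - J i)) \<le> 2 * real s * L * norm (Y - Z)"
proof -
  define A where "A = coeff_sum s a"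
  define d where "d = (\<Sum>i<s. norm (K i - J i))"
  have "d \<ge> 0" unfolding d_def by (simp add: sum_nonneg)
  have each: "norm (K i - J i) \<le> L * (norm (Y - Z) + \<bar>h\<bar> * (A * d))" if i: "i < s" for i
  proof -
    let ?y = "Y + h *\<^sub>R (\<Sum>j<s. a i j *\<^sub>R K j)" and ?z = "Z + h *\<^sub>R (\<Sum>j<s. a i j *\<^sub>R J j)"
    have "norm (\<Sum>j<s. a i j *\<^sub>R (K j - J j)) \<le> (\<Sum>j<s. \<bar>a i j\<bar> * norm (K j - J j))"
      using norm_sum[of "\<lambda>j. a i j *\<^sub>R (K j - J j)" "{..<s}"] by simp
    also have "\<dots> \<le> (\<Sum>j<s. A * norm (K j - J j))"
      unfolding A_def using coeff_le[OF i] by (intro sum_mono mult_right_mono) auto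
    also have "\<dots> = A * d" by (simp add: d_def sum_distrib_left)
    finally have sum: "norm (\<Sum>j<s. a i j *\<^sub>R (K j - J j)) \<le> A * d" .
    have "?y - ?z = (Y - Z) + h *\<^sub>R (\<Sum>j<s. a i j *\<^sub>R (K j - J j))"
      by (simp add: algebra_simps sum_subtractf)
    then have "norm (?y - ?z) \<le> norm (Y - Z) + \<bar>h\<bar> * norm (\<Sum>j<s. a i j *\<^sub>R (K j - J j))"
      using norm_triangle_ineq[of "Y - Z" "h *\<^sub>R (\<Sum>j<s. a i j *\<^sub>R (K j - J j))"] by (metis norm_scaleR)
    also have "\<dots> \<le> norm (Y - Z) + \<bar>h\<bar> * (A * d)"
      using mult_left_mono[OF sum, of "\<bar>h\<bar>"] by simp
    finally have "norm (?y - ?z) \<le> norm (Y - Z) + \<bar>h\<bar> * (A * d)" .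
    moreover have "norm (f ?y - f ?z) \<le> L * norm (?y - ?z)"
      using rk_stage_bounded[OF i M(1) Y(3,1) M(2)] rk_stage_bounded[OF i M(1) Z(3,1) M(2)]
      by (intro L(2)) auto
    moreover have "K i = f ?y" "J i = f ?z"
      using Y(2) Z(2) i unfolding rk_stages_def by auto
    ultimately show ?thesis
      using mult_left_mono[OF _ L(1)] by (metis order_trans)
  qed
  have "d \<le> (\<Sum>i<s. L * (norm (Y - Z) + \<bar>h\<bar> * (A * d)))"
    unfolding d_def using each by (intro sum_mono) (auto simp: d_def)
  also have "\<dots> = real s * L * norm (Y - Z) + (\<bar>h\<bar> * (2 * real s * L * A)) * (d / 2)"
    by (simp add: algebra_simps)
  also have "\<dots> \<le> real s * L * norm (Y - Z) + 1 * (d / 2)"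
    using h \<open>d \<ge> 0\<close> unfolding A_def by (intro add_left_mono mult_right_mono) auto
  finally show ?thesis unfolding d_def by simp
qed

text \<open>
  Fixed-point iteration, starting from zero stages. The iterates stay in the ball of radius
  \<open>norm (f Y) + 1\<close> because all arguments stay near \<open>Y\<close>; there the iteration contracts by the factor
  \<open>1/2\<close>.
\<close>

lemma rk_stages_exist:
  fixes f :: "'a::banach \<Rightarrow> 'a"
  assumes L: "L \<ge> 0" "\<And>x z. norm x \<le> R + 1 \<Longrightarrow> norm z \<le> R + 1 \<Longrightarrow> norm (f z - f x) \<le> L * norm (z - x)"
    and Y: "norm Y \<le> R"
    and A: "\<bar>h\<bar> * (coeff_sum s a * (norm (f Y) + 1)) \<le> 1"
      "\<bar>h\<bar> * (L * coeff_sum s a * (norm (f Y) + 1)) \<le> 1" "\<bar>h\<bar> * (2 * L * coeff_sum s a) \<le> 1"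
  shows "\<exists>K. rk_stages s a f h Y K \<and> (\<forall>i<s. norm (K i) \<le> norm (f Y) + 1)"
proof -
  define M where "M = norm (f Y) + 1"
  have "M \<ge> 0" unfolding M_def by simp
  define arg where "arg K i = Y + h *\<^sub>R (\<Sum>j<s. a i j *\<^sub>R K j)" for K :: "nat \<Rightarrow> 'a" and i
  define F where "F K i = (if i < s then f (arg K i) else 0)" for K :: "nat \<Rightarrow> 'a" and i
  have arg_bound: "norm (arg K i) \<le> R + 1" "norm (arg K i - Y) \<le> \<bar>h\<bar> * (coeff_sum s a * M)"
    if "\<And>j. norm (K j) \<le> M" "i < s" for K i
    using rk_stage_bounded[of i s M K Y R h a] rk_stage_near[of i s M K Y h a] that Y A(1) \<open>M \<ge> 0\<close>
    unfolding arg_def M_def by auto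
  have F_bound: "norm (F K i) \<le> M" if K: "\<And>j. norm (K j) \<le> M" for K i
  proof (cases "i < s")
    case True
    have "norm (f (arg K i) - f Y) \<le> L * norm (arg K i - Y)"
      using arg_bound(1)[OF K True] Y by (intro L(2)) auto
    also have "\<dots> \<le> L * (\<bar>h\<bar> * (coeff_sum s a * M))"
      using arg_bound(2)[OF K True] L(1) by (rule mult_left_mono)
    also have "\<dots> = \<bar>h\<bar> * (L * coeff_sum s a * M)" by simp
    also have "\<dots> \<le> 1" using A(2) unfolding M_def .
    finally show ?thesis
      using norm_triangle_ineq2[of "f (arg K i)" "f Y"] True by (simp add: F_def M_def)
  qed (use \<open>M \<ge> 0\<close> in \<open>simp add: F_def\<close>)
  have F_lipschitz: "norm (F K i - F J i) \<le> L * norm (arg K i - arg J i)"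
    if "\<And>j. norm (K j) \<le> M" "\<And>j. norm (J j) \<le> M" for K J i
    using L arg_bound(1)[OF that(1)] arg_bound(1)[OF that(2)] by (simp add: F_def)
  have contraction: "norm (F K i - F J i) \<le> d / 2"
    if K: "\<And>j. norm (K j) \<le> M" and J: "\<And>j. norm (J j) \<le> M" and d: "\<And>j. norm (K j - J j) \<le> d"
    for K J d i
  proof (cases "i < s")
    case True
    have "d \<ge> 0" using d[of 0] norm_ge_zero order_trans by blast
    have "arg K i - arg J i = h *\<^sub>R (\<Sum>j<s. a i j *\<^sub>R (K j - J j))"
      by (simp add: arg_def algebra_simps sum_subtractf)
    then have "norm (arg K i - arg J i) = \<bar>h\<bar> * norm (\<Sum>j<s. a i j *\<^sub>R (K j - J j))"
      by simp
    also have "\<dots> \<le> \<bar>h\<bar> * (coeff_sum s a * d)"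
      using True d \<open>d \<ge> 0\<close> by (intro mult_left_mono norm_stage_sum_le) auto
    finally have "L * norm (arg K i - arg J i) \<le> L * (\<bar>h\<bar> * (coeff_sum s a * d))"
      using L(1) by (rule mult_left_mono)
    also have "\<dots> = \<bar>h\<bar> * (2 * L * coeff_sum s a) * (d / 2)" by simp
    also have "\<dots> \<le> 1 * (d / 2)"
      using A(3) \<open>d \<ge> 0\<close> by (intro mult_right_mono) auto
    finally have "L * norm (arg K i - arg J i) \<le> d / 2" by simp
    moreover have "norm (F K i - F J i) \<le> L * norm (arg K i - arg J i)"
      by (rule F_lipschitz) (rule K J)+
    ultimately show ?thesis by linarith
  next
    case False
    have "d \<ge> 0" using d[of 0] norm_ge_zero order_trans by blast
    with False show ?thesis by (simp add: F_def)
  qed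
  define X where "X n = (F ^^ n) (\<lambda>i. 0)" for n
  have X_bound: "norm (X n i) \<le> M" for n i
    by (induction n arbitrary: i) (auto simp: X_def \<open>M \<ge> 0\<close> intro: F_bound)
  have X_diff: "norm (X (Suc n) i - X n i) \<le> M * (1 / 2) ^ n" for n i
  proof (induction n arbitrary: i)
    case 0
    show ?case using X_bound[of 1 i] by (simp add: X_def)
  next
    case (Suc n)
    show ?case
      using contraction[OF X_bound[of "Suc n"] X_bound[of n] Suc.IH] by (simp add: X_def)
  qed
  \<comment> \<open>The increments are dominated by a geometric series.\<close>
  have "convergent (\<lambda>n. X n i)" for i
  proof -
    have "summable (\<lambda>n. X (Suc n) i - X n i)"
    proof (rule summable_comparison_test')
      show "summable (\<lambda>n. M * (1 / 2) ^ n)" by (rule summable_mult) simp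
    qed (rule X_diff)
    then have "convergent (\<lambda>n. \<Sum>k<n. X (Suc k) i - X k i)"
      by (simp add: summable_iff_convergent)
    moreover have "(\<Sum>k<n. X (Suc k) i - X k i) = X n i" for n
      using sum_lessThan_telescope[of "\<lambda>k. X k i" n] X_def[of 0] by simp
    ultimately show ?thesis by simp
  qed
  then obtain K where K: "\<And>i. (\<lambda>n. X n i) \<longlonglongrightarrow> K i"
    unfolding convergent_def by metis
  have K_bound: "norm (K i) \<le> M" for i
    using LIMSEQ_le_const2[OF tendsto_norm[OF K[of i]]] X_bound by blast
  have "K i = F K i" for i
  proof -
    have "(\<lambda>n. arg (X n) i) \<longlonglongrightarrow> arg K i"
      unfolding arg_def by (intro tendsto_intros K)
    then have "(\<lambda>n. L * norm (arg (X n) i - arg K i)) \<longlonglongrightarrow> L * norm (arg K i - arg K i)"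
      by (intro tendsto_intros)
    then have "(\<lambda>n. L * norm (arg (X n) i - arg K i)) \<longlonglongrightarrow> 0" by simp
    moreover have "norm (F (X n) i - F K i) \<le> L * norm (arg (X n) i - arg K i)" for n
      by (rule F_lipschitz[OF X_bound K_bound])
    ultimately have "(\<lambda>n. F (X n) i - F K i) \<longlonglongrightarrow> 0"
      by (rule Lim_null_comparison[OF always_eventually[rule_format], rotated])
    then have "(\<lambda>n. X (Suc n) i) \<longlonglongrightarrow> F K i"
      by (simp add: X_def LIM_zero_iff)
    with LIMSEQ_Suc[OF K[of i]] show ?thesis by (rule LIMSEQ_unique)
  qed
  then have "rk_stages s a f h Y K"
    unfolding rk_stages_def by (metis F_def arg_def)
  then show ?thesis using K_bound unfolding M_def by blast
qed

text \<open>
  The method selects stages bounded by \<open>norm (f Y) + 1\<close>. This criterion refers to the state alone, so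
  that one method serves all bounded sets of states.
\<close>

theorem rk_method_exists:
  fixes f :: "'a::banach \<Rightarrow> 'a"
  assumes f: "quad_smooth f"
  shows "\<exists>\<Phi>. rk_method s a b f \<Phi>"
proof -
  obtain D where D: "quad_deriv f D" using f unfolding quad_smooth_def by blast
  define good where "good h Y K \<longleftrightarrow> rk_stages s a f h Y K \<and> (\<forall>i<s. norm (K i) \<le> norm (f Y) + 1)"
    for h Y K
  define \<Phi> where "\<Phi> h Y = (if \<exists>K. good h Y K then Some (rk_update s b h Y (SOME K. good h Y K)) else None)"
    for h Y
  have step: "good h Y (SOME K. good h Y K)" if "good h Y K" for h Y K
    by (rule someI[of "good h Y", OF that])
  have "rk_method s a b f \<Phi>"
    unfolding rk_method_def
  proof (intro conjI allI impI)
    fix h Y Y1 assume "\<Phi> h Y = Some Y1"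
    then show "\<exists>K. rk_stages s a f h Y K \<and> Y1 = rk_update s b h Y K"
      using step unfolding \<Phi>_def good_def by (auto split: if_splits)
  next
    fix B :: "'a set" assume "bounded B"
    then obtain R where R: "\<And>Y. Y \<in> B \<Longrightarrow> norm Y \<le> R" by (auto simp: bounded_iff)
    obtain L where L: "L \<ge> 0"
      "\<And>x z. norm x \<le> R + 1 \<Longrightarrow> norm z \<le> R + 1 \<Longrightarrow> norm (f z - f x) \<le> L * norm (z - x)"
      using quad_deriv_lipschitz[OF D, where R = "R + 1"] by blast
    obtain F where F: "F \<ge> 0" "\<And>x. norm x \<le> R \<Longrightarrow> norm (f x) \<le> F"
      using quad_deriv_bounded[OF D, where R = R] by blast
    define c where "c = coeff_sum s a * (F + 1) + L * coeff_sum s a * (F + 1) + 2 * L * coeff_sum s a"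
    have nonneg: "0 \<le> coeff_sum s a * (F + 1)" "0 \<le> L * coeff_sum s a * (F + 1)" "0 \<le> 2 * L * coeff_sum s a"
      using coeff_sum_nonneg[of s a] L(1) F(1) by auto
    obtain \<delta> where \<delta>: "\<delta> > 0" "\<And>h. \<bar>h\<bar> \<le> \<delta> \<Longrightarrow> \<bar>h\<bar> * c \<le> 1"
      using small_step[of 1 c] nonneg unfolding c_def by auto
    have "\<exists>K. rk_stages s a f h Y K \<and> (\<forall>i<s. norm (K i) \<le> F + 1) \<and> \<Phi> h Y = Some (rk_update s b h Y K)"
      if h: "\<bar>h\<bar> \<le> \<delta>" and Y: "Y \<in> B" for h Y
    proof -
      have "\<bar>h\<bar> * x \<le> 1" if "x \<le> c" for x
        using mult_left_mono[OF that, of "\<bar>h\<bar>"] \<delta>(2)[OF h] by simp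
      moreover have "coeff_sum s a * (norm (f Y) + 1) \<le> coeff_sum s a * (F + 1)"
        using F(2)[OF R[OF Y]] coeff_sum_nonneg[of s a] by (intro mult_left_mono) auto
      moreover have "L * coeff_sum s a * (norm (f Y) + 1) \<le> L * coeff_sum s a * (F + 1)"
        using F(2)[OF R[OF Y]] coeff_sum_nonneg[of s a] L(1) by (intro mult_left_mono) auto
      ultimately have "\<exists>K. good h Y K"
        unfolding good_def using nonneg by (intro rk_stages_exist[OF L R[OF Y]]) (auto simp: c_def)
      then obtain K where K: "good h Y K" "\<Phi> h Y = Some (rk_update s b h Y K)"
        using step unfolding \<Phi>_def by auto
      then have "\<forall>i<s. norm (K i) \<le> F + 1"
        using F(2)[OF R[OF Y]] unfolding good_def by fastforce
      with K show ?thesis unfolding good_def by blast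
    qed
    then show "\<exists>\<delta>>0. \<exists>M. \<forall>h Y. \<bar>h\<bar> \<le> \<delta> \<and> Y \<in> B \<longrightarrow>
           (\<exists>K. rk_stages s a f h Y K \<and> (\<forall>i<s. norm (K i) \<le> M) \<and> \<Phi> h Y = Some (rk_update s b h Y K))"
      using \<delta>(1) by blast
  qed
  then show ?thesis by blast
qed

lemma rk_methodE:
  fixes f :: "'a::real_normed_vector \<Rightarrow> 'a"
  assumes "rk_method s a b f \<Phi>"
  obtains \<delta> M where "\<delta> > 0" "M \<ge> 0"
    "\<And>h Y. \<bar>h\<bar> \<le> \<delta> \<Longrightarrow> norm Y \<le> R \<Longrightarrow>
       \<exists>K. rk_stages s a f h Y K \<and> (\<forall>i<s. norm (K i) \<le> M) \<and> \<Phi> h Y = Some (rk_update s b h Y K)"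
proof -
  obtain \<delta> M where "\<delta> > 0" and M: "\<forall>h Y. \<bar>h\<bar> \<le> \<delta> \<and> Y \<in> cball 0 R \<longrightarrow>
       (\<exists>K. rk_stages s a f h Y K \<and> (\<forall>i<s. norm (K i) \<le> M) \<and> \<Phi> h Y = Some (rk_update s b h Y K))"
    using assms bounded_cball[of "0::'a" R] unfolding rk_method_def by meson
  have "\<exists>K. rk_stages s a f h Y K \<and> (\<forall>i<s. norm (K i) \<le> max M 0) \<and> \<Phi> h Y = Some (rk_update s b h Y K)"
    if "\<bar>h\<bar> \<le> \<delta>" "norm Y \<le> R" for h Y
    using M that by (metis max.coboundedI1 mem_cball_0)
  then show ?thesis using \<open>\<delta> > 0\<close> by (intro that[of \<delta> "max M 0"]) auto
qed

text \<open>
  What the composition and convergence arguments need to know about a method. In the last bound the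
  factor must tend to \<open>1\<close> at the rate \<open>h\<close>: it is applied \<open>O(1/h)\<close> times over a fixed time interval.
\<close>

definition stable_step :: "'a::real_normed_vector one_step \<Rightarrow> bool" where
  "stable_step \<Phi> \<longleftrightarrow>
     (\<forall>R. \<exists>\<delta>>0. \<exists>L\<ge>0. \<forall>h Y Z. \<bar>h\<bar> \<le> \<delta> \<longrightarrow> norm Y \<le> R \<longrightarrow> norm Z \<le> R \<longrightarrow>
        (\<exists>Y' Z'. \<Phi> h Y = Some Y' \<and> \<Phi> h Z = Some Z' \<and>
           norm (Y' - Y) \<le> L * \<bar>h\<bar> \<and> norm (Y' - Z') \<le> (1 + L * \<bar>h\<bar>) * norm (Y - Z)))"

lemma stable_stepE:
  assumes "stable_step \<Phi>"
  obtains \<delta> L where "\<delta> > 0" "L \<ge> 0"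
    "\<And>h Y. \<bar>h\<bar> \<le> \<delta> \<Longrightarrow> norm Y \<le> R \<Longrightarrow> \<exists>Y'. \<Phi> h Y = Some Y' \<and> norm (Y' - Y) \<le> L * \<bar>h\<bar>"
    "\<And>h Y Z Y' Z'. \<bar>h\<bar> \<le> \<delta> \<Longrightarrow> norm Y \<le> R \<Longrightarrow> norm Z \<le> R \<Longrightarrow> \<Phi> h Y = Some Y' \<Longrightarrow> \<Phi> h Z = Some Z' \<Longrightarrow>
       norm (Y' - Z') \<le> (1 + L * \<bar>h\<bar>) * norm (Y - Z)"
proof -
  obtain \<delta> L where "\<delta> > 0" "L \<ge> 0" and *: "\<forall>h Y Z. \<bar>h\<bar> \<le> \<delta> \<longrightarrow> norm Y \<le> R \<longrightarrow> norm Z \<le> R \<longrightarrow>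
        (\<exists>Y' Z'. \<Phi> h Y = Some Y' \<and> \<Phi> h Z = Some Z' \<and>
           norm (Y' - Y) \<le> L * \<bar>h\<bar> \<and> norm (Y' - Z') \<le> (1 + L * \<bar>h\<bar>) * norm (Y - Z))"
    using assms[unfolded stable_step_def, THEN spec, of R]
    by (elim exE conjE) (rule that; assumption)
  show ?thesis
  proof (rule that[of \<delta> L])
    show "\<exists>Y'. \<Phi> h Y = Some Y' \<and> norm (Y' - Y) \<le> L * \<bar>h\<bar>" if "\<bar>h\<bar> \<le> \<delta>" "norm Y \<le> R" for h Y
      using *[rule_format, OF that(1,2,2)] by blast
    show "norm (Y' - Z') \<le> (1 + L * \<bar>h\<bar>) * norm (Y - Z)"
      if YZ: "\<bar>h\<bar> \<le> \<delta>" "norm Y \<le> R" "norm Z \<le> R" "\<Phi> h Y = Some Y'" "\<Phi> h Z = Some Z'" for h Y Z Y' Z'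
    proof -
      obtain Y1 Z1 where "\<Phi> h Y = Some Y1" "\<Phi> h Z = Some Z1"
          "norm (Y1 - Z1) \<le> (1 + L * \<bar>h\<bar>) * norm (Y - Z)"
        using *[rule_format, OF YZ(1-3)] by blast
      with YZ(4,5) show ?thesis by simp
    qed
  qed fact+
qed

lemma rk_method_stable:
  fixes f :: "'a::real_normed_vector \<Rightarrow> 'a"
  assumes \<Phi>: "rk_method s a b f \<Phi>" and f: "quad_smooth f"
  shows "stable_step \<Phi>"
  unfolding stable_step_def
proof
  fix R :: real
  obtain D where D: "quad_deriv f D" using f unfolding quad_smooth_def by blast
  obtain L where L: "L \<ge> 0"
    "\<And>x z. norm x \<le> R + 1 \<Longrightarrow> norm z \<le> R + 1 \<Longrightarrow> norm (f z - f x) \<le> L * norm (z - x)"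
    using quad_deriv_lipschitz[OF D, where R = "R + 1"] by blast
  obtain \<delta>0 M where M: "\<delta>0 > 0" "M \<ge> 0"
    "\<And>h Y. \<bar>h\<bar> \<le> \<delta>0 \<Longrightarrow> norm Y \<le> R \<Longrightarrow>
       \<exists>K. rk_stages s a f h Y K \<and> (\<forall>i<s. norm (K i) \<le> M) \<and> \<Phi> h Y = Some (rk_update s b h Y K)"
    using rk_methodE[OF \<Phi>, where R = R] by blast
  define A where "A = coeff_sum s a"
  define \<beta> where "\<beta> = (\<Sum>j<s. \<bar>b j\<bar>)"
  have nonneg: "A \<ge> 0" "\<beta> \<ge> 0" unfolding A_def \<beta>_def by (auto simp: coeff_sum_nonneg sum_nonneg)
  obtain \<delta> where \<delta>: "\<delta> > 0" "\<delta> \<le> \<delta>0" "\<And>h. \<bar>h\<bar> \<le> \<delta> \<Longrightarrow> \<bar>h\<bar> * (A * M + 2 * real s * L * A) \<le> 1"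
    using small_step[of \<delta>0 "A * M + 2 * real s * L * A"] M(1,2) nonneg L(1) by auto
  define C where "C = \<beta> * M + \<beta> * (2 * real s * L)"
  show "\<exists>\<delta>>0. \<exists>L\<ge>0. \<forall>h Y Z. \<bar>h\<bar> \<le> \<delta> \<longrightarrow> norm Y \<le> R \<longrightarrow> norm Z \<le> R \<longrightarrow>
        (\<exists>Y' Z'. \<Phi> h Y = Some Y' \<and> \<Phi> h Z = Some Z' \<and>
           norm (Y' - Y) \<le> L * \<bar>h\<bar> \<and> norm (Y' - Z') \<le> (1 + L * \<bar>h\<bar>) * norm (Y - Z))"
  proof (rule exI[of _ \<delta>], intro conjI, rule \<delta>(1), rule exI[of _ C], intro conjI allI impI)
    fix h and Y Z :: 'a assume h: "\<bar>h\<bar> \<le> \<delta>" and YZ: "norm Y \<le> R" "norm Z \<le> R"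
    obtain K where K: "rk_stages s a f h Y K" "\<forall>i<s. norm (K i) \<le> M" "\<Phi> h Y = Some (rk_update s b h Y K)"
      using M(3)[of h Y] h \<delta>(2) YZ by auto
    obtain J where J: "rk_stages s a f h Z J" "\<forall>i<s. norm (J i) \<le> M" "\<Phi> h Z = Some (rk_update s b h Z J)"
      using M(3)[of h Z] h \<delta>(2) YZ by auto
    have "\<bar>h\<bar> * (A * M) \<le> \<bar>h\<bar> * (A * M + 2 * real s * L * A)" "\<bar>h\<bar> * (2 * real s * L * A) \<le> \<bar>h\<bar> * (A * M + 2 * real s * L * A)"
      using nonneg M(2) L(1) by (auto intro!: mult_left_mono)
    with \<delta>(3)[OF h] have small: "\<bar>h\<bar> * (A * M) \<le> 1" "\<bar>h\<bar> * (2 * real s * L * A) \<le> 1" by linarith+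
    have KJ: "(\<Sum>i<s. norm (K i - J i)) \<le> 2 * real s * L * norm (Y - Z)"
      using small unfolding A_def
      by (intro rk_stages_stable[OF L YZ(1) K(1,2) YZ(2) J(1,2) M(2)]) auto
    have "norm (rk_update s b h Y K - Y) = \<bar>h\<bar> * norm (\<Sum>j<s. b j *\<^sub>R K j)"
      unfolding rk_update_def by simp
    also have "\<dots> \<le> \<bar>h\<bar> * (\<beta> * M)"
      unfolding \<beta>_def by (intro mult_left_mono norm_weighted_sum_le K(2)) auto
    also have "\<dots> \<le> \<bar>h\<bar> * C"
      unfolding C_def using nonneg L(1) by (intro mult_left_mono) auto
    finally have inc: "norm (rk_update s b h Y K - Y) \<le> C * \<bar>h\<bar>" by (simp add: mult.commute)
    have "norm (\<Sum>j<s. b j *\<^sub>R (K j - J j)) \<le> \<beta> * (2 * real s * L * norm (Y - Z))"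
    proof -
      have "norm (K j - J j) \<le> 2 * real s * L * norm (Y - Z)" if "j < s" for j
        using KJ member_le_sum[of j "{..<s}" "\<lambda>j. norm (K j - J j)"] that by fastforce
      then show ?thesis unfolding \<beta>_def by (intro norm_weighted_sum_le) auto
    qed
    also have "\<dots> \<le> C * norm (Y - Z)"
      unfolding C_def using nonneg M(2) by (simp add: algebra_simps)
    finally have "norm (\<Sum>j<s. b j *\<^sub>R (K j - J j)) \<le> C * norm (Y - Z)" .
    moreover have "rk_update s b h Y K - rk_update s b h Z J
        = (Y - Z) + h *\<^sub>R (\<Sum>j<s. b j *\<^sub>R (K j - J j))"
      unfolding rk_update_def by (simp add: algebra_simps sum_subtractf)
    moreover have "norm ((Y - Z) + h *\<^sub>R (\<Sum>j<s. b j *\<^sub>R (K j - J j)))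
        \<le> norm (Y - Z) + \<bar>h\<bar> * norm (\<Sum>j<s. b j *\<^sub>R (K j - J j))"
      using norm_triangle_ineq[of "Y - Z" "h *\<^sub>R (\<Sum>j<s. b j *\<^sub>R (K j - J j))"] by simp
    ultimately have "norm (rk_update s b h Y K - rk_update s b h Z J)
        \<le> norm (Y - Z) + \<bar>h\<bar> * (C * norm (Y - Z))"
      using mult_left_mono[of _ _ "\<bar>h\<bar>"] by (smt (verit) abs_ge_zero)
    then have "norm (rk_update s b h Y K - rk_update s b h Z J) \<le> (1 + C * \<bar>h\<bar>) * norm (Y - Z)"
      by (simp add: algebra_simps)
    with inc K(3) J(3) show "\<exists>Y' Z'. \<Phi> h Y = Some Y' \<and> \<Phi> h Z = Some Z' \<and>
           norm (Y' - Y) \<le> C * \<bar>h\<bar> \<and> norm (Y' - Z') \<le> (1 + C * \<bar>h\<bar>) * norm (Y - Z)"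
      by blast
  qed (use nonneg M(2) L(1) in \<open>auto simp: C_def\<close>)
qed

section \<open>Quadratic invariants and symmetry of Runge--Kutta schemes\<close>

text \<open>
  Cooper's theorem. Expanding the form at the updated state gives a term linear in \<open>h\<close> and one quadratic in \<open>h\<close>.
  Tangency at the stages, as opposed to tangency at \<open>Y\<close>, turns the linear term into a double sum with
  weights \<open>b\<^sub>i a\<^sub>i\<^sub>j\<close>; symmetrising this sum, the condition on the coefficients makes it cancel the quadratic term.
\<close>

lemma rk_preserves_quadratic:
  fixes B :: "'a::real_normed_vector \<Rightarrow> 'a \<Rightarrow> real"
  assumes B: "bilinear B" and sym: "\<And>x y. B x y = B y x"
    and coeff: "\<forall>i<s. \<forall>j<s. b i * a i j + b j * a j i = b i * b j"
    and tangent: "\<And>i. i < s \<Longrightarrow> B (Y + h *\<^sub>R (\<Sum>j<s. a i j *\<^sub>R K j)) (K i) = 0"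
  shows "B (rk_update s b h Y K) (rk_update s b h Y K) = B Y Y"
proof -
  define S where "S = (\<Sum>j<s. b j *\<^sub>R K j)"
  have linr: "linear (B x)" and linl: "linear (\<lambda>x. B x y)" for x y
    using B unfolding bilinear_def by auto
  have sumr: "B x (\<Sum>j<s. c j *\<^sub>R K j) = (\<Sum>j<s. c j * B x (K j))" for x c
    using linear_sum[OF linr[of x], of "\<lambda>j. c j *\<^sub>R K j" "{..<s}"] by (simp add: linear_cmul[OF linr])
  have suml: "B (\<Sum>j<s. c j *\<^sub>R K j) y = (\<Sum>j<s. c j * B (K j) y)" for y c
    using sumr[of y c] by (simp add: sym)
  have BY: "B Y (K i) = - h * (\<Sum>j<s. a i j * B (K j) (K i))" if "i < s" for i
    using tangent[OF that]
    by (simp add: linear_add[OF linl] linear_cmul[OF linl] suml)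
  have BYS: "B Y S = - h * (\<Sum>i<s. \<Sum>j<s. b i * a i j * B (K j) (K i))"
    unfolding S_def sumr by (simp add: BY sum_distrib_left mult.assoc mult.left_commute sum_negf)
  have BSS: "B S S = (\<Sum>i<s. \<Sum>j<s. b i * b j * B (K j) (K i))"
    unfolding S_def sumr by (simp add: suml sum_distrib_left mult.assoc)
  have "2 * (\<Sum>i<s. \<Sum>j<s. b i * a i j * B (K j) (K i))
      = (\<Sum>i<s. \<Sum>j<s. b i * a i j * B (K j) (K i)) + (\<Sum>j<s. \<Sum>i<s. b i * a i j * B (K j) (K i))"
    by (simp add: sum.swap[of "\<lambda>i j. b i * a i j * B (K j) (K i)"])
  also have "(\<Sum>j<s. \<Sum>i<s. b i * a i j * B (K j) (K i)) = (\<Sum>i<s. \<Sum>j<s. b j * a j i * B (K j) (K i))"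
    by (simp add: sym)
  also have "(\<Sum>i<s. \<Sum>j<s. b i * a i j * B (K j) (K i)) + (\<Sum>i<s. \<Sum>j<s. b j * a j i * B (K j) (K i))
      = (\<Sum>i<s. \<Sum>j<s. (b i * a i j + b j * a j i) * B (K j) (K i))"
    by (simp add: sum.distrib distrib_right)
  also have "\<dots> = B S S"
    unfolding BSS using coeff by (intro sum.cong) auto
  finally have "2 * B Y S = - h * B S S"
    unfolding BYS by simp
  moreover have "B (Y + h *\<^sub>R S) (Y + h *\<^sub>R S) = B Y Y + h * (2 * B Y S) + h * h * B S S"
    using sym[of S Y] by (simp add: linear_add[OF linl] linear_cmul[OF linl] linear_add[OF linr]
        linear_cmul[OF linr] algebra_simps)
  ultimately show ?thesis unfolding rk_update_def S_def[symmetric] by simp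
qed

lemma sum_reverse: "(\<Sum>j<s. g (s - 1 - j)) = (\<Sum>j<s. g j :: 'a::comm_monoid_add)" for s :: nat
  using sum.nat_diff_reindex[of g s] by simp

text \<open>
  Let \<open>Y1\<close> be the result of the step of size \<open>-h\<close> from \<open>Y\<close>. The stages of that step in reverse order
  solve the stage equations of the step of size \<open>h\<close> from \<open>Y1\<close>. The method might use other stages there,
  but both families are bounded, hence equal for small \<open>h\<close>, and the update leads back to \<open>Y\<close>.
\<close>

theorem rk_symmetric_imp_symmetric_method:
  fixes f :: "'a::real_normed_vector \<Rightarrow> 'a"
  assumes \<Phi>: "rk_method s a b f \<Phi>" and f: "quad_smooth f" and ab: "rk_symmetric s a b"
  shows "symmetric_method \<Phi>"
  unfolding symmetric_method_def
proof (intro allI impI)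
  fix B :: "'a set" assume "bounded B"
  then obtain R where R: "\<And>Y. Y \<in> B \<Longrightarrow> norm Y \<le> R" by (auto simp: bounded_iff)
  obtain D where D: "quad_deriv f D" using f unfolding quad_smooth_def by blast
  obtain L where L: "L \<ge> 0"
    "\<And>x z. norm x \<le> (R + 1) + 1 \<Longrightarrow> norm z \<le> (R + 1) + 1 \<Longrightarrow> norm (f z - f x) \<le> L * norm (z - x)"
    using quad_deriv_lipschitz[OF D, where R = "(R + 1) + 1"] by blast
  obtain \<delta>0 M0 where M0: "\<delta>0 > 0" "M0 \<ge> 0"
    "\<And>h Y. \<bar>h\<bar> \<le> \<delta>0 \<Longrightarrow> norm Y \<le> R \<Longrightarrow>
       \<exists>K. rk_stages s a f h Y K \<and> (\<forall>i<s. norm (K i) \<le> M0) \<and> \<Phi> h Y = Some (rk_update s b h Y K)"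
    using rk_methodE[OF \<Phi>, where R = R] by blast
  obtain \<delta>1 M1 where M1: "\<delta>1 > 0" "M1 \<ge> 0"
    "\<And>h Y. \<bar>h\<bar> \<le> \<delta>1 \<Longrightarrow> norm Y \<le> R + 1 \<Longrightarrow>
       \<exists>K. rk_stages s a f h Y K \<and> (\<forall>i<s. norm (K i) \<le> M1) \<and> \<Phi> h Y = Some (rk_update s b h Y K)"
    using rk_methodE[OF \<Phi>, where R = "R + 1"] by blast
  define A where "A = coeff_sum s a"
  define \<beta> where "\<beta> = (\<Sum>j<s. \<bar>b j\<bar>)"
  define M where "M = max M0 M1"
  have nonneg: "0 \<le> A * M" "0 \<le> 2 * real s * L * A" "0 \<le> \<beta> * M0" "0 \<le> M"
    using M0(2) L(1) unfolding A_def \<beta>_def M_def by (auto simp: coeff_sum_nonneg sum_nonneg)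
  obtain \<delta> where \<delta>: "\<delta> > 0" "\<delta> \<le> min \<delta>0 \<delta>1"
    "\<And>h. \<bar>h\<bar> \<le> \<delta> \<Longrightarrow> \<bar>h\<bar> * (A * M + 2 * real s * L * A + \<beta> * M0) \<le> 1"
    using small_step[of "min \<delta>0 \<delta>1" "A * M + 2 * real s * L * A + \<beta> * M0"] M0(1) M1(1) nonneg
    by (metis add_nonneg_nonneg min_less_iff_conj)
  have "(\<Phi> h \<circ>\<^sub>m \<Phi> (- h)) Y = Some Y" if h: "\<bar>h\<bar> \<le> \<delta>" and "Y \<in> B" for h Y
  proof -
    have small: "\<bar>h\<bar> * x \<le> 1" if "x \<le> A * M + 2 * real s * L * A + \<beta> * M0" for x
      using mult_left_mono[OF that, of "\<bar>h\<bar>"] \<delta>(3)[OF h] by simp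
    have h01: "\<bar>- h\<bar> \<le> \<delta>0" "\<bar>h\<bar> \<le> \<delta>1" using h \<delta>(2) by auto
    obtain K where K: "rk_stages s a f (- h) Y K" "\<forall>i<s. norm (K i) \<le> M0"
        "\<Phi> (- h) Y = Some (rk_update s b (- h) Y K)"
      using M0(3)[OF h01(1) R[OF \<open>Y \<in> B\<close>]] by blast
    define Y1 where "Y1 = rk_update s b (- h) Y K"
    have Y1: "Y1 = Y - h *\<^sub>R (\<Sum>j<s. b j *\<^sub>R K j)"
      unfolding Y1_def rk_update_def by simp
    have "norm Y1 \<le> norm Y + \<bar>h\<bar> * norm (\<Sum>j<s. b j *\<^sub>R K j)"
      unfolding Y1 using norm_triangle_ineq4[of Y "h *\<^sub>R (\<Sum>j<s. b j *\<^sub>R K j)"] by (metis norm_scaleR)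
    also have "\<dots> \<le> norm Y + \<bar>h\<bar> * (\<beta> * M0)"
      unfolding \<beta>_def by (intro add_left_mono mult_left_mono norm_weighted_sum_le K(2)) auto
    also have "\<dots> \<le> R + 1"
      using small[of "\<beta> * M0"] nonneg R[OF \<open>Y \<in> B\<close>] by linarith
    finally have Y1_bound: "norm Y1 \<le> R + 1" .
    obtain J where J: "rk_stages s a f h Y1 J" "\<forall>i<s. norm (J i) \<le> M1"
        "\<Phi> h Y1 = Some (rk_update s b h Y1 J)"
      using M1(3)[OF h01(2) Y1_bound] by blast
    define K' where "K' i = K (s - 1 - i)" for i
    have "rk_stages s a f h Y1 K'"
      unfolding rk_stages_def
    proof (intro allI impI)
      fix i assume i: "i < s"
      define i' where "i' = s - 1 - i"
      have i': "i' < s" using i unfolding i'_def by auto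
      have "(\<Sum>j<s. a i j *\<^sub>R K' j) = (\<Sum>j<s. (b (s - 1 - j) - a i' (s - 1 - j)) *\<^sub>R K (s - 1 - j))"
      proof (rule sum.cong)
        fix j assume "j \<in> {..<s}"
        then have "a i j = b (s - 1 - j) - a i' (s - 1 - j)"
          using ab i unfolding rk_symmetric_def i'_def by blast
        then show "a i j *\<^sub>R K' j = (b (s - 1 - j) - a i' (s - 1 - j)) *\<^sub>R K (s - 1 - j)"
          unfolding K'_def by (rule arg_cong)
      qed simp
      also have "\<dots> = (\<Sum>j<s. (b j - a i' j) *\<^sub>R K j)"
        by (rule sum_reverse[of "\<lambda>j. (b j - a i' j) *\<^sub>R K j"])
      also have "\<dots> = (\<Sum>j<s. b j *\<^sub>R K j) - (\<Sum>j<s. a i' j *\<^sub>R K j)"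
        by (simp add: scaleR_diff_left sum_subtractf)
      finally have "Y1 + h *\<^sub>R (\<Sum>j<s. a i j *\<^sub>R K' j) = Y + (- h) *\<^sub>R (\<Sum>j<s. a i' j *\<^sub>R K j)"
        unfolding Y1 by (simp add: scaleR_diff_right)
      then show "K' i = f (Y1 + h *\<^sub>R (\<Sum>j<s. a i j *\<^sub>R K' j))"
        using K(1) i' unfolding rk_stages_def K'_def i'_def by simp
    qed
    moreover have "\<forall>i<s. norm (K' i) \<le> M" "\<forall>i<s. norm (J i) \<le> M"
      using K(2) J(2) unfolding K'_def M_def by (auto simp: le_max_iff_disj)
    moreover have "\<bar>h\<bar> * (coeff_sum s a * M) \<le> 1" "\<bar>h\<bar> * (2 * real s * L * coeff_sum s a) \<le> 1"
      using small nonneg unfolding A_def by auto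
    ultimately have "(\<Sum>i<s. norm (J i - K' i)) \<le> 2 * real s * L * norm (Y1 - Y1)"
      using nonneg(4) Y1_bound J(1) by (intro rk_stages_stable[OF L]) auto
    then have "(\<Sum>i<s. norm (J i - K' i)) = 0"
      by (simp add: sum_nonneg antisym)
    then have JK: "J i = K' i" if "i < s" for i
      using that by (auto simp: sum_nonneg_eq_0_iff)
    have "(\<Sum>j<s. b j *\<^sub>R J j) = (\<Sum>j<s. b (s - 1 - j) *\<^sub>R K (s - 1 - j))"
    proof (rule sum.cong)
      fix j assume j: "j \<in> {..<s}"
      then have "b j = b (s - 1 - j)" using ab unfolding rk_symmetric_def by blast
      moreover have "J j = K (s - 1 - j)" using JK j unfolding K'_def by blast
      ultimately show "b j *\<^sub>R J j = b (s - 1 - j) *\<^sub>R K (s - 1 - j)" by simp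
    qed simp
    also have "\<dots> = (\<Sum>j<s. b j *\<^sub>R K j)"
      by (rule sum_reverse[of "\<lambda>j. b j *\<^sub>R K j"])
    finally have "rk_update s b h Y1 J = Y"
      unfolding rk_update_def Y1 by simp
    then show ?thesis using K(3) J(3) unfolding Y1_def by simp
  qed
  then show "\<exists>\<delta>>0. \<forall>dt Y. \<bar>dt\<bar> \<le> \<delta> \<and> Y \<in> B \<longrightarrow> (\<Phi> dt \<circ>\<^sub>m \<Phi> (- dt)) Y = Some Y"
    using \<delta>(1) by blast
qed

section \<open>Taylor expansion of a step\<close>

text \<open>
  The expansion point \<open>X\<close> may differ from the state \<open>Y\<close> by \<open>O(h)\<close>, so that all substeps of a splitting can be
  expanded about its starting point, with one and the same linear map \<open>D X\<close>.
\<close>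

definition expands_to_second_order ::
    "'a::real_normed_vector one_step \<Rightarrow> ('a \<Rightarrow> 'a) \<Rightarrow> ('a \<Rightarrow> 'a \<Rightarrow> 'a) \<Rightarrow> bool" where
  "expands_to_second_order \<Phi> f D \<longleftrightarrow>
     (\<forall>R \<rho>. \<exists>\<delta>>0. \<exists>C\<ge>0. \<forall>h X Y Y'.
        \<bar>h\<bar> \<le> \<delta> \<longrightarrow> norm X \<le> R \<longrightarrow> norm Y \<le> R \<longrightarrow> norm (Y - X) \<le> \<rho> * \<bar>h\<bar> \<longrightarrow> \<Phi> h Y = Some Y' \<longrightarrow>
        norm (Y' - Y - h *\<^sub>R f X - h *\<^sub>R D X (Y - X) - (h\<^sup>2 / 2) *\<^sub>R D X (f X)) \<le> C * \<bar>h\<bar> ^ 3)"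

lemma expands_to_second_orderE:
  assumes "expands_to_second_order \<Phi> f D"
  obtains \<delta> C where "\<delta> > 0" "C \<ge> 0"
    "\<And>h X Y Y'. \<bar>h\<bar> \<le> \<delta> \<Longrightarrow> norm X \<le> R \<Longrightarrow> norm Y \<le> R \<Longrightarrow> norm (Y - X) \<le> \<rho> * \<bar>h\<bar> \<Longrightarrow> \<Phi> h Y = Some Y' \<Longrightarrow>
        norm (Y' - Y - h *\<^sub>R f X - h *\<^sub>R D X (Y - X) - (h\<^sup>2 / 2) *\<^sub>R D X (f X)) \<le> C * \<bar>h\<bar> ^ 3"
proof -
  obtain \<delta> C where "\<delta> > 0" "C \<ge> 0" and *: "\<forall>h X Y Y'.
        \<bar>h\<bar> \<le> \<delta> \<longrightarrow> norm X \<le> R \<longrightarrow> norm Y \<le> R \<longrightarrow> norm (Y - X) \<le> \<rho> * \<bar>h\<bar> \<longrightarrow> \<Phi> h Y = Some Y' \<longrightarrow>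
        norm (Y' - Y - h *\<^sub>R f X - h *\<^sub>R D X (Y - X) - (h\<^sup>2 / 2) *\<^sub>R D X (f X)) \<le> C * \<bar>h\<bar> ^ 3"
    using assms[unfolded expands_to_second_order_def, THEN spec, THEN spec, of R \<rho>]
    by (elim exE conjE) (rule that; assumption)
  show ?thesis by (rule that[of \<delta> C]) (use \<open>\<delta> > 0\<close> \<open>C \<ge> 0\<close> * in blast)+
qed

text \<open>
  All stages are evaluated within \<open>O(h)\<close> of \<open>X\<close>, so \<open>K\<^sub>i = f X + O(h)\<close>. Inserting this into the linearised
  stage equation yields \<open>K\<^sub>i = f X + D X (Y - X) + h c\<^sub>i D X (f X) + O(h\<^sup>2)\<close> with \<open>c\<^sub>i = \<Sum>\<^sub>j a\<^sub>i\<^sub>j\<close>, and the two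
  order conditions evaluate the weighted sum.
\<close>

theorem rk_method_expands:
  fixes f :: "'a::real_normed_vector \<Rightarrow> 'a"
  assumes \<Phi>: "rk_method s a b f \<Phi>" and f: "quad_deriv f D"
    and order1: "(\<Sum>i<s. b i) = 1" and order2: "(\<Sum>i<s. b i * (\<Sum>j<s. a i j)) = 1 / 2"
  shows "expands_to_second_order \<Phi> f D"
  unfolding expands_to_second_order_def
proof (intro allI)
  fix R \<rho> :: real
  have lin: "linear (D x)" for x using f unfolding quad_deriv_def by blast
  obtain L where L: "L \<ge> 0"
    "\<And>x z. norm x \<le> R + 1 \<Longrightarrow> norm z \<le> R + 1 \<Longrightarrow> norm (f z - f x) \<le> L * norm (z - x)"
    using quad_deriv_lipschitz[OF f, where R = "R + 1"] by blast
  obtain C where C: "C \<ge> 0"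
    "\<And>x v. norm x \<le> R + 1 \<Longrightarrow> norm (D x v) \<le> C * norm v"
    "\<And>x z. norm x \<le> R + 1 \<Longrightarrow> norm z \<le> R + 1 \<Longrightarrow>
       norm (f z - f x - D x (z - x)) \<le> C * (norm (z - x))\<^sup>2"
    using quad_derivE[OF f, where R = "R + 1"] by blast
  obtain \<delta>0 M where M: "\<delta>0 > 0" "M \<ge> 0"
    "\<And>h Y. \<bar>h\<bar> \<le> \<delta>0 \<Longrightarrow> norm Y \<le> R \<Longrightarrow>
       \<exists>K. rk_stages s a f h Y K \<and> (\<forall>i<s. norm (K i) \<le> M) \<and> \<Phi> h Y = Some (rk_update s b h Y K)"
    using rk_methodE[OF \<Phi>, where R = R] by blast
  define A where "A = coeff_sum s a"
  have "A \<ge> 0" unfolding A_def by (rule coeff_sum_nonneg)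
  obtain \<delta> where \<delta>: "\<delta> > 0" "\<delta> \<le> \<delta>0" "\<And>h. \<bar>h\<bar> \<le> \<delta> \<Longrightarrow> \<bar>h\<bar> * (A * M) \<le> 1"
    using small_step[of \<delta>0 "A * M"] M(1,2) \<open>A \<ge> 0\<close> by auto
  define \<kappa> where "\<kappa> = \<bar>\<rho>\<bar> + A * M"
  have "\<kappa> \<ge> 0" unfolding \<kappa>_def using \<open>A \<ge> 0\<close> M(2) by simp
  define \<beta> where "\<beta> = (\<Sum>j<s. \<bar>b j\<bar>)"
  define E where "E = C * \<kappa>\<^sup>2 + C * (A * (L * \<kappa>))"
  have E0: "E \<ge> 0" unfolding E_def using C(1) \<open>A \<ge> 0\<close> L(1) \<open>\<kappa> \<ge> 0\<close> by simp
  have main: "norm (Y' - Y - h *\<^sub>R f X - h *\<^sub>R D X (Y - X) - (h\<^sup>2 / 2) *\<^sub>R D X (f X)) \<le> \<beta> * E * \<bar>h\<bar> ^ 3"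
    if h: "\<bar>h\<bar> \<le> \<delta>" and X: "norm X \<le> R" and Y: "norm Y \<le> R" and XY: "norm (Y - X) \<le> \<rho> * \<bar>h\<bar>"
      and Y': "\<Phi> h Y = Some Y'" for h X Y Y'
  proof -
    obtain K where K: "rk_stages s a f h Y K" "\<forall>i<s. norm (K i) \<le> M" "Y' = rk_update s b h Y K"
      using M(3)[of h Y] Y' Y h \<delta>(2) by auto
    define c where "c i = (\<Sum>j<s. a i j)" for i
    define Z where "Z i = Y + h *\<^sub>R (\<Sum>j<s. a i j *\<^sub>R K j)" for i
    have KZ: "K i = f (Z i)" if "i < s" for i
      using K(1) that unfolding rk_stages_def Z_def by blast
    have X1: "norm X \<le> R + 1" using X by simp
    have Z1: "norm (Z i) \<le> R + 1" if "i < s" for i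
      unfolding Z_def using rk_stage_bounded[OF that M(2) K(2) Y] \<delta>(3)[OF h] unfolding A_def .
    have ZX: "norm (Z i - X) \<le> \<kappa> * \<bar>h\<bar>" if "i < s" for i
    proof -
      have "norm (Z i - X) \<le> norm (Z i - Y) + norm (Y - X)"
        using norm_triangle_ineq[of "Z i - Y" "Y - X"] by simp
      moreover have "norm (Z i - Y) \<le> \<bar>h\<bar> * (A * M)"
        unfolding Z_def A_def by (rule rk_stage_near[OF that M(2) K(2)])
      moreover have "\<rho> * \<bar>h\<bar> \<le> \<bar>\<rho>\<bar> * \<bar>h\<bar>" by (intro mult_right_mono) auto
      ultimately show ?thesis using XY unfolding \<kappa>_def by (simp add: algebra_simps)
    qed
    have Kf: "norm (K i - f X) \<le> L * \<kappa> * \<bar>h\<bar>" if "i < s" for i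
      using L(2)[OF X1 Z1[OF that]] mult_left_mono[OF ZX[OF that] L(1)] KZ[OF that] by simp
    define r where "r i = K i - f X - D X (Y - X) - (h * c i) *\<^sub>R D X (f X)" for i
    have r: "norm (r i) \<le> E * h\<^sup>2" if i: "i < s" for i
    proof -
      have "(\<Sum>j<s. a i j *\<^sub>R K j) = (\<Sum>j<s. a i j *\<^sub>R (K j - f X)) + c i *\<^sub>R f X"
        by (simp add: c_def scaleR_diff_right sum_subtractf scaleR_left.sum)
      then have "Z i - X = (Y - X) + h *\<^sub>R (\<Sum>j<s. a i j *\<^sub>R (K j - f X)) + (h * c i) *\<^sub>R f X"
        unfolding Z_def by (simp add: algebra_simps)
      then have "D X (Z i - X) = D X (Y - X) + h *\<^sub>R D X (\<Sum>j<s. a i j *\<^sub>R (K j - f X)) + (h * c i) *\<^sub>R D X (f X)"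
        by (simp only: linear_add[OF lin] linear_cmul[OF lin])
      then have "r i = (f (Z i) - f X - D X (Z i - X)) + h *\<^sub>R D X (\<Sum>j<s. a i j *\<^sub>R (K j - f X))"
        unfolding r_def KZ[OF i] by simp
      also have "norm \<dots> \<le> norm (f (Z i) - f X - D X (Z i - X)) + \<bar>h\<bar> * norm (D X (\<Sum>j<s. a i j *\<^sub>R (K j - f X)))"
        by (rule order_trans[OF norm_triangle_ineq]) simp
      also have "\<dots> \<le> C * (\<kappa> * \<bar>h\<bar>)\<^sup>2 + \<bar>h\<bar> * (C * (A * (L * \<kappa> * \<bar>h\<bar>)))"
      proof (intro add_mono mult_left_mono)
        have "C * (norm (Z i - X))\<^sup>2 \<le> C * (\<kappa> * \<bar>h\<bar>)\<^sup>2"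
          by (intro mult_left_mono power_mono ZX i C(1)) simp
        then show "norm (f (Z i) - f X - D X (Z i - X)) \<le> C * (\<kappa> * \<bar>h\<bar>)\<^sup>2"
          using C(3)[OF X1 Z1[OF i]] by linarith
        have "norm (\<Sum>j<s. a i j *\<^sub>R (K j - f X)) \<le> A * (L * \<kappa> * \<bar>h\<bar>)"
          unfolding A_def using Kf L(1) \<open>\<kappa> \<ge> 0\<close> by (intro norm_stage_sum_le i) auto
        then show "norm (D X (\<Sum>j<s. a i j *\<^sub>R (K j - f X))) \<le> C * (A * (L * \<kappa> * \<bar>h\<bar>))"
          using C(2)[OF X1] C(1) by (meson mult_left_mono order_trans)
      qed simp
      also have "\<dots> = E * h\<^sup>2"
        unfolding E_def by (simp add: power_mult_distrib algebra_simps power2_eq_square flip: abs_mult)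
      finally show ?thesis .
    qed
    have "(\<Sum>i<s. b i *\<^sub>R K i) = (\<Sum>i<s. b i *\<^sub>R r i) + (\<Sum>i<s. b i) *\<^sub>R f X
        + (\<Sum>i<s. b i) *\<^sub>R D X (Y - X) + (h * (\<Sum>i<s. b i * c i)) *\<^sub>R D X (f X)"
      unfolding r_def
      by (simp add: scaleR_diff_right sum_subtractf scaleR_left.sum sum_distrib_left mult.left_commute)
    also have "\<dots> = (\<Sum>i<s. b i *\<^sub>R r i) + f X + D X (Y - X) + (h / 2) *\<^sub>R D X (f X)"
      using order1 order2 by (simp add: c_def)
    finally have "Y' - Y - h *\<^sub>R f X - h *\<^sub>R D X (Y - X) - (h\<^sup>2 / 2) *\<^sub>R D X (f X) = h *\<^sub>R (\<Sum>i<s. b i *\<^sub>R r i)"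
      unfolding K(3) rk_update_def by (simp add: algebra_simps power2_eq_square)
    moreover have "norm (\<Sum>i<s. b i *\<^sub>R r i) \<le> \<beta> * (E * h\<^sup>2)"
      unfolding \<beta>_def using r by (intro norm_weighted_sum_le) blast
    ultimately have "norm (Y' - Y - h *\<^sub>R f X - h *\<^sub>R D X (Y - X) - (h\<^sup>2 / 2) *\<^sub>R D X (f X)) \<le> \<bar>h\<bar> * (\<beta> * (E * h\<^sup>2))"
      by (simp add: mult_left_mono)
    also have "\<dots> = \<beta> * E * \<bar>h\<bar> ^ 3"
      by (simp add: power3_eq_cube power2_eq_square algebra_simps flip: abs_mult)
    finally show ?thesis .
  qed
  have "\<beta> * E \<ge> 0" using E0 unfolding \<beta>_def by (simp add: sum_nonneg)
  with \<delta>(1) main show "\<exists>\<delta>>0. \<exists>C\<ge>0. \<forall>h X Y Y'.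
        \<bar>h\<bar> \<le> \<delta> \<longrightarrow> norm X \<le> R \<longrightarrow> norm Y \<le> R \<longrightarrow> norm (Y - X) \<le> \<rho> * \<bar>h\<bar> \<longrightarrow> \<Phi> h Y = Some Y' \<longrightarrow>
        norm (Y' - Y - h *\<^sub>R f X - h *\<^sub>R D X (Y - X) - (h\<^sup>2 / 2) *\<^sub>R D X (f X)) \<le> C * \<bar>h\<bar> ^ 3"
    by blast
qed

text \<open>
  The sum of \<open>b\<^sub>i a\<^sub>i\<^sub>j + b\<^sub>j a\<^sub>j\<^sub>i\<close> over all \<open>i, j\<close> is twice the sum in question, the sum of \<open>b\<^sub>i b\<^sub>j\<close> is \<open>1\<close>.
\<close>

lemma symplectic_order2:
  fixes a :: "nat \<Rightarrow> nat \<Rightarrow> real"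
  assumes coeff: "\<forall>i<s. \<forall>j<s. b i * a i j + b j * a j i = b i * b j" and "(\<Sum>i<s. b i) = 1"
  shows "(\<Sum>i<s. b i * (\<Sum>j<s. a i j)) = 1 / 2"
proof -
  have "1 = (\<Sum>i<s. b i) * (\<Sum>j<s. b j)" using assms(2) by simp
  also have "\<dots> = (\<Sum>i<s. \<Sum>j<s. b i * b j)" by (rule sum_product)
  also have "\<dots> = (\<Sum>i<s. \<Sum>j<s. b i * a i j + b j * a j i)"
    using coeff by (intro sum.cong) auto
  also have "\<dots> = (\<Sum>i<s. \<Sum>j<s. b i * a i j) + (\<Sum>i<s. \<Sum>j<s. b j * a j i)"
    by (simp add: sum.distrib)
  also have "(\<Sum>i<s. \<Sum>j<s. b j * a j i) = (\<Sum>j<s. \<Sum>i<s. b j * a j i)"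
    by (rule sum.swap)
  finally have "(\<Sum>i<s. \<Sum>j<s. b i * a i j) = 1 / 2" by simp
  then show ?thesis by (simp only: sum_distrib_left)
qed

section \<open>Taylor expansion of the exact solution\<close>

lemma norm_increment_le:
  fixes g :: "real \<Rightarrow> 'a::real_normed_vector"
  assumes "t \<le> u" and g: "\<And>s. s \<in> {t..u} \<Longrightarrow> (g has_vector_derivative g' s) (at s within {t..u})"
    and B: "\<And>s. s \<in> {t..u} \<Longrightarrow> norm (g' s) \<le> B"
  shows "norm (g u - g t) \<le> B * (u - t)"
proof -
  have "norm (g u - g t) \<le> B * norm (u - t)"
  proof (rule differentiable_bound)
    show "(g has_derivative (\<lambda>x. x *\<^sub>R g' s)) (at s within {t..u})" if "s \<in> {t..u}" for s
      using g[OF that] unfolding has_vector_derivative_def .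
    show "onorm (\<lambda>x. x *\<^sub>R g' s) \<le> B" if "s \<in> {t..u}" for s
    proof (rule onorm_bound)
      show "0 \<le> B" using B[OF that] norm_ge_zero order_trans by blast
      show "norm (x *\<^sub>R g' s) \<le> B * norm x" for x
        using mult_left_mono[OF B[OF that], of "\<bar>x\<bar>"] by (simp add: mult.commute)
    qed
  qed (use \<open>t \<le> u\<close> in auto)
  with \<open>t \<le> u\<close> show ?thesis by simp
qed

lemma ode_solution_bounded:
  fixes Y :: "real \<Rightarrow> 'a::real_normed_vector"
  assumes "ode_solution f T Y"
  obtains R where "R \<ge> 0" "\<And>t. 0 \<le> t \<Longrightarrow> t \<le> T \<Longrightarrow> norm (Y t) \<le> R"
proof -
  have "continuous_on {0..T} Y"
    using assms unfolding ode_solution_def continuous_on_eq_continuous_within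
    by (blast intro: has_vector_derivative_continuous)
  then have "bounded (Y ` {0..T})"
    by (intro compact_imp_bounded compact_continuous_image compact_Icc)
  then obtain R where "\<forall>x\<in>Y ` {0..T}. norm x \<le> R" unfolding bounded_iff by blast
  then show ?thesis by (intro that[of "max R 0"]) (auto simp: le_max_iff_disj)
qed

text \<open>
  A bootstrap through the mean value inequality: the solution moves by \<open>O(h)\<close>, hence its velocity
  changes by \<open>O(h)\<close>, hence the first-order expansion holds up to \<open>O(h\<^sup>2)\<close>; inserted into the linearisation of \<open>f\<close>
  this gives the velocity up to \<open>O(h\<^sup>2)\<close> and the solution up to \<open>O(h\<^sup>3)\<close>.
\<close>

lemma exact_expansion:
  fixes f :: "'a::real_normed_vector \<Rightarrow> 'a"
  assumes f: "quad_deriv f D" and Y: "ode_solution f T Y"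
  shows "\<exists>C\<ge>0. \<forall>t h. 0 \<le> t \<longrightarrow> 0 \<le> h \<longrightarrow> t + h \<le> T \<longrightarrow>
    norm (Y (t + h) - Y t - h *\<^sub>R f (Y t) - (h\<^sup>2 / 2) *\<^sub>R D (Y t) (f (Y t))) \<le> C * h ^ 3"
proof -
  obtain R where R: "R \<ge> 0" "\<And>t. 0 \<le> t \<Longrightarrow> t \<le> T \<Longrightarrow> norm (Y t) \<le> R"
    using ode_solution_bounded[OF Y] by blast
  have lin: "linear (D x)" for x using f unfolding quad_deriv_def by blast
  obtain L where L: "L \<ge> 0"
    "\<And>x z. norm x \<le> R \<Longrightarrow> norm z \<le> R \<Longrightarrow> norm (f z - f x) \<le> L * norm (z - x)"
    using quad_deriv_lipschitz[OF f, where R = R] by blast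
  obtain F where F: "F \<ge> 0" "\<And>x. norm x \<le> R \<Longrightarrow> norm (f x) \<le> F"
    using quad_deriv_bounded[OF f, where R = R] by blast
  obtain C where C: "C \<ge> 0"
    "\<And>x v. norm x \<le> R \<Longrightarrow> norm (D x v) \<le> C * norm v"
    "\<And>x z. norm x \<le> R \<Longrightarrow> norm z \<le> R \<Longrightarrow>
       norm (f z - f x - D x (z - x)) \<le> C * (norm (z - x))\<^sup>2"
    using quad_derivE[OF f, where R = R] by blast
  define E where "E = C * F\<^sup>2 + C * (L * F)"
  have main: "norm (Y (t + h) - Y t - h *\<^sub>R f (Y t) - (h\<^sup>2 / 2) *\<^sub>R D (Y t) (f (Y t))) \<le> E * h ^ 3"
    if t: "0 \<le> t" "0 \<le> h" "t + h \<le> T" for t h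
  proof -
    define X where "X = Y t"
    have bound: "norm (Y s) \<le> R" if "s \<in> {t..t + h}" for s
      using R(2)[of s] that t by auto
    have X: "norm X \<le> R" unfolding X_def using bound t by simp
    have deriv: "(Y has_vector_derivative f (Y s)) (at s within {t..u})"
      if "s \<in> {t..u}" "u \<le> t + h" for s u
      using Y that t unfolding ode_solution_def
      by (auto intro: has_vector_derivative_within_subset[where S = "{0..T}"])
    have inc: "norm (Y u - X) \<le> F * h" if u: "u \<in> {t..t + h}" for u
    proof -
      have "norm (Y u - Y t) \<le> F * (u - t)"
        using u deriv F(2) bound by (intro norm_increment_le) auto
      also have "\<dots> \<le> F * h" using u F(1) by (intro mult_left_mono) auto
      finally show ?thesis unfolding X_def .
    qed
    have f_inc: "norm (f (Y u) - f X) \<le> L * F * h" if u: "u \<in> {t..t + h}" for u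
      using L(2)[OF X bound[OF u]] mult_left_mono[OF inc[OF u] L(1)] by simp
    have first: "norm (Y u - X - (u - t) *\<^sub>R f X) \<le> L * F * h\<^sup>2" if u: "u \<in> {t..t + h}" for u
    proof -
      have "norm ((Y u - u *\<^sub>R f X) - (Y t - t *\<^sub>R f X)) \<le> L * F * h * (u - t)"
      proof (rule norm_increment_le)
        fix s assume s: "s \<in> {t..u}"
        show "((\<lambda>u. Y u - u *\<^sub>R f X) has_vector_derivative f (Y s) - f X) (at s within {t..u})"
          by (rule derivative_eq_intros deriv | use s u in auto)+
        show "norm (f (Y s) - f X) \<le> L * F * h" using f_inc[of s] s u by auto
      qed (use u in simp)
      also have "\<dots> \<le> L * F * h * h"
        using u L(1) F(1) t(2) by (intro mult_left_mono) auto
      finally show ?thesis unfolding X_def by (simp add: algebra_simps power2_eq_square)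
    qed
    \<comment> \<open>The quadratic Taylor polynomial is subtracted up to a constant; its derivative is the error in the velocity.\<close>
    define g where "g u = Y u - u *\<^sub>R f X - ((u - t)\<^sup>2 / 2) *\<^sub>R D X (f X)" for u
    have "norm (g (t + h) - g t) \<le> E * h\<^sup>2 * ((t + h) - t)"
    proof (rule norm_increment_le)
      fix s assume s: "s \<in> {t..t + h}"
      show "(g has_vector_derivative f (Y s) - f X - (s - t) *\<^sub>R D X (f X)) (at s within {t..t + h})"
      proof -
        have "((\<lambda>u. (u - t)\<^sup>2 / 2) has_real_derivative s - t) (at s within {t..t + h})"
          "((\<lambda>u. u *\<^sub>R f X) has_vector_derivative f X) (at s within {t..t + h})"
          by (auto intro!: derivative_eq_intros)
        then show ?thesis
          unfolding g_def
          using has_vector_derivative_diff[OF has_vector_derivative_diff[OF deriv[OF s order_refl]]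
              has_vector_derivative_scaleR[OF _ has_vector_derivative_const]] by fastforce
      qed
      have "f (Y s) - f X - (s - t) *\<^sub>R D X (f X)
          = (f (Y s) - f X - D X (Y s - X)) + D X (Y s - X - (s - t) *\<^sub>R f X)"
        by (simp add: linear_diff[OF lin] linear_cmul[OF lin])
      also have "norm \<dots> \<le> C * (norm (Y s - X))\<^sup>2 + C * norm (Y s - X - (s - t) *\<^sub>R f X)"
        using norm_triangle_ineq C(3)[OF X bound[OF s]] C(2)[OF X] by (meson add_mono order_trans)
      also have "\<dots> \<le> C * (F * h)\<^sup>2 + C * (L * F * h\<^sup>2)"
        by (intro add_mono mult_left_mono power_mono inc first s C(1)) simp
      also have "\<dots> = E * h\<^sup>2" unfolding E_def by (simp add: power_mult_distrib algebra_simps)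
      finally show "norm (f (Y s) - f X - (s - t) *\<^sub>R D X (f X)) \<le> E * h\<^sup>2" .
    qed (use t in simp)
    moreover have "g (t + h) - g t = Y (t + h) - Y t - h *\<^sub>R f X - (h\<^sup>2 / 2) *\<^sub>R D X (f X)"
      unfolding g_def by (simp add: algebra_simps)
    ultimately show ?thesis unfolding X_def by (simp add: power3_eq_cube power2_eq_square mult.assoc)
  qed
  have "E \<ge> 0" unfolding E_def using C(1) L(1) F(1) by simp
  with main show ?thesis by blast
qed

section \<open>Composition of one-step methods\<close>

lemma stable_step_boundE:
  assumes "stable_step \<Phi>"
  obtains \<delta> L where "\<delta> > 0" "L \<ge> 0"
    "\<And>h Y. \<bar>h\<bar> \<le> \<delta> \<Longrightarrow> norm Y \<le> R \<Longrightarrow> \<exists>Y'. \<Phi> h Y = Some Y' \<and> norm (Y' - Y) \<le> L * \<bar>h\<bar>"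
  using assms by (rule stable_stepE[where R = R]) (rule that)

lemma stable_step_compose:
  fixes \<Phi> \<Psi> :: "'a::real_normed_vector one_step"
  assumes \<Phi>: "stable_step \<Phi>" and \<Psi>: "stable_step \<Psi>"
  shows "stable_step (\<lambda>h. \<Psi> h \<circ>\<^sub>m \<Phi> h)"
  unfolding stable_step_def
proof
  fix R :: real
  obtain \<delta>1 L1 where 1: "\<delta>1 > 0" "L1 \<ge> 0"
    "\<And>h Y. \<bar>h\<bar> \<le> \<delta>1 \<Longrightarrow> norm Y \<le> R \<Longrightarrow> \<exists>Y'. \<Phi> h Y = Some Y' \<and> norm (Y' - Y) \<le> L1 * \<bar>h\<bar>"
    "\<And>h Y Z Y' Z'. \<bar>h\<bar> \<le> \<delta>1 \<Longrightarrow> norm Y \<le> R \<Longrightarrow> norm Z \<le> R \<Longrightarrow> \<Phi> h Y = Some Y' \<Longrightarrow> \<Phi> h Z = Some Z' \<Longrightarrow>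
       norm (Y' - Z') \<le> (1 + L1 * \<bar>h\<bar>) * norm (Y - Z)"
    using stable_stepE[OF \<Phi>, where R = R] by blast
  obtain \<delta>2 L2 where 2: "\<delta>2 > 0" "L2 \<ge> 0"
    "\<And>h Y. \<bar>h\<bar> \<le> \<delta>2 \<Longrightarrow> norm Y \<le> R + 1 \<Longrightarrow> \<exists>Y'. \<Psi> h Y = Some Y' \<and> norm (Y' - Y) \<le> L2 * \<bar>h\<bar>"
    "\<And>h Y Z Y' Z'. \<bar>h\<bar> \<le> \<delta>2 \<Longrightarrow> norm Y \<le> R + 1 \<Longrightarrow> norm Z \<le> R + 1 \<Longrightarrow> \<Psi> h Y = Some Y' \<Longrightarrow> \<Psi> h Z = Some Z' \<Longrightarrow>
       norm (Y' - Z') \<le> (1 + L2 * \<bar>h\<bar>) * norm (Y - Z)"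
    using stable_stepE[OF \<Psi>, where R = "R + 1"] by blast
  obtain \<delta> where \<delta>: "\<delta> > 0" "\<delta> \<le> min \<delta>1 \<delta>2" "\<And>h. \<bar>h\<bar> \<le> \<delta> \<Longrightarrow> \<bar>h\<bar> * L1 \<le> 1"
    using small_step[of "min \<delta>1 \<delta>2" L1] 1(1,2) 2(1) by (metis min_less_iff_conj)
  have step: "\<exists>Y' Z'. (\<Psi> h \<circ>\<^sub>m \<Phi> h) Y = Some Y' \<and> (\<Psi> h \<circ>\<^sub>m \<Phi> h) Z = Some Z' \<and>
           norm (Y' - Y) \<le> (L1 + 2 * L2) * \<bar>h\<bar> \<and> norm (Y' - Z') \<le> (1 + (L1 + 2 * L2) * \<bar>h\<bar>) * norm (Y - Z)"
    if h: "\<bar>h\<bar> \<le> \<delta>" and YZ: "norm Y \<le> R" "norm Z \<le> R" for h Y Z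
  proof -
    have h12: "\<bar>h\<bar> \<le> \<delta>1" "\<bar>h\<bar> \<le> \<delta>2" using h \<delta>(2) by auto
    obtain Y1 where Y1: "\<Phi> h Y = Some Y1" "norm (Y1 - Y) \<le> L1 * \<bar>h\<bar>"
      using 1(3)[OF h12(1) YZ(1)] by blast
    obtain Z1 where Z1: "\<Phi> h Z = Some Z1" "norm (Z1 - Z) \<le> L1 * \<bar>h\<bar>"
      using 1(3)[OF h12(1) YZ(2)] by blast
    have b: "norm Y1 \<le> R + 1" "norm Z1 \<le> R + 1"
      using Y1(2) Z1(2) YZ \<delta>(3)[OF h] norm_triangle_ineq2[of Y1 Y] norm_triangle_ineq2[of Z1 Z]
      by (auto simp: mult.commute)
    obtain Y2 where Y2: "\<Psi> h Y1 = Some Y2" "norm (Y2 - Y1) \<le> L2 * \<bar>h\<bar>"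
      using 2(3)[OF h12(2) b(1)] by blast
    obtain Z2 where Z2: "\<Psi> h Z1 = Some Z2"
      using 2(3)[OF h12(2) b(2)] by blast
    have "norm (Y2 - Y) \<le> norm (Y2 - Y1) + norm (Y1 - Y)"
      using norm_triangle_ineq[of "Y2 - Y1" "Y1 - Y"] by simp
    also have "\<dots> \<le> (L1 + L2) * \<bar>h\<bar>"
      using Y1(2) Y2(2) by (simp add: algebra_simps)
    also have "\<dots> \<le> (L1 + 2 * L2) * \<bar>h\<bar>"
      using 2(2) by (intro mult_right_mono) auto
    finally have inc: "norm (Y2 - Y) \<le> (L1 + 2 * L2) * \<bar>h\<bar>" .
    have "norm (Y2 - Z2) \<le> (1 + L2 * \<bar>h\<bar>) * norm (Y1 - Z1)"
      using 2(4)[OF h12(2) b Y2(1) Z2] .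
    also have "\<dots> \<le> (1 + L2 * \<bar>h\<bar>) * ((1 + L1 * \<bar>h\<bar>) * norm (Y - Z))"
      using 1(4)[OF h12(1) YZ Y1(1) Z1(1)] 2(2) by (intro mult_left_mono) auto
    also have "\<dots> = ((1 + L2 * \<bar>h\<bar>) * (1 + L1 * \<bar>h\<bar>)) * norm (Y - Z)" by simp
    also have "\<dots> \<le> (1 + (L1 + 2 * L2) * \<bar>h\<bar>) * norm (Y - Z)"
    proof (intro mult_right_mono)
      \<comment> \<open>The cross term of the two growth factors is at most \<open>L2 * \<bar>h\<bar>\<close>, which accounts for the factor 2.\<close>
      have "(L2 * \<bar>h\<bar>) * (\<bar>h\<bar> * L1) \<le> (L2 * \<bar>h\<bar>) * 1"
        using \<delta>(3)[OF h] 2(2) by (intro mult_left_mono) auto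
      then show "(1 + L2 * \<bar>h\<bar>) * (1 + L1 * \<bar>h\<bar>) \<le> 1 + (L1 + 2 * L2) * \<bar>h\<bar>"
        by (simp add: algebra_simps)
    qed simp
    finally show ?thesis using inc Y1 Z1 Y2 Z2 by simp
  qed
  have "L1 + 2 * L2 \<ge> 0" using 1(2) 2(2) by simp
  with \<delta>(1) step show "\<exists>\<delta>>0. \<exists>L\<ge>0. \<forall>h Y Z. \<bar>h\<bar> \<le> \<delta> \<longrightarrow> norm Y \<le> R \<longrightarrow> norm Z \<le> R \<longrightarrow>
        (\<exists>Y' Z'. (\<Psi> h \<circ>\<^sub>m \<Phi> h) Y = Some Y' \<and> (\<Psi> h \<circ>\<^sub>m \<Phi> h) Z = Some Z' \<and>
           norm (Y' - Y) \<le> L * \<bar>h\<bar> \<and> norm (Y' - Z') \<le> (1 + L * \<bar>h\<bar>) * norm (Y - Z))"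
    by blast
qed

lemma stable_step_half:
  fixes \<Phi> :: "'a::real_normed_vector one_step"
  assumes "stable_step \<Phi>"
  shows "stable_step (\<lambda>h. \<Phi> (h / 2))"
  unfolding stable_step_def
proof
  fix R :: real
  obtain \<delta> L where L: "\<delta> > 0" "L \<ge> 0"
    "\<And>h Y. \<bar>h\<bar> \<le> \<delta> \<Longrightarrow> norm Y \<le> R \<Longrightarrow> \<exists>Y'. \<Phi> h Y = Some Y' \<and> norm (Y' - Y) \<le> L * \<bar>h\<bar>"
    "\<And>h Y Z Y' Z'. \<bar>h\<bar> \<le> \<delta> \<Longrightarrow> norm Y \<le> R \<Longrightarrow> norm Z \<le> R \<Longrightarrow> \<Phi> h Y = Some Y' \<Longrightarrow> \<Phi> h Z = Some Z' \<Longrightarrow>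
       norm (Y' - Z') \<le> (1 + L * \<bar>h\<bar>) * norm (Y - Z)"
    using stable_stepE[OF assms, where R = R] by blast
  have "\<exists>Y' Z'. \<Phi> (h / 2) Y = Some Y' \<and> \<Phi> (h / 2) Z = Some Z' \<and>
           norm (Y' - Y) \<le> L * \<bar>h\<bar> \<and> norm (Y' - Z') \<le> (1 + L * \<bar>h\<bar>) * norm (Y - Z)"
    if h: "\<bar>h\<bar> \<le> \<delta>" and YZ: "norm Y \<le> R" "norm Z \<le> R" for h Y Z
  proof -
    have h2: "\<bar>h / 2\<bar> \<le> \<delta>" and "L * \<bar>h / 2\<bar> \<le> L * \<bar>h\<bar>" using h L(2) by (auto intro: mult_left_mono)
    moreover obtain Y' where "\<Phi> (h / 2) Y = Some Y'" "norm (Y' - Y) \<le> L * \<bar>h / 2\<bar>"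
      using L(3)[OF h2 YZ(1)] by blast
    moreover obtain Z' where "\<Phi> (h / 2) Z = Some Z'" using L(3)[OF h2 YZ(2)] by blast
    moreover have "(1 + L * \<bar>h / 2\<bar>) * norm (Y - Z) \<le> (1 + L * \<bar>h\<bar>) * norm (Y - Z)"
      using \<open>L * \<bar>h / 2\<bar> \<le> L * \<bar>h\<bar>\<close> by (intro mult_right_mono) auto
    ultimately show ?thesis using L(4)[OF h2 YZ] by (meson order_trans)
  qed
  with L(1,2) show "\<exists>\<delta>>0. \<exists>L\<ge>0. \<forall>h Y Z. \<bar>h\<bar> \<le> \<delta> \<longrightarrow> norm Y \<le> R \<longrightarrow> norm Z \<le> R \<longrightarrow>
        (\<exists>Y' Z'. \<Phi> (h / 2) Y = Some Y' \<and> \<Phi> (h / 2) Z = Some Z' \<and>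
           norm (Y' - Y) \<le> L * \<bar>h\<bar> \<and> norm (Y' - Z') \<le> (1 + L * \<bar>h\<bar>) * norm (Y - Z))"
    by blast
qed

lemma lie_trotter_stable: "stable_step \<Phi>1 \<Longrightarrow> stable_step \<Phi>2 \<Longrightarrow> stable_step (lie_trotter \<Phi>1 \<Phi>2)"
  using stable_step_compose[of \<Phi>1 \<Phi>2] by (simp add: lie_trotter_def[abs_def])

lemma strang_stable: "stable_step \<Phi>1 \<Longrightarrow> stable_step \<Phi>2 \<Longrightarrow> stable_step (strang \<Phi>1 \<Phi>2)"
  unfolding strang_def[abs_def] by (intro stable_step_compose stable_step_half)

text \<open>
  In \<open>\<Phi>1 (h/2) \<circ> \<Phi>2 h \<circ> \<Phi>1 (h/2) \<circ> \<Phi>1 (-h/2) \<circ> \<Phi>2 (-h) \<circ> \<Phi>1 (-h/2)\<close> adjacent factors cancel,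
  beginning in the middle. Stability keeps the intermediate states in a ball on which symmetry is
  available.
\<close>

lemma strang_symmetric:
  fixes \<Phi>1 \<Phi>2 :: "'a::real_normed_vector one_step"
  assumes stable: "stable_step \<Phi>1" "stable_step \<Phi>2"
    and sym: "symmetric_method \<Phi>1" "symmetric_method \<Phi>2"
  shows "symmetric_method (strang \<Phi>1 \<Phi>2)"
  unfolding symmetric_method_def
proof (intro allI impI)
  fix B :: "'a set" assume "bounded B"
  then obtain R where R: "\<And>Y. Y \<in> B \<Longrightarrow> norm Y \<le> R" by (auto simp: bounded_iff)
  obtain \<delta>1 L1 where 1: "\<delta>1 > 0" "L1 \<ge> 0"
    "\<And>h Y. \<bar>h\<bar> \<le> \<delta>1 \<Longrightarrow> norm Y \<le> R \<Longrightarrow> \<exists>Y'. \<Phi>1 h Y = Some Y' \<and> norm (Y' - Y) \<le> L1 * \<bar>h\<bar>"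
    using stable_step_boundE[OF stable(1), where R = R] by blast
  obtain \<delta>2 L2 where 2: "\<delta>2 > 0" "L2 \<ge> 0"
    "\<And>h Y. \<bar>h\<bar> \<le> \<delta>2 \<Longrightarrow> norm Y \<le> R + 1 \<Longrightarrow> \<exists>Y'. \<Phi>2 h Y = Some Y' \<and> norm (Y' - Y) \<le> L2 * \<bar>h\<bar>"
    using stable_step_boundE[OF stable(2), where R = "R + 1"] by blast
  obtain \<epsilon>1 where \<epsilon>1: "\<epsilon>1 > 0"
    "\<And>h Y. \<bar>h\<bar> \<le> \<epsilon>1 \<Longrightarrow> norm Y \<le> R + 2 \<Longrightarrow> (\<Phi>1 h \<circ>\<^sub>m \<Phi>1 (- h)) Y = Some Y"
    using sym(1)[unfolded symmetric_method_def, rule_format, OF bounded_cball[of 0 "R + 2"]]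
    by auto
  obtain \<epsilon>2 where \<epsilon>2: "\<epsilon>2 > 0"
    "\<And>h Y. \<bar>h\<bar> \<le> \<epsilon>2 \<Longrightarrow> norm Y \<le> R + 2 \<Longrightarrow> (\<Phi>2 h \<circ>\<^sub>m \<Phi>2 (- h)) Y = Some Y"
    using sym(2)[unfolded symmetric_method_def, rule_format, OF bounded_cball[of 0 "R + 2"]]
    by auto
  define \<delta>0 where "\<delta>0 = min (min \<delta>1 \<delta>2) (min \<epsilon>1 \<epsilon>2)"
  have "\<delta>0 > 0" unfolding \<delta>0_def using 1(1) 2(1) \<epsilon>1(1) \<epsilon>2(1) by simp
  then obtain \<delta> where \<delta>: "\<delta> > 0" "\<delta> \<le> \<delta>0" "\<And>h. \<bar>h\<bar> \<le> \<delta> \<Longrightarrow> \<bar>h\<bar> * (L1 + L2) \<le> 1"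
    using small_step[of \<delta>0 "L1 + L2"] 1(2) 2(2) by (metis add_nonneg_nonneg)
  have "(strang \<Phi>1 \<Phi>2 h \<circ>\<^sub>m strang \<Phi>1 \<Phi>2 (- h)) Y = Some Y" if h: "\<bar>h\<bar> \<le> \<delta>" and Y: "Y \<in> B" for h Y
  proof -
    have hs: "\<bar>- (h / 2)\<bar> \<le> \<delta>1" "\<bar>- h\<bar> \<le> \<delta>2" "\<bar>h / 2\<bar> \<le> \<epsilon>1" "\<bar>h\<bar> \<le> \<epsilon>2"
      using h \<delta>(2) unfolding \<delta>0_def by auto
    have small: "L1 * \<bar>- (h / 2)\<bar> \<le> 1" "L2 * \<bar>- h\<bar> \<le> 1"
      using \<delta>(3)[OF h] mult_nonneg_nonneg[OF 1(2), of "\<bar>h\<bar>"] mult_nonneg_nonneg[OF 2(2), of "\<bar>h\<bar>"]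
      by (auto simp: algebra_simps)
    obtain Y1 where Y1: "\<Phi>1 (- (h / 2)) Y = Some Y1" "norm (Y1 - Y) \<le> L1 * \<bar>- (h / 2)\<bar>"
      using 1(3)[OF hs(1) R[OF Y]] by blast
    have b1: "norm Y1 \<le> R + 1"
      using Y1(2) small(1) R[OF Y] norm_triangle_ineq2[of Y1 Y] by linarith
    obtain Y2 where Y2: "\<Phi>2 (- h) Y1 = Some Y2" "norm (Y2 - Y1) \<le> L2 * \<bar>- h\<bar>"
      using 2(3)[OF hs(2) b1] by blast
    have b2: "norm Y2 \<le> R + 2"
      using Y2(2) small(2) b1 norm_triangle_ineq2[of Y2 Y1] by linarith
    obtain Y3 where Y3: "\<Phi>1 (- (h / 2)) Y2 = Some Y3" "\<Phi>1 (h / 2) Y3 = Some Y2"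
      using \<epsilon>1(2)[OF hs(3) b2] by (auto simp: map_comp_Some_iff)
    have "\<Phi>2 h Y2 = Some Y1"
      using \<epsilon>2(2)[OF hs(4), of Y1] b1 Y2(1) by simp
    moreover have "\<Phi>1 (h / 2) Y1 = Some Y"
      using \<epsilon>1(2)[OF hs(3), of Y] R[OF Y] Y1(1) by simp
    ultimately show ?thesis
      unfolding strang_def using Y1(1) Y2(1) Y3 by simp
  qed
  then show "\<exists>\<delta>>0. \<forall>dt Y. \<bar>dt\<bar> \<le> \<delta> \<and> Y \<in> B \<longrightarrow>
      (strang \<Phi>1 \<Phi>2 dt \<circ>\<^sub>m strang \<Phi>1 \<Phi>2 (- dt)) Y = Some Y"
    using \<delta>(1) by blast
qed

section \<open>Local errors of the splittings\<close>

lemma norm_triangle3: "norm (x + y + z) \<le> norm x + norm y + norm (z::'a::real_normed_vector)"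
  using norm_triangle_ineq[of "x + y" z] norm_triangle_ineq[of x y] by linarith

lemma expansion_first_order:
  fixes X :: "'a::real_normed_vector"
  assumes D: "\<And>v. norm (D v) \<le> B * norm v" and "B \<ge> 0" and v: "norm v \<le> F"
    and h: "\<bar>h\<bar> \<le> 1" and "C \<ge> 0" and XY: "norm (Y - X) \<le> \<rho> * \<bar>h\<bar>"
    and step: "norm (Y' - Y - h *\<^sub>R v - h *\<^sub>R D (Y - X) - (h\<^sup>2 / 2) *\<^sub>R D v) \<le> C * \<bar>h\<bar> ^ 3"
  shows "norm (Y' - Y - h *\<^sub>R v) \<le> (B * \<rho> + B * F + C) * h\<^sup>2"
proof -
  have "norm (h *\<^sub>R D (Y - X)) \<le> \<bar>h\<bar> * (B * (\<rho> * \<bar>h\<bar>))"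
    using D[of "Y - X"] mult_left_mono[OF XY \<open>B \<ge> 0\<close>] by (simp add: mult_left_mono)
  then have 1: "norm (h *\<^sub>R D (Y - X)) \<le> B * \<rho> * h\<^sup>2"
    by (simp add: power2_eq_square algebra_simps flip: abs_mult)
  have "norm (D v) \<le> B * F" using D[of v] mult_left_mono[OF v \<open>B \<ge> 0\<close>] by linarith
  then have "norm ((h\<^sup>2 / 2) *\<^sub>R D v) \<le> h\<^sup>2 / 2 * (B * F)"
    using mult_left_mono[of "norm (D v)" "B * F" "h\<^sup>2 / 2"] by simp
  moreover have "h\<^sup>2 / 2 * (B * F) \<le> h\<^sup>2 * (B * F)"
    using mult_nonneg_nonneg[OF \<open>B \<ge> 0\<close> order_trans[OF norm_ge_zero v]]
    by (intro mult_right_mono) auto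
  ultimately have 2: "norm ((h\<^sup>2 / 2) *\<^sub>R D v) \<le> B * F * h\<^sup>2" by (simp add: mult.commute)
  have "\<bar>h\<bar> ^ 3 \<le> \<bar>h\<bar> ^ 2" using h by (intro power_decreasing) auto
  then have 3: "C * \<bar>h\<bar> ^ 3 \<le> C * h\<^sup>2" using \<open>C \<ge> 0\<close> by (simp add: mult_left_mono)
  have "Y' - Y - h *\<^sub>R v = (Y' - Y - h *\<^sub>R v - h *\<^sub>R D (Y - X) - (h\<^sup>2 / 2) *\<^sub>R D v)
      + h *\<^sub>R D (Y - X) + (h\<^sup>2 / 2) *\<^sub>R D v" by simp
  then have "norm (Y' - Y - h *\<^sub>R v) \<le> norm (Y' - Y - h *\<^sub>R v - h *\<^sub>R D (Y - X) - (h\<^sup>2 / 2) *\<^sub>R D v)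
      + norm (h *\<^sub>R D (Y - X)) + norm ((h\<^sup>2 / 2) *\<^sub>R D v)"
    using norm_triangle3 by metis
  with step 1 2 3 show ?thesis by (simp add: algebra_simps)
qed

text \<open>
  To first order the increments of the substeps from the common expansion point simply add up.
\<close>

lemma lie_trotter_local_error:
  fixes f1 f2 :: "'a::real_normed_vector \<Rightarrow> 'a"
  assumes f: "quad_deriv f1 D1" "quad_deriv f2 D2"
    and \<Phi>: "expands_to_second_order \<Phi>1 f1 D1" "expands_to_second_order \<Phi>2 f2 D2"
    and stable: "stable_step \<Phi>1"
  shows "\<exists>\<delta>>0. \<exists>C\<ge>0. \<forall>h X W. \<bar>h\<bar> \<le> \<delta> \<longrightarrow> norm X \<le> R \<longrightarrow> lie_trotter \<Phi>1 \<Phi>2 h X = Some W \<longrightarrow>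
    norm (W - X - h *\<^sub>R (f1 X + f2 X)) \<le> C * h\<^sup>2"
proof -
  obtain F1 where F1: "F1 \<ge> 0" "\<And>x. norm x \<le> R \<Longrightarrow> norm (f1 x) \<le> F1"
    using quad_deriv_bounded[OF f(1), where R = R] by blast
  obtain F2 where F2: "F2 \<ge> 0" "\<And>x. norm x \<le> R \<Longrightarrow> norm (f2 x) \<le> F2"
    using quad_deriv_bounded[OF f(2), where R = R] by blast
  obtain B1 where B1: "B1 \<ge> 0" "\<And>x v. norm x \<le> R \<Longrightarrow> norm (D1 x v) \<le> B1 * norm v"
    using f(1) by (rule quad_derivE[where R = R]) (rule that)
  obtain B2 where B2: "B2 \<ge> 0" "\<And>x v. norm x \<le> R \<Longrightarrow> norm (D2 x v) \<le> B2 * norm v"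
    using f(2) by (rule quad_derivE[where R = R]) (rule that)
  obtain \<delta>0 L where L: "\<delta>0 > 0" "L \<ge> 0"
    "\<And>h Y. \<bar>h\<bar> \<le> \<delta>0 \<Longrightarrow> norm Y \<le> R \<Longrightarrow> \<exists>Y'. \<Phi>1 h Y = Some Y' \<and> norm (Y' - Y) \<le> L * \<bar>h\<bar>"
    using stable_step_boundE[OF stable, where R = R] by blast
  obtain \<delta>1 C1 where C1: "\<delta>1 > 0" "C1 \<ge> 0"
    "\<And>h X Y Y'. \<bar>h\<bar> \<le> \<delta>1 \<Longrightarrow> norm X \<le> R \<Longrightarrow> norm Y \<le> R \<Longrightarrow> norm (Y - X) \<le> 0 * \<bar>h\<bar> \<Longrightarrow> \<Phi>1 h Y = Some Y' \<Longrightarrow>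
        norm (Y' - Y - h *\<^sub>R f1 X - h *\<^sub>R D1 X (Y - X) - (h\<^sup>2 / 2) *\<^sub>R D1 X (f1 X)) \<le> C1 * \<bar>h\<bar> ^ 3"
    using \<Phi>(1) by (rule expands_to_second_orderE[where R = R and \<rho> = 0]) (rule that)
  obtain \<delta>2 C2 where C2: "\<delta>2 > 0" "C2 \<ge> 0"
    "\<And>h X Y Y'. \<bar>h\<bar> \<le> \<delta>2 \<Longrightarrow> norm X \<le> R + 1 \<Longrightarrow> norm Y \<le> R + 1 \<Longrightarrow> norm (Y - X) \<le> L * \<bar>h\<bar> \<Longrightarrow> \<Phi>2 h Y = Some Y' \<Longrightarrow>
        norm (Y' - Y - h *\<^sub>R f2 X - h *\<^sub>R D2 X (Y - X) - (h\<^sup>2 / 2) *\<^sub>R D2 X (f2 X)) \<le> C2 * \<bar>h\<bar> ^ 3"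
    using \<Phi>(2) by (rule expands_to_second_orderE[where R = "R + 1" and \<rho> = L]) (rule that)
  obtain \<delta> where \<delta>: "\<delta> > 0" "\<delta> \<le> min \<delta>0 (min \<delta>1 \<delta>2)" "\<delta> \<le> 1" "\<And>h. \<bar>h\<bar> \<le> \<delta> \<Longrightarrow> \<bar>h\<bar> * L \<le> 1"
    using small_step[of "min \<delta>0 (min \<delta>1 \<delta>2)" L] L(1,2) C1(1) C2(1) by (metis min_less_iff_conj)
  define G where "G = (B1 * 0 + B1 * F1 + C1) + (B2 * L + B2 * F2 + C2)"
  have "norm (W - X - h *\<^sub>R (f1 X + f2 X)) \<le> G * h\<^sup>2"
    if h: "\<bar>h\<bar> \<le> \<delta>" and X: "norm X \<le> R" and W: "lie_trotter \<Phi>1 \<Phi>2 h X = Some W" for h X W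
  proof -
    have hs: "\<bar>h\<bar> \<le> \<delta>0" "\<bar>h\<bar> \<le> \<delta>1" "\<bar>h\<bar> \<le> \<delta>2" "\<bar>h\<bar> \<le> 1" using h \<delta>(2,3) by auto
    obtain Y1 where Y1: "\<Phi>1 h X = Some Y1" "\<Phi>2 h Y1 = Some W"
      using W unfolding lie_trotter_def by (auto simp: map_comp_Some_iff)
    have inc: "norm (Y1 - X) \<le> L * \<bar>h\<bar>" using L(3)[OF hs(1) X] Y1(1) by auto
    have X1: "norm X \<le> R + 1" using X by simp
    have b1: "norm Y1 \<le> R + 1"
      using inc \<delta>(4)[OF h] X norm_triangle_ineq2[of Y1 X] by (simp add: mult.commute)
    have XX: "norm (X - X) \<le> 0 * \<bar>h\<bar>" by simp
    have "norm (Y1 - X - h *\<^sub>R f1 X) \<le> (B1 * 0 + B1 * F1 + C1) * h\<^sup>2"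
      by (rule expansion_first_order[OF B1(2)[OF X] B1(1) F1(2)[OF X] hs(4) C1(2) XX
            C1(3)[OF hs(2) X X XX Y1(1)]])
    moreover have "norm (W - Y1 - h *\<^sub>R f2 X) \<le> (B2 * L + B2 * F2 + C2) * h\<^sup>2"
      by (rule expansion_first_order[OF B2(2)[OF X] B2(1) F2(2)[OF X] hs(4) C2(2) inc
            C2(3)[OF hs(3) X1 b1 inc Y1(2)]])
    moreover have "W - X - h *\<^sub>R (f1 X + f2 X) = (Y1 - X - h *\<^sub>R f1 X) + (W - Y1 - h *\<^sub>R f2 X)"
      by (simp add: algebra_simps)
    then have "norm (W - X - h *\<^sub>R (f1 X + f2 X))
        \<le> norm (Y1 - X - h *\<^sub>R f1 X) + norm (W - Y1 - h *\<^sub>R f2 X)"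
      using norm_triangle_ineq by metis
    ultimately show ?thesis unfolding G_def distrib_right[of _ _ "h\<^sup>2"] by linarith
  qed
  moreover have "G \<ge> 0"
    unfolding G_def using B1(1) B2(1) F1(1) F2(1) C1(2) C2(2) L(2) by simp
  ultimately show ?thesis using \<delta>(1) by blast
qed

text \<open>
  Let \<open>u = h/2\<close>. The half steps contribute \<open>u\<^sup>2/2\<close> each to the coefficient of \<open>D1 (f1)\<close>, and the second half step
  starts from a state displaced by \<open>u f1 + h f2\<close>, which adds \<open>u\<^sup>2 D1 (f1) + u h D1 (f2)\<close>; the full step
  starts from a state displaced by \<open>u f1\<close>, which adds \<open>h u D2 (f1)\<close> to \<open>h\<^sup>2/2 D2 (f2)\<close>. With \<open>u = h/2\<close> all four coefficients
  are \<open>h\<^sup>2/2\<close>.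
\<close>

lemma strang_local_error:
  fixes f1 f2 :: "'a::real_normed_vector \<Rightarrow> 'a"
  assumes f: "quad_deriv f1 D1" "quad_deriv f2 D2"
    and \<Phi>: "expands_to_second_order \<Phi>1 f1 D1" "expands_to_second_order \<Phi>2 f2 D2"
    and stable: "stable_step \<Phi>1" "stable_step \<Phi>2"
  shows "\<exists>\<delta>>0. \<exists>C\<ge>0. \<forall>h X W. \<bar>h\<bar> \<le> \<delta> \<longrightarrow> norm X \<le> R \<longrightarrow> strang \<Phi>1 \<Phi>2 h X = Some W \<longrightarrow>
    norm (W - X - h *\<^sub>R (f1 X + f2 X)
      - (h\<^sup>2 / 2) *\<^sub>R (D1 X (f1 X + f2 X) + D2 X (f1 X + f2 X))) \<le> C * \<bar>h\<bar> ^ 3"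
proof -
  have lin1: "linear (D1 x)" and lin2: "linear (D2 x)" for x
    using f unfolding quad_deriv_def by blast+
  obtain F1 where F1: "F1 \<ge> 0" "\<And>x. norm x \<le> R \<Longrightarrow> norm (f1 x) \<le> F1"
    using quad_deriv_bounded[OF f(1), where R = R] by blast
  obtain F2 where F2: "F2 \<ge> 0" "\<And>x. norm x \<le> R \<Longrightarrow> norm (f2 x) \<le> F2"
    using quad_deriv_bounded[OF f(2), where R = R] by blast
  obtain B1 where B1: "B1 \<ge> 0" "\<And>x v. norm x \<le> R \<Longrightarrow> norm (D1 x v) \<le> B1 * norm v"
    using f(1) by (rule quad_derivE[where R = R]) (rule that)
  obtain B2 where B2: "B2 \<ge> 0" "\<And>x v. norm x \<le> R \<Longrightarrow> norm (D2 x v) \<le> B2 * norm v"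
    using f(2) by (rule quad_derivE[where R = R]) (rule that)
  obtain \<epsilon>1 L1 where L1: "\<epsilon>1 > 0" "L1 \<ge> 0"
    "\<And>h Y. \<bar>h\<bar> \<le> \<epsilon>1 \<Longrightarrow> norm Y \<le> R \<Longrightarrow> \<exists>Y'. \<Phi>1 h Y = Some Y' \<and> norm (Y' - Y) \<le> L1 * \<bar>h\<bar>"
    using stable_step_boundE[OF stable(1), where R = R] by blast
  obtain \<epsilon>2 L2 where L2: "\<epsilon>2 > 0" "L2 \<ge> 0"
    "\<And>h Y. \<bar>h\<bar> \<le> \<epsilon>2 \<Longrightarrow> norm Y \<le> R + 1 \<Longrightarrow> \<exists>Y'. \<Phi>2 h Y = Some Y' \<and> norm (Y' - Y) \<le> L2 * \<bar>h\<bar>"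
    using stable_step_boundE[OF stable(2), where R = "R + 1"] by blast
  obtain \<delta>1 C1 where C1: "\<delta>1 > 0" "C1 \<ge> 0"
    "\<And>h X Y Y'. \<bar>h\<bar> \<le> \<delta>1 \<Longrightarrow> norm X \<le> R \<Longrightarrow> norm Y \<le> R \<Longrightarrow> norm (Y - X) \<le> 0 * \<bar>h\<bar> \<Longrightarrow> \<Phi>1 h Y = Some Y' \<Longrightarrow>
        norm (Y' - Y - h *\<^sub>R f1 X - h *\<^sub>R D1 X (Y - X) - (h\<^sup>2 / 2) *\<^sub>R D1 X (f1 X)) \<le> C1 * \<bar>h\<bar> ^ 3"
    using \<Phi>(1) by (rule expands_to_second_orderE[where R = R and \<rho> = 0]) (rule that)
  obtain \<delta>2 C2 where C2: "\<delta>2 > 0" "C2 \<ge> 0"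
    "\<And>h X Y Y'. \<bar>h\<bar> \<le> \<delta>2 \<Longrightarrow> norm X \<le> R + 1 \<Longrightarrow> norm Y \<le> R + 1 \<Longrightarrow> norm (Y - X) \<le> L1 * \<bar>h\<bar> \<Longrightarrow> \<Phi>2 h Y = Some Y' \<Longrightarrow>
        norm (Y' - Y - h *\<^sub>R f2 X - h *\<^sub>R D2 X (Y - X) - (h\<^sup>2 / 2) *\<^sub>R D2 X (f2 X)) \<le> C2 * \<bar>h\<bar> ^ 3"
    using \<Phi>(2) by (rule expands_to_second_orderE[where R = "R + 1" and \<rho> = L1]) (rule that)
  obtain \<delta>3 C3 where C3: "\<delta>3 > 0" "C3 \<ge> 0"
    "\<And>h X Y Y'. \<bar>h\<bar> \<le> \<delta>3 \<Longrightarrow> norm X \<le> R + 2 \<Longrightarrow> norm Y \<le> R + 2 \<Longrightarrow> norm (Y - X) \<le> 2 * (L1 + L2) * \<bar>h\<bar> \<Longrightarrow> \<Phi>1 h Y = Some Y' \<Longrightarrow>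
        norm (Y' - Y - h *\<^sub>R f1 X - h *\<^sub>R D1 X (Y - X) - (h\<^sup>2 / 2) *\<^sub>R D1 X (f1 X)) \<le> C3 * \<bar>h\<bar> ^ 3"
    using \<Phi>(1) by (rule expands_to_second_orderE[where R = "R + 2" and \<rho> = "2 * (L1 + L2)"]) (rule that)
  define \<delta>0 where "\<delta>0 = min (min \<epsilon>1 \<epsilon>2) (min \<delta>1 (min \<delta>2 \<delta>3))"
  have "\<delta>0 > 0" unfolding \<delta>0_def using L1(1) L2(1) C1(1) C2(1) C3(1) by simp
  then obtain \<delta> where \<delta>: "\<delta> > 0" "\<delta> \<le> \<delta>0" "\<delta> \<le> 1" "\<And>h. \<bar>h\<bar> \<le> \<delta> \<Longrightarrow> \<bar>h\<bar> * (L1 + L2) \<le> 1"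
    using small_step[of \<delta>0 "L1 + L2"] L1(2) L2(2) by (metis add_nonneg_nonneg)
  define G1 where "G1 = B1 * 0 + B1 * F1 + C1"
  define G2 where "G2 = B2 * L1 + B2 * F2 + C2"
  define E where "E = C1 + C2 + C3 + B2 * G1 + B1 * (G1 + G2)"
  have G: "G1 \<ge> 0" "G2 \<ge> 0"
    unfolding G1_def G2_def using B1(1) B2(1) F1(1) F2(1) C1(2) C2(2) L1(2) by simp_all
  have "norm (W - X - h *\<^sub>R (f1 X + f2 X)
      - (h\<^sup>2 / 2) *\<^sub>R (D1 X (f1 X + f2 X) + D2 X (f1 X + f2 X))) \<le> E * \<bar>h\<bar> ^ 3"
    if h: "\<bar>h\<bar> \<le> \<delta>" and X: "norm X \<le> R" and W: "strang \<Phi>1 \<Phi>2 h X = Some W" for h X W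
  proof -
    define u where "u = h / 2"
    have u: "\<bar>u\<bar> \<le> \<bar>h\<bar>" unfolding u_def by simp
    have hs: "\<bar>u\<bar> \<le> \<epsilon>1" "\<bar>h\<bar> \<le> \<epsilon>2" "\<bar>u\<bar> \<le> \<delta>1" "\<bar>h\<bar> \<le> \<delta>2" "\<bar>u\<bar> \<le> \<delta>3" "\<bar>u\<bar> \<le> 1" "\<bar>h\<bar> \<le> 1"
      using h \<delta>(2,3) u unfolding \<delta>0_def by auto
    have u3: "\<bar>u\<bar> ^ 3 \<le> \<bar>h\<bar> ^ 3" and u2: "u\<^sup>2 \<le> h\<^sup>2"
      using u by (auto intro: power_mono simp: abs_le_square_iff)
    obtain Y1 Y2 where Y: "\<Phi>1 u X = Some Y1" "\<Phi>2 h Y1 = Some Y2" "\<Phi>1 u Y2 = Some W"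
      using W unfolding strang_def u_def by (auto simp: map_comp_Some_iff)
    have X1: "norm X \<le> R + 1" and X2: "norm X \<le> R + 2" using X by simp_all
    have inc1: "norm (Y1 - X) \<le> L1 * \<bar>h\<bar>"
    proof -
      have "norm (Y1 - X) \<le> L1 * \<bar>u\<bar>" using L1(3)[OF hs(1) X] Y(1) by auto
      then show ?thesis using mult_left_mono[OF u L1(2)] by linarith
    qed
    have small: "L1 * \<bar>h\<bar> \<le> 1" "L2 * \<bar>h\<bar> \<le> 1"
      using \<delta>(4)[OF h] mult_nonneg_nonneg[OF L1(2), of "\<bar>h\<bar>"] mult_nonneg_nonneg[OF L2(2), of "\<bar>h\<bar>"]
      by (auto simp: algebra_simps)
    have b1: "norm Y1 \<le> R + 1"
      using inc1 small X norm_triangle_ineq2[of Y1 X] by simp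
    have inc2: "norm (Y2 - Y1) \<le> L2 * \<bar>h\<bar>" using L2(3)[OF hs(2) b1] Y(2) by auto
    have b2: "norm Y2 \<le> R + 2"
      using inc2 small b1 norm_triangle_ineq2[of Y2 Y1] by simp
    have inc3: "norm (Y2 - X) \<le> 2 * (L1 + L2) * \<bar>u\<bar>"
      using inc1 inc2 norm_triangle_ineq[of "Y2 - Y1" "Y1 - X"] unfolding u_def
      by (simp add: algebra_simps)
    have XX: "norm (X - X) \<le> 0 * \<bar>u\<bar>" by simp
    define e1 where "e1 = Y1 - X - u *\<^sub>R f1 X - u *\<^sub>R D1 X (X - X) - (u\<^sup>2 / 2) *\<^sub>R D1 X (f1 X)"
    define e2 where "e2 = Y2 - Y1 - h *\<^sub>R f2 X - h *\<^sub>R D2 X (Y1 - X) - (h\<^sup>2 / 2) *\<^sub>R D2 X (f2 X)"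
    define e3 where "e3 = W - Y2 - u *\<^sub>R f1 X - u *\<^sub>R D1 X (Y2 - X) - (u\<^sup>2 / 2) *\<^sub>R D1 X (f1 X)"
    define g1 where "g1 = Y1 - X - u *\<^sub>R f1 X"
    define g2 where "g2 = Y2 - Y1 - h *\<^sub>R f2 X"
    have e1: "norm e1 \<le> C1 * \<bar>u\<bar> ^ 3" unfolding e1_def by (rule C1(3)[OF hs(3) X X XX Y(1)])
    have e2: "norm e2 \<le> C2 * \<bar>h\<bar> ^ 3" unfolding e2_def by (rule C2(3)[OF hs(4) X1 b1 inc1 Y(2)])
    have e3: "norm e3 \<le> C3 * \<bar>u\<bar> ^ 3" unfolding e3_def by (rule C3(3)[OF hs(5) X2 b2 inc3 Y(3)])
    have "norm g1 \<le> G1 * u\<^sup>2"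
      unfolding g1_def G1_def
      by (rule expansion_first_order[OF B1(2)[OF X] B1(1) F1(2)[OF X] hs(6) C1(2) XX e1[unfolded e1_def]])
    then have g1: "norm g1 \<le> G1 * h\<^sup>2" using mult_left_mono[OF u2 G(1)] by linarith
    have g2: "norm g2 \<le> G2 * h\<^sup>2"
      unfolding g2_def G2_def
      by (rule expansion_first_order[OF B2(2)[OF X] B2(1) F2(2)[OF X] hs(7) C2(2) inc1 e2[unfolded e2_def]])
    have "norm (g1 + g2) \<le> (G1 + G2) * h\<^sup>2"
      using g1 g2 norm_triangle_ineq[of g1 g2] by (simp add: distrib_right)
    then have d1: "norm (D1 X (g1 + g2)) \<le> B1 * ((G1 + G2) * h\<^sup>2)"
      using B1(2)[OF X] mult_left_mono[OF _ B1(1)] by (meson order_trans)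
    have d2: "norm (D2 X g1) \<le> B2 * (G1 * h\<^sup>2)"
      using B2(2)[OF X] mult_left_mono[OF g1 B2(1)] by (meson order_trans)
    \<comment> \<open>The displacements are replaced by their first-order parts, with errors \<open>g1\<close> and \<open>g1 + g2\<close>.\<close>
    have dY1: "D2 X (Y1 - X) = D2 X g1 + u *\<^sub>R D2 X (f1 X)"
    proof -
      have "Y1 - X = g1 + u *\<^sub>R f1 X" unfolding g1_def by simp
      then show ?thesis by (simp only: linear_add[OF lin2] linear_cmul[OF lin2])
    qed
    have dY2: "D1 X (Y2 - X) = D1 X (g1 + g2) + u *\<^sub>R D1 X (f1 X) + h *\<^sub>R D1 X (f2 X)"
    proof -
      have "Y2 - X = (g1 + g2) + u *\<^sub>R f1 X + h *\<^sub>R f2 X" unfolding g1_def g2_def by simp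
      then show ?thesis by (simp only: linear_add[OF lin1] linear_cmul[OF lin1])
    qed
    \<comment> \<open>The terms in parentheses at the end are the remainders; what precedes them is the second-order Taylor polynomial.\<close>
    have W_eq: "W = X + (u *\<^sub>R f1 X + u *\<^sub>R f1 X) + h *\<^sub>R f2 X
        + ((u\<^sup>2 / 2) *\<^sub>R D1 X (f1 X) + (u\<^sup>2 / 2) *\<^sub>R D1 X (f1 X) + (u * u) *\<^sub>R D1 X (f1 X))
        + (u * h) *\<^sub>R D1 X (f2 X) + (h * u) *\<^sub>R D2 X (f1 X) + (h\<^sup>2 / 2) *\<^sub>R D2 X (f2 X)
        + (e1 + e2 + e3 + h *\<^sub>R D2 X g1 + u *\<^sub>R D1 X (g1 + g2))"
      unfolding e1_def e2_def e3_def dY1 dY2 by (simp add: linear_0[OF lin1] scaleR_add_right)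
    have coeffs: "u *\<^sub>R v + u *\<^sub>R v = h *\<^sub>R v" "u * h = h\<^sup>2 / 2" "h * u = h\<^sup>2 / 2"
      "(u\<^sup>2 / 2) *\<^sub>R v + (u\<^sup>2 / 2) *\<^sub>R v + (u * u) *\<^sub>R v = (h\<^sup>2 / 2) *\<^sub>R v" for v :: 'a
      unfolding u_def scaleR_add_left[symmetric] by (simp_all add: power2_eq_square field_simps)
    have "W - X - h *\<^sub>R (f1 X + f2 X) - (h\<^sup>2 / 2) *\<^sub>R (D1 X (f1 X + f2 X) + D2 X (f1 X + f2 X))
        = e1 + e2 + e3 + h *\<^sub>R D2 X g1 + u *\<^sub>R D1 X (g1 + g2)"
      unfolding linear_add[OF lin1] linear_add[OF lin2]
      by (subst W_eq) (simp add: coeffs scaleR_add_right linear_add[OF lin1])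
    also have "norm \<dots> \<le> norm e1 + norm e2 + norm e3 + norm (h *\<^sub>R D2 X g1) + norm (u *\<^sub>R D1 X (g1 + g2))"
      by (intro norm_triangle_le add_mono order_refl)
    also have "\<dots> \<le> C1 * \<bar>h\<bar> ^ 3 + C2 * \<bar>h\<bar> ^ 3 + C3 * \<bar>h\<bar> ^ 3 + \<bar>h\<bar> * (B2 * (G1 * h\<^sup>2)) + \<bar>h\<bar> * (B1 * ((G1 + G2) * h\<^sup>2))"
    proof (intro add_mono)
      show "norm e1 \<le> C1 * \<bar>h\<bar> ^ 3" using e1 mult_left_mono[OF u3 C1(2)] by linarith
      show "norm e3 \<le> C3 * \<bar>h\<bar> ^ 3" using e3 mult_left_mono[OF u3 C3(2)] by linarith
      show "norm (h *\<^sub>R D2 X g1) \<le> \<bar>h\<bar> * (B2 * (G1 * h\<^sup>2))"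
        using d2 by (simp add: mult_left_mono)
      show "norm (u *\<^sub>R D1 X (g1 + g2)) \<le> \<bar>h\<bar> * (B1 * ((G1 + G2) * h\<^sup>2))"
        unfolding norm_scaleR by (rule mult_mono[OF u d1]) auto
    qed (rule e2)
    also have "\<dots> = E * \<bar>h\<bar> ^ 3"
      unfolding E_def by (simp add: algebra_simps power3_eq_cube power2_eq_square flip: abs_mult)
    finally show ?thesis .
  qed
  moreover have "E \<ge> 0"
    unfolding E_def using B1(1) B2(1) C1(2) C2(2) C3(2) G by simp
  ultimately show ?thesis using \<delta>(1) by blast
qed

section \<open>From local errors to convergence\<close>

text \<open>
  Each step multiplies the accumulated error by at most \<open>1 + L h \<le> exp (L h)\<close> and adds a local error
  \<open>C h\<^sup>p\<^sup>+\<^sup>1\<close>, which gives the bound \<open>C h\<^sup>p t exp (L t)\<close> at time \<open>t\<close>. The step size is chosen such that this bound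
  is at most \<open>1\<close> up to time \<open>T\<close>: the numerical solution then stays in the ball of radius \<open>R + 1\<close>, where the stability
  estimate holds and the next step is defined.
\<close>

lemma stable_step_convergence:
  fixes f :: "'a::real_normed_vector \<Rightarrow> 'a"
  assumes stable: "stable_step \<Phi>" and p: "p \<ge> 1"
    and Y: "ode_solution f T Y" and "0 \<le> T"
    and \<delta>0: "\<delta>0 > 0" and C: "C \<ge> 0"
    and local_error: "\<And>t h W. 0 \<le> t \<Longrightarrow> 0 < h \<Longrightarrow> h \<le> \<delta>0 \<Longrightarrow> t + h \<le> T \<Longrightarrow> \<Phi> h (Y t) = Some W \<Longrightarrow>
       norm (W - Y (t + h)) \<le> C * h ^ Suc p"
  shows "\<exists>E. \<exists>\<delta>>0. \<forall>h n. 0 < h \<and> h \<le> \<delta> \<and> real n * h \<le> T \<longrightarrow>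
    (\<exists>Z. iterate (\<Phi> h) n (Y 0) = Some Z \<and> norm (Z - Y (real n * h)) \<le> E * h ^ p)"
proof -
  obtain R where R: "R \<ge> 0" "\<And>t. 0 \<le> t \<Longrightarrow> t \<le> T \<Longrightarrow> norm (Y t) \<le> R"
    using ode_solution_bounded[OF Y] by blast
  obtain \<delta>1 L where L: "\<delta>1 > 0" "L \<ge> 0"
    "\<And>h Y. \<bar>h\<bar> \<le> \<delta>1 \<Longrightarrow> norm Y \<le> R + 1 \<Longrightarrow> \<exists>Y'. \<Phi> h Y = Some Y' \<and> norm (Y' - Y) \<le> L * \<bar>h\<bar>"
    "\<And>h Y Z Y' Z'. \<bar>h\<bar> \<le> \<delta>1 \<Longrightarrow> norm Y \<le> R + 1 \<Longrightarrow> norm Z \<le> R + 1 \<Longrightarrow> \<Phi> h Y = Some Y' \<Longrightarrow> \<Phi> h Z = Some Z' \<Longrightarrow>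
       norm (Y' - Z') \<le> (1 + L * \<bar>h\<bar>) * norm (Y - Z)"
    using stable_stepE[OF stable, where R = "R + 1"] by blast
  define E where "E = C * T * exp (L * T)"
  have "E \<ge> 0" unfolding E_def using C \<open>0 \<le> T\<close> by simp
  obtain \<delta> where \<delta>: "\<delta> > 0" "\<delta> \<le> min \<delta>0 \<delta>1" "\<delta> \<le> 1" "\<And>h. \<bar>h\<bar> \<le> \<delta> \<Longrightarrow> \<bar>h\<bar> * E \<le> 1"
    using small_step[of "min \<delta>0 \<delta>1" E] \<delta>0 L(1) \<open>E \<ge> 0\<close> by (metis min_less_iff_conj)
  have main: "real n * h \<le> T \<Longrightarrow> \<exists>Z. iterate (\<Phi> h) n (Y 0) = Some Z \<and>
      norm (Z - Y (real n * h)) \<le> C * h ^ p * (real n * h) * exp (L * (real n * h))"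
    if h: "0 < h" "h \<le> \<delta>" for h n
  proof (induction n)
    case 0
    show ?case by simp
  next
    case (Suc n)
    have hs: "\<bar>h\<bar> \<le> \<delta>" "h \<le> \<delta>0" "\<bar>h\<bar> \<le> \<delta>1" "h \<le> 1" using h \<delta>(2,3) by auto
    define t where "t = real n * h"
    have t: "0 \<le> t" "t + h \<le> T" "real (Suc n) * h = t + h" "t \<le> T"
      using Suc.prems h(1) unfolding t_def by (auto simp: algebra_simps)
    obtain Z where Z: "iterate (\<Phi> h) n (Y 0) = Some Z"
        "norm (Z - Y t) \<le> C * h ^ p * t * exp (L * t)"
      using Suc.IH t(4) unfolding t_def by auto
    have "norm (Z - Y t) \<le> C * h ^ p * T * exp (L * T)"
      using Z(2)
    proof (rule order_trans)
      show "C * h ^ p * t * exp (L * t) \<le> C * h ^ p * T * exp (L * T)"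
        using C h(1) t L(2) \<open>0 \<le> T\<close> by (intro mult_mono) (auto intro: mult_left_mono)
    qed
    also have "\<dots> = E * h ^ p" unfolding E_def by simp
    also have "\<dots> \<le> E * h"
      using \<open>E \<ge> 0\<close> power_decreasing[OF p, of h] h(1) hs(4) by (intro mult_left_mono) auto
    also have "\<dots> \<le> 1" using \<delta>(4)[OF hs(1)] h(1) by (simp add: mult.commute)
    finally have "norm (Z - Y t) \<le> 1" .
    then have bounds: "norm Z \<le> R + 1" "norm (Y t) \<le> R + 1"
      using R(2)[OF t(1,4)] norm_triangle_ineq2[of Z "Y t"] by linarith+
    obtain Z' where Z': "\<Phi> h Z = Some Z'" using L(3)[OF hs(3) bounds(1)] by blast
    obtain W where W: "\<Phi> h (Y t) = Some W" using L(3)[OF hs(3) bounds(2)] by blast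
    have "norm (Z' - Y (t + h)) \<le> norm (Z' - W) + norm (W - Y (t + h))"
      using norm_triangle_ineq[of "Z' - W" "W - Y (t + h)"] by simp
    also have "\<dots> \<le> (1 + L * h) * norm (Z - Y t) + C * h ^ Suc p"
      using L(4)[OF hs(3) bounds Z' W] local_error[OF t(1) h(1) hs(2) t(2) W] h(1) by simp
    also have "\<dots> \<le> exp (L * h) * (C * h ^ p * t * exp (L * t)) + C * h ^ p * h * exp (L * (t + h))"
    proof (intro add_mono)
      show "(1 + L * h) * norm (Z - Y t) \<le> exp (L * h) * (C * h ^ p * t * exp (L * t))"
        using Z(2) exp_ge_add_one_self[of "L * h"] L(2) h(1) by (intro mult_mono) auto
      have "C * h ^ p * h * 1 \<le> C * h ^ p * h * exp (L * (t + h))"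
        using C h(1) t(1) L(2) by (intro mult_left_mono) auto
      then show "C * h ^ Suc p \<le> C * h ^ p * h * exp (L * (t + h))" by (simp add: ac_simps)
    qed
    also have "\<dots> = C * h ^ p * (t + h) * exp (L * (t + h))"
      by (simp add: algebra_simps exp_add)
    finally show ?case using Z(1) Z' t(3) by simp
  qed
  have "\<exists>Z. iterate (\<Phi> h) n (Y 0) = Some Z \<and> norm (Z - Y (real n * h)) \<le> E * h ^ p"
    if h: "0 < h" "h \<le> \<delta>" and n: "real n * h \<le> T" for h n
  proof -
    obtain Z where Z: "iterate (\<Phi> h) n (Y 0) = Some Z"
        "norm (Z - Y (real n * h)) \<le> C * h ^ p * (real n * h) * exp (L * (real n * h))"
      using main[OF h n] by blast
    have "C * h ^ p * (real n * h) * exp (L * (real n * h)) \<le> C * h ^ p * T * exp (L * T)"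
      using C h(1) n L(2) \<open>0 \<le> T\<close> by (intro mult_mono) (auto intro: mult_left_mono)
    also have "\<dots> = E * h ^ p" unfolding E_def by simp
    finally show ?thesis using Z order_trans by blast
  qed
  then show ?thesis using \<delta>(1) by blast
qed

theorem lie_trotter_converges:
  fixes f1 f2 :: "'a::real_normed_vector \<Rightarrow> 'a"
  assumes f: "quad_deriv f1 D1" "quad_deriv f2 D2"
    and \<Phi>: "expands_to_second_order \<Phi>1 f1 D1" "expands_to_second_order \<Phi>2 f2 D2"
    and stable: "stable_step \<Phi>1" "stable_step \<Phi>2"
  shows "convergence_order (\<lambda>Y. f1 Y + f2 Y) (lie_trotter \<Phi>1 \<Phi>2) 1"
  unfolding convergence_order_def
proof (intro allI impI, elim conjE)
  fix T :: real and Y assume "0 \<le> T" and Y: "ode_solution (\<lambda>Y. f1 Y + f2 Y) T Y"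
  let ?f = "\<lambda>Y. f1 Y + f2 Y" and ?D = "\<lambda>x v. D1 x v + D2 x v"
  have fD: "quad_deriv ?f ?D" by (rule quad_deriv_add[OF f])
  obtain R where R: "R \<ge> 0" "\<And>t. 0 \<le> t \<Longrightarrow> t \<le> T \<Longrightarrow> norm (Y t) \<le> R"
    using ode_solution_bounded[OF Y] by blast
  obtain F where F: "F \<ge> 0" "\<And>x. norm x \<le> R \<Longrightarrow> norm (?f x) \<le> F"
    using quad_deriv_bounded[OF fD, where R = R] by blast
  obtain B where B: "B \<ge> 0" "\<And>x v. norm x \<le> R \<Longrightarrow> norm (?D x v) \<le> B * norm v"
    using fD by (rule quad_derivE[where R = R]) (rule that)
  obtain C1 where C1: "C1 \<ge> 0" "\<And>t h. 0 \<le> t \<Longrightarrow> 0 \<le> h \<Longrightarrow> t + h \<le> T \<Longrightarrow>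
    norm (Y (t + h) - Y t - h *\<^sub>R ?f (Y t) - (h\<^sup>2 / 2) *\<^sub>R ?D (Y t) (?f (Y t))) \<le> C1 * h ^ 3"
    using exact_expansion[OF fD Y] by blast
  obtain \<delta> C2 where C2: "\<delta> > 0" "C2 \<ge> 0" "\<And>h X W. \<bar>h\<bar> \<le> \<delta> \<Longrightarrow> norm X \<le> R \<Longrightarrow>
    lie_trotter \<Phi>1 \<Phi>2 h X = Some W \<Longrightarrow> norm (W - X - h *\<^sub>R ?f X) \<le> C2 * h\<^sup>2"
    using lie_trotter_local_error[OF f \<Phi> stable(1), of R] by blast
  show "\<exists>E. \<exists>\<delta>>0. \<forall>h n. 0 < h \<and> h \<le> \<delta> \<and> real n * h \<le> T \<longrightarrow>
    (\<exists>Z. iterate (lie_trotter \<Phi>1 \<Phi>2 h) n (Y 0) = Some Z \<and> norm (Z - Y (real n * h)) \<le> E * h ^ 1)"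
  proof (rule stable_step_convergence[OF lie_trotter_stable[OF stable] _ Y \<open>0 \<le> T\<close>])
    show "min \<delta> 1 > 0" using C2(1) by simp
    show "C2 + (B * 0 + B * F + C1) \<ge> 0" using C1(1) C2(2) B(1) F(1) by simp
    fix t h W
    assume t: "0 \<le> t" "0 < h" "h \<le> min \<delta> 1" "t + h \<le> T" and W: "lie_trotter \<Phi>1 \<Phi>2 h (Y t) = Some W"
    have Yt: "norm (Y t) \<le> R" using R(2) t by simp
    have num: "norm (W - Y t - h *\<^sub>R ?f (Y t)) \<le> C2 * h\<^sup>2"
      using C2(3)[of h "Y t" W] t Yt W by simp
    have "linear (?D (Y t))" using fD unfolding quad_deriv_def by blast
    from linear_0[OF this] have D0: "?D (Y t) (Y t - Y t) = 0" by simp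
    have "norm (Y (t + h) - Y t - h *\<^sub>R ?f (Y t) - h *\<^sub>R ?D (Y t) (Y t - Y t)
        - (h\<^sup>2 / 2) *\<^sub>R ?D (Y t) (?f (Y t))) \<le> C1 * \<bar>h\<bar> ^ 3"
      using C1(2)[of t h] t unfolding D0 by simp
    then have ex: "norm (Y (t + h) - Y t - h *\<^sub>R ?f (Y t)) \<le> (B * 0 + B * F + C1) * h\<^sup>2"
      using t by (intro expansion_first_order[where D = "?D (Y t)", OF B(2)[OF Yt] B(1) F(2)[OF Yt] _ C1(1)]) auto
    have "norm (W - Y (t + h)) \<le> norm (W - Y t - h *\<^sub>R ?f (Y t)) + norm (Y (t + h) - Y t - h *\<^sub>R ?f (Y t))"
      using norm_triangle_ineq4[of "W - Y t - h *\<^sub>R ?f (Y t)" "Y (t + h) - Y t - h *\<^sub>R ?f (Y t)"] by simp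
    also have "\<dots> \<le> (C2 + (B * 0 + B * F + C1)) * h\<^sup>2"
      using num ex by (simp add: distrib_right)
    finally show "norm (W - Y (t + h)) \<le> (C2 + (B * 0 + B * F + C1)) * h ^ Suc 1"
      by (simp add: numeral_2_eq_2)
  qed simp
qed

theorem strang_converges:
  fixes f1 f2 :: "'a::real_normed_vector \<Rightarrow> 'a"
  assumes f: "quad_deriv f1 D1" "quad_deriv f2 D2"
    and \<Phi>: "expands_to_second_order \<Phi>1 f1 D1" "expands_to_second_order \<Phi>2 f2 D2"
    and stable: "stable_step \<Phi>1" "stable_step \<Phi>2"
  shows "convergence_order (\<lambda>Y. f1 Y + f2 Y) (strang \<Phi>1 \<Phi>2) 2"
  unfolding convergence_order_def
proof (intro allI impI, elim conjE)
  fix T :: real and Y assume "0 \<le> T" and Y: "ode_solution (\<lambda>Y. f1 Y + f2 Y) T Y"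
  let ?f = "\<lambda>Y. f1 Y + f2 Y" and ?D = "\<lambda>x v. D1 x v + D2 x v"
  have fD: "quad_deriv ?f ?D" by (rule quad_deriv_add[OF f])
  obtain R where R: "R \<ge> 0" "\<And>t. 0 \<le> t \<Longrightarrow> t \<le> T \<Longrightarrow> norm (Y t) \<le> R"
    using ode_solution_bounded[OF Y] by blast
  obtain C1 where C1: "C1 \<ge> 0" "\<And>t h. 0 \<le> t \<Longrightarrow> 0 \<le> h \<Longrightarrow> t + h \<le> T \<Longrightarrow>
    norm (Y (t + h) - Y t - h *\<^sub>R ?f (Y t) - (h\<^sup>2 / 2) *\<^sub>R ?D (Y t) (?f (Y t))) \<le> C1 * h ^ 3"
    using exact_expansion[OF fD Y] by blast
  obtain \<delta> C2 where C2: "\<delta> > 0" "C2 \<ge> 0" "\<And>h X W. \<bar>h\<bar> \<le> \<delta> \<Longrightarrow> norm X \<le> R \<Longrightarrow>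
    strang \<Phi>1 \<Phi>2 h X = Some W \<Longrightarrow> norm (W - X - h *\<^sub>R ?f X - (h\<^sup>2 / 2) *\<^sub>R ?D X (?f X)) \<le> C2 * \<bar>h\<bar> ^ 3"
    using strang_local_error[OF f \<Phi> stable, of R] by blast
  show "\<exists>E. \<exists>\<delta>>0. \<forall>h n. 0 < h \<and> h \<le> \<delta> \<and> real n * h \<le> T \<longrightarrow>
    (\<exists>Z. iterate (strang \<Phi>1 \<Phi>2 h) n (Y 0) = Some Z \<and> norm (Z - Y (real n * h)) \<le> E * h ^ 2)"
  proof (rule stable_step_convergence[OF strang_stable[OF stable] _ Y \<open>0 \<le> T\<close>])
    show "\<delta> > 0" by fact
    show "C2 + C1 \<ge> 0" using C1(1) C2(2) by simp
    fix t h W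
    assume t: "0 \<le> t" "0 < h" "h \<le> \<delta>" "t + h \<le> T" and W: "strang \<Phi>1 \<Phi>2 h (Y t) = Some W"
    define P where "P = Y t + h *\<^sub>R ?f (Y t) + (h\<^sup>2 / 2) *\<^sub>R ?D (Y t) (?f (Y t))"
    have "norm (W - P) \<le> C2 * h ^ 3"
      using C2(3)[of h "Y t" W] t R(2)[of t] W unfolding P_def by (simp add: diff_diff_eq add.assoc)
    moreover have "norm (Y (t + h) - P) \<le> C1 * h ^ 3"
      using C1(2)[of t h] t unfolding P_def by (simp add: diff_diff_eq add.assoc)
    moreover have "norm (W - Y (t + h)) \<le> norm (W - P) + norm (Y (t + h) - P)"
      using norm_triangle_ineq4[of "W - P" "Y (t + h) - P"] by simp
    ultimately show "norm (W - Y (t + h)) \<le> (C2 + C1) * h ^ Suc 2"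
      by (simp add: distrib_right eval_nat_numeral)
  qed simp
qed

section \<open>The semi-discrete vector fields\<close>

lemma cell_unique:
  assumes "\<Delta>\<xi> > 0" and "inj ix" and "\<eta> \<in> cell \<Delta>\<xi> ix i" and "\<eta> \<in> cell \<Delta>\<xi> ix j"
  shows "i = j"
proof -
  have "ix k = \<lfloor>\<eta> / \<Delta>\<xi>\<rfloor>" if "\<eta> \<in> cell \<Delta>\<xi> ix k" for k
  proof (rule floor_unique[symmetric])
    show "of_int (ix k) \<le> \<eta> / \<Delta>\<xi>" "\<eta> / \<Delta>\<xi> < of_int (ix k) + 1"
      using that \<open>\<Delta>\<xi> > 0\<close> unfolding cell_def by (auto simp: field_simps)
  qed
  with assms(3,4) have "ix i = ix j" by simp
  with \<open>inj ix\<close> show ?thesis by (simp add: inj_eq)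
qed

lemma grid_interval_iff:
  assumes "\<Delta>\<xi> > 0" and "bij_betw ix UNIV {- int N ..< int N}"
  shows "- (real N * \<Delta>\<xi>) \<le> \<eta> \<and> \<eta> < real N * \<Delta>\<xi> \<longleftrightarrow> (\<exists>i. \<eta> \<in> cell \<Delta>\<xi> ix i)"
proof
  assume \<eta>: "- (real N * \<Delta>\<xi>) \<le> \<eta> \<and> \<eta> < real N * \<Delta>\<xi>"
  define k where "k = \<lfloor>\<eta> / \<Delta>\<xi>\<rfloor>"
  have "- real N \<le> \<eta> / \<Delta>\<xi>" "\<eta> / \<Delta>\<xi> < real N"
    using \<eta> \<open>\<Delta>\<xi> > 0\<close> by (auto simp: field_simps)
  then have "k \<in> {- int N ..< int N}"
    unfolding k_def by (auto simp: le_floor_iff floor_less_iff)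
  then obtain i where i: "ix i = k"
    using assms(2) unfolding bij_betw_def by (metis (no_types, lifting) imageE)
  have "of_int k \<le> \<eta> / \<Delta>\<xi>" "\<eta> / \<Delta>\<xi> < of_int k + 1"
    unfolding k_def by linarith+
  then have "\<eta> \<in> cell \<Delta>\<xi> ix i"
    using \<open>\<Delta>\<xi> > 0\<close> unfolding cell_def i by (auto simp: field_simps)
  then show "\<exists>i. \<eta> \<in> cell \<Delta>\<xi> ix i" ..
next
  assume "\<exists>i. \<eta> \<in> cell \<Delta>\<xi> ix i"
  then obtain i where i: "of_int (ix i) * \<Delta>\<xi> \<le> \<eta>" "\<eta> < of_int (ix i + 1) * \<Delta>\<xi>"
    unfolding cell_def by auto
  have "ix i \<in> {- int N ..< int N}"
    using bij_betwE[OF assms(2)] by blast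
  then have "- int N \<le> ix i" "ix i + 1 \<le> int N" by auto
  then have "- real N \<le> of_int (ix i)" "of_int (ix i + 1) \<le> real N"
    by linarith+
  then have "- real N * \<Delta>\<xi> \<le> of_int (ix i) * \<Delta>\<xi>" "of_int (ix i + 1) * \<Delta>\<xi> \<le> real N * \<Delta>\<xi>"
    using \<open>\<Delta>\<xi> > 0\<close> by (intro mult_right_mono; simp)+
  with i show "- (real N * \<Delta>\<xi>) \<le> \<eta> \<and> \<eta> < real N * \<Delta>\<xi>" by linarith
qed

lemma pc_in_cell:
  assumes "\<Delta>\<xi> > 0" and bij: "bij_betw ix UNIV {- int N ..< int N}" and i: "\<eta> \<in> cell \<Delta>\<xi> ix i"
  shows "pc N \<Delta>\<xi> ix l v r \<eta> = v $ i"
proof -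
  have "inj ix" using bij by (rule bij_betw_imp_inj_on)
  then have "(THE k. \<eta> \<in> cell \<Delta>\<xi> ix k) = i"
    using cell_unique[OF \<open>\<Delta>\<xi> > 0\<close> _ _ i] by (intro the_equality i)
  moreover have "- (real N * \<Delta>\<xi>) \<le> \<eta>" "\<eta> < real N * \<Delta>\<xi>"
    using grid_interval_iff[OF assms(1,2)] i by blast+
  ultimately show ?thesis unfolding pc_def by simp
qed

lemma pc_outside:
  assumes "\<Delta>\<xi> > 0" and "bij_betw ix UNIV {- int N ..< int N}" and "\<And>i. \<eta> \<notin> cell \<Delta>\<xi> ix i"
  shows "pc N \<Delta>\<xi> ix c v c \<eta> = c"
  using grid_interval_iff[OF assms(1,2), of \<eta>] assms(3) unfolding pc_def by auto

text \<open>
  The value of the integrals behind \<open>P\<close> and \<open>Q\<close> at the \<open>i\<close>-th grid point, where the weight \<open>c i j\<close> is the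
  integral of the state-independent part of the kernel over the \<open>j\<close>-th cell.
\<close>

definition kernel_sum ::
    "real \<Rightarrow> ('n::finite \<Rightarrow> int) \<Rightarrow> ('n \<Rightarrow> 'n \<Rightarrow> real) \<Rightarrow> 'n state \<Rightarrow> 'n \<Rightarrow> real" where
  "kernel_sum \<gamma> ix c Y i = (\<Sum>j\<in>UNIV. c i j *
     exp (- (sgn (of_int (ix i - ix j)) * (fst Y $ i - fst Y $ j))) *
     ((3 - 2 * \<gamma>) / 2 * (fst (snd Y) $ j)\<^sup>2 * (fst (snd (snd (snd Y))) $ j)
       + \<gamma> / 2 * (snd (snd (snd (snd (snd Y)))) $ j)))"

text \<open>
  As \<open>y(\<xi>) = \<xi> + \<zeta>(\<xi>)\<close>, the exponential factors into \<open>exp (- \<bar>\<xi>\<^sub>i - \<eta>\<bar>)\<close> and an exponential in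
  \<open>\<zeta>\<^sub>i - \<zeta>\<^sub>j\<close> on the \<open>j\<close>-th cell. Grid points are left end points of cells, so for \<open>j \<noteq> i\<close> the sign of
  \<open>\<xi>\<^sub>i - \<eta>\<close> is the same on the whole cell; for \<open>j = i\<close> it multiplies \<open>\<zeta>\<^sub>i - \<zeta>\<^sub>i = 0\<close>. The function \<open>g\<close> is
  the constant \<open>1\<close> for \<open>P\<close> and the sign function for \<open>Q\<close>.
\<close>

lemma kernel_integral:
  fixes g :: "real \<Rightarrow> real" and \<gamma> zl zr :: real and ix :: "'n::finite \<Rightarrow> int"
  assumes \<Delta>\<xi>: "\<Delta>\<xi> > 0" and bij: "bij_betw ix UNIV {- int N ..< int N}"
    and g: "g \<in> borel_measurable borel" "\<And>x. \<bar>g x\<bar> \<le> 1"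
  shows "\<exists>c. \<forall>Y i. (LINT \<eta>|lborel. g (of_int (ix i) * \<Delta>\<xi> - \<eta>) *
      exp (- sgn (of_int (ix i) * \<Delta>\<xi> - \<eta>) *
        (y_fun N \<Delta>\<xi> ix zl zr Y (of_int (ix i) * \<Delta>\<xi>) - y_fun N \<Delta>\<xi> ix zl zr Y \<eta>)) *
      source \<gamma> N \<Delta>\<xi> ix Y \<eta>) = kernel_sum \<gamma> ix c Y i"
proof -
  define x where "x i = of_int (ix i) * \<Delta>\<xi>" for i
  define w where "w i j \<eta> = indicator (cell \<Delta>\<xi> ix j) \<eta> *\<^sub>R (g (x i - \<eta>) * exp (- \<bar>x i - \<eta>\<bar>))" for i j \<eta>
  define c where "c i j = (LINT \<eta>|lborel. w i j \<eta>)" for i j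
  have int: "integrable lborel (w i j)" for i j
    unfolding w_def
  proof (rule integrableI_bounded_set_indicator[where B = 1])
    show "cell \<Delta>\<xi> ix j \<in> sets lborel" "emeasure lborel (cell \<Delta>\<xi> ix j) < \<infinity>"
      unfolding cell_def using \<Delta>\<xi> by (auto simp: mult_right_mono)
    show "(\<lambda>\<eta>. g (x i - \<eta>) * exp (- \<bar>x i - \<eta>\<bar>)) \<in> borel_measurable lborel"
      using g(1) by measurable
    have "\<bar>g (x i - \<eta>) * exp (- \<bar>x i - \<eta>\<bar>)\<bar> \<le> 1 * 1" for \<eta>
      unfolding abs_mult by (intro mult_mono g(2)) auto
    then show "AE \<eta> \<in> cell \<Delta>\<xi> ix j in lborel. norm (g (x i - \<eta>) * exp (- \<bar>x i - \<eta>\<bar>)) \<le> 1"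
      by simp
  qed
  have grid: "x i \<in> cell \<Delta>\<xi> ix i" for i
    unfolding cell_def x_def using \<Delta>\<xi> by (simp add: distrib_right)
  have inj: "inj ix" using bij by (rule bij_betw_imp_inj_on)
  have sgn: "sgn (x i - \<eta>) * d = sgn (of_int (ix i - ix j)) * d"
    if \<eta>: "\<eta> \<in> cell \<Delta>\<xi> ix j" and d: "i = j \<longrightarrow> d = 0" for i j \<eta> d
  proof -
    consider "i = j" | "ix i < ix j" | "ix j < ix i"
      using inj by (metis injD linorder_neqE)
    then show ?thesis
    proof cases
      case 1
      then show ?thesis using d by simp
    next
      case 2
      then have "x i < x j" unfolding x_def using \<Delta>\<xi> by simp
      then have "x i < \<eta>" using \<eta> unfolding cell_def x_def by simp
      with 2 show ?thesis by simp
    next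
      case 3
      then have "of_int (ix j + 1) * \<Delta>\<xi> \<le> x i"
        unfolding x_def using \<Delta>\<xi> by (intro mult_right_mono) linarith+
      then have "\<eta> < x i" using \<eta> unfolding cell_def by simp
      with 3 show ?thesis by simp
    qed
  qed
  have "(LINT \<eta>|lborel. g (x i - \<eta>) *
      exp (- sgn (x i - \<eta>) * (y_fun N \<Delta>\<xi> ix zl zr Y (x i) - y_fun N \<Delta>\<xi> ix zl zr Y \<eta>)) *
      source \<gamma> N \<Delta>\<xi> ix Y \<eta>) = kernel_sum \<gamma> ix c Y i" for Y i
  proof -
    obtain \<zeta> U H q w' h where Y: "Y = (\<zeta>, U, H, q, w', h)" by (metis prod.exhaust)
    define S where "S j = (3 - 2 * \<gamma>) / 2 * (U $ j)\<^sup>2 * (q $ j) + \<gamma> / 2 * (h $ j)" for j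
    define e where "e j = exp (- (sgn (of_int (ix i - ix j)) * (\<zeta> $ i - \<zeta> $ j)))" for j
    have integrand: "g (x i - \<eta>) *
        exp (- sgn (x i - \<eta>) * (y_fun N \<Delta>\<xi> ix zl zr Y (x i) - y_fun N \<Delta>\<xi> ix zl zr Y \<eta>)) *
        source \<gamma> N \<Delta>\<xi> ix Y \<eta> = (\<Sum>j\<in>UNIV. w i j \<eta> * (e j * S j))" for \<eta>
    proof (cases "\<exists>j. \<eta> \<in> cell \<Delta>\<xi> ix j")
      case True
      then obtain j where j: "\<eta> \<in> cell \<Delta>\<xi> ix j" ..
      have "w i k \<eta> = 0" if "k \<noteq> j" for k
        using cell_unique[OF \<Delta>\<xi> inj j, of k] that unfolding w_def by (auto simp: indicator_def)
      then have "(\<Sum>k\<in>UNIV. w i k \<eta> * (e k * S k)) = (\<Sum>k\<in>UNIV. if k = j then w i j \<eta> * (e j * S j) else 0)"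
        by (intro sum.cong) auto
      also have "\<dots> = w i j \<eta> * (e j * S j)" by simp
      also have "w i j \<eta> = g (x i - \<eta>) * exp (- \<bar>x i - \<eta>\<bar>)"
        unfolding w_def using j by simp
      also have "g (x i - \<eta>) * exp (- \<bar>x i - \<eta>\<bar>) * (e j * S j)
          = g (x i - \<eta>) * exp (- \<bar>x i - \<eta>\<bar> - sgn (x i - \<eta>) * (\<zeta> $ i - \<zeta> $ j)) * S j"
      proof -
        have "sgn (x i - \<eta>) * (\<zeta> $ i - \<zeta> $ j) = sgn (of_int (ix i - ix j)) * (\<zeta> $ i - \<zeta> $ j)"
          using j by (rule sgn) simp
        then have "exp (- \<bar>x i - \<eta>\<bar> - sgn (x i - \<eta>) * (\<zeta> $ i - \<zeta> $ j)) = exp (- \<bar>x i - \<eta>\<bar>) * e j"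
          unfolding e_def by (simp only: diff_conv_add_uminus exp_add)
        then show ?thesis by simp
      qed
      also have "- \<bar>x i - \<eta>\<bar> - sgn (x i - \<eta>) * (\<zeta> $ i - \<zeta> $ j)
          = - sgn (x i - \<eta>) * (y_fun N \<Delta>\<xi> ix zl zr Y (x i) - y_fun N \<Delta>\<xi> ix zl zr Y \<eta>)"
        unfolding Y y_fun.simps pc_in_cell[OF \<Delta>\<xi> bij grid] pc_in_cell[OF \<Delta>\<xi> bij j]
        by (simp add: abs_sgn algebra_simps)
      also have "S j = source \<gamma> N \<Delta>\<xi> ix Y \<eta>"
        unfolding S_def Y source.simps pc_in_cell[OF \<Delta>\<xi> bij j] ..
      finally show ?thesis by simp
    next
      case False
      then have "source \<gamma> N \<Delta>\<xi> ix Y \<eta> = 0"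
        unfolding Y source.simps using pc_outside[OF \<Delta>\<xi> bij] by simp
      moreover have "w i j \<eta> = 0" for j
        unfolding w_def using False by (simp add: indicator_def)
      ultimately show ?thesis by simp
    qed
    have "(LINT \<eta>|lborel. (\<Sum>j\<in>UNIV. w i j \<eta> * (e j * S j))) = (\<Sum>j\<in>UNIV. c i j * (e j * S j))"
      unfolding c_def using int by (subst Bochner_Integration.integral_sum) auto
    then show ?thesis
      unfolding integrand by (simp add: kernel_sum_def Y e_def S_def mult.assoc)
  qed
  then show ?thesis unfolding x_def by blast
qed

lemma P_vec_kernel_sum:
  assumes "\<Delta>\<xi> > 0" and "bij_betw ix UNIV {- int N ..< int N}"
  obtains c where "\<And>Y i. P_vec \<gamma> N \<Delta>\<xi> ix zl zr Y $ i = 1 / 2 * kernel_sum \<gamma> ix c Y i"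
proof -
  obtain c where c: "\<forall>Y i. (LINT \<eta>|lborel. 1 *
      exp (- sgn (of_int (ix i) * \<Delta>\<xi> - \<eta>) *
        (y_fun N \<Delta>\<xi> ix zl zr Y (of_int (ix i) * \<Delta>\<xi>) - y_fun N \<Delta>\<xi> ix zl zr Y \<eta>)) *
      source \<gamma> N \<Delta>\<xi> ix Y \<eta>) = kernel_sum \<gamma> ix c Y i"
    using kernel_integral[OF assms, of "\<lambda>_. 1" zl zr \<gamma>] by auto
  show ?thesis
    by (rule that[of c]) (simp only: P_vec_def P_fun_def vec_lambda_beta c[unfolded mult_1_left])
qed

lemma Q_vec_kernel_sum:
  assumes "\<Delta>\<xi> > 0" and "bij_betw ix UNIV {- int N ..< int N}"
  obtains c where "\<And>Y i. Q_vec \<gamma> N \<Delta>\<xi> ix zl zr Y $ i = - (1 / 2) * kernel_sum \<gamma> ix c Y i"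
proof -
  have "\<bar>sgn x\<bar> \<le> 1" for x :: real by (simp add: sgn_if)
  then obtain c where c: "\<forall>Y i. (LINT \<eta>|lborel. sgn (of_int (ix i) * \<Delta>\<xi> - \<eta>) *
      exp (- sgn (of_int (ix i) * \<Delta>\<xi> - \<eta>) *
        (y_fun N \<Delta>\<xi> ix zl zr Y (of_int (ix i) * \<Delta>\<xi>) - y_fun N \<Delta>\<xi> ix zl zr Y \<eta>)) *
      source \<gamma> N \<Delta>\<xi> ix Y \<eta>) = kernel_sum \<gamma> ix c Y i"
    using kernel_integral[OF assms, of sgn zl zr \<gamma>] borel_measurable_sgn by blast
  show ?thesis
    by (rule that[of c]) (simp only: Q_vec_def Q_fun_def vec_lambda_beta c)
qed

lemmas bounded_linear_state =
  bounded_linear_fst bounded_linear_snd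
  bounded_linear_compose[OF bounded_linear_fst] bounded_linear_compose[OF bounded_linear_snd]

lemmas quad_smooth_component =
  quad_smooth_compose[OF quad_smooth_bounded_linear[OF bounded_linear_vec_nth] quad_smooth_bounded_linear]

lemmas quad_smooth_intros =
  quad_smooth_const quad_smooth_add quad_smooth_diff quad_smooth_minus quad_smooth_mult quad_smooth_power
  quad_smooth_exp quad_smooth_sum quad_smooth_vec quad_smooth_Pair

lemma quad_smooth_kernel_sum: "quad_smooth (\<lambda>Y. kernel_sum \<gamma> ix c Y i)"
  unfolding kernel_sum_def
  by (intro quad_smooth_intros quad_smooth_component bounded_linear_state)

theorem G1_quad_smooth:
  assumes "\<Delta>\<xi> > 0" and "bij_betw ix UNIV {- int N ..< int N}"
  shows "quad_smooth (G1 \<gamma> N \<Delta>\<xi> ix zl zr)"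
proof -
  obtain c where P: "\<And>Y i. P_vec \<gamma> N \<Delta>\<xi> ix zl zr Y $ i = 1 / 2 * kernel_sum \<gamma> ix c Y i"
    using P_vec_kernel_sum[OF assms] by blast
  have "G1 \<gamma> N \<Delta>\<xi> ix zl zr = (\<lambda>Y. (0, 0, 0,
        (\<chi> i. \<gamma> * fst (snd (snd (snd (snd Y)))) $ i),
        (\<chi> i. \<gamma> / 2 * snd (snd (snd (snd (snd Y)))) $ i
          + ((3 - 2 * \<gamma>) / 2 * (fst (snd Y) $ i)\<^sup>2 - 1 / 2 * kernel_sum \<gamma> ix c Y i) * fst (snd (snd (snd Y))) $ i),
        (\<chi> i. (3 * (fst (snd Y) $ i)\<^sup>2 - 2 * (1 / 2 * kernel_sum \<gamma> ix c Y i)) * fst (snd (snd (snd (snd Y)))) $ i)))"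
    by (rule ext) (simp add: P Let_def split_paired_all)
  moreover have "quad_smooth \<dots>"
    by (intro quad_smooth_intros quad_smooth_component bounded_linear_state quad_smooth_kernel_sum)
  ultimately show ?thesis by simp
qed

theorem G2_quad_smooth:
  assumes "\<Delta>\<xi> > 0" and "bij_betw ix UNIV {- int N ..< int N}"
  shows "quad_smooth (G2 \<gamma> N \<Delta>\<xi> ix zl zr)"
proof -
  obtain c where P: "\<And>Y i. P_vec \<gamma> N \<Delta>\<xi> ix zl zr Y $ i = 1 / 2 * kernel_sum \<gamma> ix c Y i"
    using P_vec_kernel_sum[OF assms] by blast
  obtain d where Q: "\<And>Y i. Q_vec \<gamma> N \<Delta>\<xi> ix zl zr Y $ i = - (1 / 2) * kernel_sum \<gamma> ix d Y i"
    using Q_vec_kernel_sum[OF assms] by blast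
  have "G2 \<gamma> N \<Delta>\<xi> ix zl zr = (\<lambda>Y. (
        (\<chi> i. \<gamma> * fst (snd Y) $ i),
        (\<chi> i. - (- (1 / 2) * kernel_sum \<gamma> ix d Y i)),
        (\<chi> i. (fst (snd Y) $ i) ^ 3 - 2 * (1 / 2 * kernel_sum \<gamma> ix c Y i) * fst (snd Y) $ i),
        0, 0,
        (\<chi> i. - 2 * (- (1 / 2) * kernel_sum \<gamma> ix d Y i) * fst (snd Y) $ i * fst (snd (snd (snd Y))) $ i)))"
    by (rule ext) (simp add: P Q Let_def split_paired_all)
  moreover have "quad_smooth \<dots>"
    by (intro quad_smooth_intros quad_smooth_component bounded_linear_state quad_smooth_kernel_sum)
  ultimately show ?thesis by simp
qed

section \<open>Preservation of the invariants\<close>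

text \<open>
  The \<open>i\<close>-th invariant as a quadratic form in two guises: with \<open>\<kappa> = U\<^sub>i\<^sup>2, \<mu> = 0\<close> on states with a given \<open>U\<^sub>i\<close>,
  and with \<open>\<kappa> = 0, \<mu> = q\<^sub>i\<^sup>2\<close> on states with a given \<open>q\<^sub>i\<close>.
\<close>

definition inv_form :: "real \<Rightarrow> real \<Rightarrow> 'n::finite \<Rightarrow> 'n state \<Rightarrow> 'n state \<Rightarrow> real" where
  "inv_form \<kappa> \<mu> i x y =
     \<kappa> * (fst (snd (snd (snd x))) $ i * fst (snd (snd (snd y))) $ i)
       + \<mu> * (fst (snd x) $ i * fst (snd y) $ i)
       + fst (snd (snd (snd (snd x)))) $ i * fst (snd (snd (snd (snd y)))) $ i
       - (fst (snd (snd (snd x))) $ i * snd (snd (snd (snd (snd y)))) $ i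
          + snd (snd (snd (snd (snd x)))) $ i * fst (snd (snd (snd y))) $ i) / 2"

lemma inv_form_commute: "inv_form \<kappa> \<mu> i x y = inv_form \<kappa> \<mu> i y x"
  unfolding inv_form_def by (simp add: mult.commute add.commute)

lemma bilinear_inv_form: "bilinear (inv_form \<kappa> \<mu> i)"
proof -
  have lin: "linear (inv_form \<kappa> \<mu> i x)" for x
  proof (rule linearI)
    show "inv_form \<kappa> \<mu> i x (y + z) = inv_form \<kappa> \<mu> i x y + inv_form \<kappa> \<mu> i x z" for y z
      unfolding inv_form_def by (simp add: distrib_left add_divide_distrib)
    show "inv_form \<kappa> \<mu> i x (r *\<^sub>R y) = r *\<^sub>R inv_form \<kappa> \<mu> i x y" for r y
      unfolding inv_form_def by (simp add: field_simps)
  qed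
  have "(\<lambda>x. inv_form \<kappa> \<mu> i x y) = inv_form \<kappa> \<mu> i y" for y
    by (rule ext) (rule inv_form_commute)
  with lin show ?thesis unfolding bilinear_def by simp
qed

text \<open>
  The stages have no \<open>U\<close> component, so all states involved share the value of \<open>U\<^sub>i\<close> and the invariant is a
  fixed quadratic form on them. Likewise with \<open>q\<^sub>i\<close> for the second system below.
\<close>

lemma G1_step_preserves:
  fixes ix :: "'n::finite \<Rightarrow> int"
  assumes coeff: "\<forall>i<s. \<forall>j<s. b i * a i j + b j * a j i = b i * b j"
    and K: "rk_stages s a (G1 \<gamma> N \<Delta>\<xi> ix zl zr) h Y K"
  shows "inv_I i (rk_update s b h Y K) = inv_I i Y"
proof -
  define u where "u = fst (snd Y) $ i"
  define B where "B = inv_form (u\<^sup>2) 0 i"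
  have inv: "inv_I i x = B x x" if "fst (snd x) $ i = u" for x
    using that unfolding B_def inv_form_def by (cases x rule: prod_cases6) (simp add: power2_eq_square)
  have frozen: "fst (snd (G1 \<gamma> N \<Delta>\<xi> ix zl zr x)) = 0" for x
    by (cases x rule: prod_cases6) (simp add: Let_def)
  have stage: "fst (snd (K j)) = 0" if "j < s" for j
    using K that frozen unfolding rk_stages_def by simp
  have const: "fst (snd (Y + h *\<^sub>R (\<Sum>j<s. c j *\<^sub>R K j))) $ i = u" for c
    unfolding u_def by (simp add: fst_sum snd_sum stage)
  have tangent: "B x (G1 \<gamma> N \<Delta>\<xi> ix zl zr x) = 0" if "fst (snd x) $ i = u" for x
    using that unfolding B_def inv_form_def
    by (cases x rule: prod_cases6)
       (simp add: Let_def algebra_simps power2_eq_square add_divide_distrib diff_divide_distrib)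
  have "B (rk_update s b h Y K) (rk_update s b h Y K) = B Y Y"
  proof (rule rk_preserves_quadratic[where B = B, OF _ _ coeff])
    show "bilinear B" unfolding B_def by (rule bilinear_inv_form)
    show "B x y = B y x" for x y unfolding B_def by (rule inv_form_commute)
    show "B (Y + h *\<^sub>R (\<Sum>k<s. a j k *\<^sub>R K k)) (K j) = 0" if "j < s" for j
    proof -
      let ?y = "Y + h *\<^sub>R (\<Sum>k<s. a j k *\<^sub>R K k)"
      have "K j = G1 \<gamma> N \<Delta>\<xi> ix zl zr ?y"
        using K that unfolding rk_stages_def by blast
      from trans[OF arg_cong[OF this, of "B ?y"] tangent[OF const]] show ?thesis .
    qed
  qed
  then show ?thesis
    using inv const[of b] by (simp add: rk_update_def u_def)
qed

lemma G2_step_preserves: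
  fixes ix :: "'n::finite \<Rightarrow> int"
  assumes coeff: "\<forall>i<s. \<forall>j<s. b i * a i j + b j * a j i = b i * b j"
    and K: "rk_stages s a (G2 \<gamma> N \<Delta>\<xi> ix zl zr) h Y K"
  shows "inv_I i (rk_update s b h Y K) = inv_I i Y"
proof -
  define p where "p = fst (snd (snd (snd Y))) $ i"
  define B where "B = inv_form 0 (p\<^sup>2) i"
  have inv: "inv_I i x = B x x" if "fst (snd (snd (snd x))) $ i = p" for x
    using that unfolding B_def inv_form_def by (cases x rule: prod_cases6) (simp add: power2_eq_square)
  have frozen: "fst (snd (snd (snd (G2 \<gamma> N \<Delta>\<xi> ix zl zr x)))) = 0" for x
    by (cases x rule: prod_cases6) (simp add: Let_def)
  have stage: "fst (snd (snd (snd (K j)))) = 0" if "j < s" for j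
    using K that frozen unfolding rk_stages_def by simp
  have const: "fst (snd (snd (snd (Y + h *\<^sub>R (\<Sum>j<s. c j *\<^sub>R K j))))) $ i = p" for c
    unfolding p_def by (simp add: fst_sum snd_sum stage)
  have tangent: "B x (G2 \<gamma> N \<Delta>\<xi> ix zl zr x) = 0" if "fst (snd (snd (snd x))) $ i = p" for x
    using that unfolding B_def inv_form_def
    by (cases x rule: prod_cases6)
       (simp add: Let_def algebra_simps power2_eq_square)
  have "B (rk_update s b h Y K) (rk_update s b h Y K) = B Y Y"
  proof (rule rk_preserves_quadratic[where B = B, OF _ _ coeff])
    show "bilinear B" unfolding B_def by (rule bilinear_inv_form)
    show "B x y = B y x" for x y unfolding B_def by (rule inv_form_commute)
    show "B (Y + h *\<^sub>R (\<Sum>k<s. a j k *\<^sub>R K k)) (K j) = 0" if "j < s" for j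
    proof -
      let ?y = "Y + h *\<^sub>R (\<Sum>k<s. a j k *\<^sub>R K k)"
      have "K j = G2 \<gamma> N \<Delta>\<xi> ix zl zr ?y"
        using K that unfolding rk_stages_def by blast
      from trans[OF arg_cong[OF this, of "B ?y"] tangent[OF const]] show ?thesis .
    qed
  qed
  then show ?thesis
    using inv const[of b] by (simp add: rk_update_def p_def)
qed

lemma rk_method_preserves:
  assumes "rk_method s a b f \<Phi>"
    and "\<And>h Y K. rk_stages s a f h Y K \<Longrightarrow> J (rk_update s b h Y K) = J Y"
  shows "preserves \<Phi> J"
  unfolding preserves_def
proof (intro allI impI)
  fix h Y Y1 assume "\<Phi> h Y = Some Y1"
  then obtain K where "rk_stages s a f h Y K" "Y1 = rk_update s b h Y K"
    using assms(1) unfolding rk_method_def by blast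
  then show "J Y1 = J Y" using assms(2) by simp
qed

lemma lie_trotter_preserves:
  "preserves \<Phi>1 J \<Longrightarrow> preserves \<Phi>2 J \<Longrightarrow> preserves (lie_trotter \<Phi>1 \<Phi>2) J"
  unfolding preserves_def lie_trotter_def by (auto simp: map_comp_Some_iff)

lemma strang_preserves:
  "preserves \<Phi>1 J \<Longrightarrow> preserves \<Phi>2 J \<Longrightarrow> preserves (strang \<Phi>1 \<Phi>2) J"
  unfolding preserves_def strang_def by (auto simp: map_comp_Some_iff)

section \<open>Splitting of the semi-discrete system\<close>

theorem theorem7p3:
  fixes \<gamma> \<Delta>\<xi> zl zr :: real and N s1 s2 :: nat and ix :: "'n::finite \<Rightarrow> int"
    and a1 a2 :: "nat \<Rightarrow> nat \<Rightarrow> real" and b1 b2 :: "nat \<Rightarrow> real"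
  assumes "\<Delta>\<xi> > 0"
    and "bij_betw ix UNIV {- int N ..< int N}"
    and "\<forall>i<s1. \<forall>j<s1. b1 i * a1 i j + b1 j * a1 j i = b1 i * b1 j"
    and "\<forall>i<s2. \<forall>j<s2. b2 i * a2 i j + b2 j * a2 j i = b2 i * b2 j"
  shows
    "(\<exists>\<Phi>1. rk_method s1 a1 b1 (G1 \<gamma> N \<Delta>\<xi> ix zl zr) \<Phi>1) \<and>
     (\<exists>\<Phi>2. rk_method s2 a2 b2 (G2 \<gamma> N \<Delta>\<xi> ix zl zr) \<Phi>2) \<and>
     (\<forall>\<Phi>1 \<Phi>2.
        rk_method s1 a1 b1 (G1 \<gamma> N \<Delta>\<xi> ix zl zr) \<Phi>1 \<and>
        rk_method s2 a2 b2 (G2 \<gamma> N \<Delta>\<xi> ix zl zr) \<Phi>2 \<longrightarrow>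
          (\<forall>i. preserves (lie_trotter \<Phi>1 \<Phi>2) (inv_I i)) \<and>
          (\<forall>i. preserves (strang \<Phi>1 \<Phi>2) (inv_I i)) \<and>
          ((\<Sum>j<s1. b1 j) = 1 \<and> (\<Sum>j<s2. b2 j) = 1 \<longrightarrow>
             convergence_order (\<lambda>Y. G1 \<gamma> N \<Delta>\<xi> ix zl zr Y + G2 \<gamma> N \<Delta>\<xi> ix zl zr Y)
               (lie_trotter \<Phi>1 \<Phi>2) 1 \<and>
             convergence_order (\<lambda>Y. G1 \<gamma> N \<Delta>\<xi> ix zl zr Y + G2 \<gamma> N \<Delta>\<xi> ix zl zr Y)
               (strang \<Phi>1 \<Phi>2) 2) \<and>
          (symmetric_method \<Phi>1 \<and> symmetric_method \<Phi>2 \<longrightarrow>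
             symmetric_method (strang \<Phi>1 \<Phi>2)) \<and>
          (rk_symmetric s1 a1 b1 \<and> rk_symmetric s2 a2 b2 \<longrightarrow>
             symmetric_method (strang \<Phi>1 \<Phi>2)))"
proof -
  let ?G1 = "G1 \<gamma> N \<Delta>\<xi> ix zl zr" and ?G2 = "G2 \<gamma> N \<Delta>\<xi> ix zl zr"
  have smooth: "quad_smooth ?G1" "quad_smooth ?G2"
    by (rule G1_quad_smooth[OF assms(1,2)], rule G2_quad_smooth[OF assms(1,2)])
  then obtain D1 D2 where D: "quad_deriv ?G1 D1" "quad_deriv ?G2 D2"
    unfolding quad_smooth_def by blast
  have splittings:
    "(\<forall>i. preserves (lie_trotter \<Phi>1 \<Phi>2) (inv_I i)) \<and>
     (\<forall>i. preserves (strang \<Phi>1 \<Phi>2) (inv_I i)) \<and>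
     ((\<Sum>j<s1. b1 j) = 1 \<and> (\<Sum>j<s2. b2 j) = 1 \<longrightarrow>
        convergence_order (\<lambda>Y. ?G1 Y + ?G2 Y) (lie_trotter \<Phi>1 \<Phi>2) 1 \<and>
        convergence_order (\<lambda>Y. ?G1 Y + ?G2 Y) (strang \<Phi>1 \<Phi>2) 2) \<and>
     (symmetric_method \<Phi>1 \<and> symmetric_method \<Phi>2 \<longrightarrow> symmetric_method (strang \<Phi>1 \<Phi>2)) \<and>
     (rk_symmetric s1 a1 b1 \<and> rk_symmetric s2 a2 b2 \<longrightarrow> symmetric_method (strang \<Phi>1 \<Phi>2))"
    if rk: "rk_method s1 a1 b1 ?G1 \<Phi>1" "rk_method s2 a2 b2 ?G2 \<Phi>2" for \<Phi>1 \<Phi>2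
  proof (intro conjI)
    have stable: "stable_step \<Phi>1" "stable_step \<Phi>2"
      by (rule rk_method_stable[OF rk(1) smooth(1)], rule rk_method_stable[OF rk(2) smooth(2)])
    have pres1: "preserves \<Phi>1 (inv_I i)" for i
      using rk(1) by (rule rk_method_preserves) (rule G1_step_preserves[OF assms(3)])
    have pres2: "preserves \<Phi>2 (inv_I i)" for i
      using rk(2) by (rule rk_method_preserves) (rule G2_step_preserves[OF assms(4)])
    show "\<forall>i. preserves (lie_trotter \<Phi>1 \<Phi>2) (inv_I i)"
      using lie_trotter_preserves[OF pres1 pres2] by blast
    show "\<forall>i. preserves (strang \<Phi>1 \<Phi>2) (inv_I i)"
      using strang_preserves[OF pres1 pres2] by blast
    show "symmetric_method \<Phi>1 \<and> symmetric_method \<Phi>2 \<longrightarrow> symmetric_method (strang \<Phi>1 \<Phi>2)"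
      using strang_symmetric[OF stable] by blast
    then show "rk_symmetric s1 a1 b1 \<and> rk_symmetric s2 a2 b2 \<longrightarrow> symmetric_method (strang \<Phi>1 \<Phi>2)"
      using rk_symmetric_imp_symmetric_method[OF rk(1) smooth(1)]
        rk_symmetric_imp_symmetric_method[OF rk(2) smooth(2)] by blast
    show "(\<Sum>j<s1. b1 j) = 1 \<and> (\<Sum>j<s2. b2 j) = 1 \<longrightarrow>
        convergence_order (\<lambda>Y. ?G1 Y + ?G2 Y) (lie_trotter \<Phi>1 \<Phi>2) 1 \<and>
        convergence_order (\<lambda>Y. ?G1 Y + ?G2 Y) (strang \<Phi>1 \<Phi>2) 2"
    proof (intro impI, elim conjE)
      assume b: "(\<Sum>j<s1. b1 j) = 1" "(\<Sum>j<s2. b2 j) = 1"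
      have expands: "expands_to_second_order \<Phi>1 ?G1 D1" "expands_to_second_order \<Phi>2 ?G2 D2"
        by (rule rk_method_expands[OF rk(1) D(1) b(1) symplectic_order2[OF assms(3) b(1)]],
            rule rk_method_expands[OF rk(2) D(2) b(2) symplectic_order2[OF assms(4) b(2)]])
      show "convergence_order (\<lambda>Y. ?G1 Y + ?G2 Y) (lie_trotter \<Phi>1 \<Phi>2) 1 \<and>
          convergence_order (\<lambda>Y. ?G1 Y + ?G2 Y) (strang \<Phi>1 \<Phi>2) 2"
        using lie_trotter_converges[OF D expands stable] strang_converges[OF D expands stable] ..
    qed
  qed
  show ?thesis
    using rk_method_exists[OF smooth(1)] rk_method_exists[OF smooth(2)] splittings by blast
qed

end
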